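(* Let $F$ be an algebraically closed field and let $A$ be a finitely presented $F$-algebra. Then the action of $\mathrm{Aut}(F)$ on the class of Morita equivalence of $A$ has countably many orbits. In other words, the Morita equivalence class of $A$ is countable up to semilinear isomorphisms.
   Context: All algebras are associative with $1$ and all modules are unital. Two $F$-algebras $A,B$ are Morita equivalent if their categories of (left) modules are equivalent; equivalently, $A \cong eM_n(B)e$ for some $n \geq 1$, where $M_n(B)$ is the algebra of $n\times n$ matrices over $B$ and $e=e^2\in M_n(B)$ is a full idempotent, i.e. $M_n(B)eM_n(B)=M_n(B)$. The class of Morita equivalence of $A$ consists of all $F$-algebras that are Morita equivalent to $A$. An $F$-algebra $A$ is finitely presented if it is generated by finitely many elements $a_1,\ldots,a_m$ and the kernel of the homomorphism $F\langle x_1,\ldots,x_m\rangle \to A$, $x_i\mapsto a_i$, from the free associative algebra is generated as an ideal by a finite set. $\mathrm{Aut}(F)$ is the group of automorphisms of the field $F$. For $\sigma\in\mathrm{Aut}(F)$, a map $\varphi: B\to C$ of $F$-algebras is a $\sigma$-semilinear isomorphism if it is a ring isomorphism and $\varphi(\alpha b)=\sigma(\alpha)\varphi(b)$ for all $\alpha\in F$, $b\in B$; a semilinear isomorphism is a $\sigma$-semilinear isomorphism for some $\sigma \in \mathrm{Aut}(F)$. For an $F$-algebra $B$, the $F$-algebra $B^{(\sigma)}$ has the same ring structure as $B$ and the new multiplication by scalars $\alpha\cdot b=\sigma(\alpha)b$; the identity map $B\to B^{(\sigma^{-1})}$ is a $\sigma$-semilinear isomorphism. Semilinearly isomorphic algebras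 are Morita equivalent, so $\mathrm{Aut}(F)$ acts on the class of Morita equivalence of $A$ via the algebras $B^{(\sigma)}$, algebras being considered up to isomorphism. *)

theory Defs
  imports "HOL-Algebra.Algebra" "HOL-Library.Countable_Set"
begin

section \<open>Associative unital algebras\<close>

text \<open>The library locale \<^locale>\<open>algebra\<close> requires the algebra to be commutative, hence this
  variant. The zero algebra is allowed.\<close>

locale assoc_algebra = module R M + ring M for R (structure) and M (structure) +
  assumes smult_mult_l:
      "\<lbrakk>\<alpha> \<in> carrier R; x \<in> carrier M; y \<in> carrier M\<rbrakk> \<Longrightarrow>
        (\<alpha> \<odot>\<^bsub>M\<^esub> x) \<otimes>\<^bsub>M\<^esub> y = \<alpha> \<odot>\<^bsub>M\<^esub> (x \<otimes>\<^bsub>M\<^esub> y)"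
    and smult_mult_r:
      "\<lbrakk>\<alpha> \<in> carrier R; x \<in> carrier M; y \<in> carrier M\<rbrakk> \<Longrightarrow>
        x \<otimes>\<^bsub>M\<^esub> (\<alpha> \<odot>\<^bsub>M\<^esub> y) = \<alpha> \<odot>\<^bsub>M\<^esub> (x \<otimes>\<^bsub>M\<^esub> y)"

definition alg_iso :: "'f ring \<Rightarrow> ('f, 'a) module \<Rightarrow> ('f, 'b) module \<Rightarrow> ('a \<Rightarrow> 'b) set" where
  "alg_iso F A B = {h \<in> ring_iso A B.
     \<forall>\<alpha>\<in>carrier F. \<forall>x\<in>carrier A. h (\<alpha> \<odot>\<^bsub>A\<^esub> x) = \<alpha> \<odot>\<^bsub>B\<^esub> h x}"

definition alg_isomorphic :: "'f ring \<Rightarrow> ('f, 'a) module \<Rightarrow> ('f, 'b) module \<Rightarrow> bool" where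
  "alg_isomorphic F A B \<longleftrightarrow> alg_iso F A B \<noteq> {}"


section \<open>Finitely presented algebras\<close>

text \<open>The free algebra on generators numbered \<open>0, \<dots>, m - 1\<close>: an element is its family of
  coefficients, indexed by the words in the generators.\<close>

definition free_alg :: "'f ring \<Rightarrow> nat \<Rightarrow> ('f, nat list \<Rightarrow> 'f) module" where
  "free_alg F m = \<lparr>
     carrier = {p. (\<forall>w. p w \<in> carrier F) \<and> finite {w. p w \<noteq> \<zero>\<^bsub>F\<^esub>} \<and>
                   (\<forall>w. \<not> set w \<subseteq> {..<m} \<longrightarrow> p w = \<zero>\<^bsub>F\<^esub>)},
     monoid.mult = (\<lambda>p q w. \<Oplus>\<^bsub>F\<^esub>k\<in>{..length w}. p (take k w) \<otimes>\<^bsub>F\<^esub> q (drop k w)),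
     one = (\<lambda>w. if w = [] then \<one>\<^bsub>F\<^esub> else \<zero>\<^bsub>F\<^esub>),
     ring.zero = (\<lambda>w. \<zero>\<^bsub>F\<^esub>),
     add = (\<lambda>p q w. p w \<oplus>\<^bsub>F\<^esub> q w),
     module.smult = (\<lambda>\<alpha> p w. \<alpha> \<otimes>\<^bsub>F\<^esub> p w)\<rparr>"

definition eval_word :: "('f, 'a) module \<Rightarrow> (nat \<Rightarrow> 'a) \<Rightarrow> nat list \<Rightarrow> 'a" where
  "eval_word A a w = foldr (\<lambda>i x. a i \<otimes>\<^bsub>A\<^esub> x) w \<one>\<^bsub>A\<^esub>"

definition eval_free ::
    "'f ring \<Rightarrow> ('f, 'a) module \<Rightarrow> (nat \<Rightarrow> 'a) \<Rightarrow> (nat list \<Rightarrow> 'f) \<Rightarrow> 'a" where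
  "eval_free F A a p = (\<Oplus>\<^bsub>A\<^esub>w\<in>{w. p w \<noteq> \<zero>\<^bsub>F\<^esub>}. p w \<odot>\<^bsub>A\<^esub> eval_word A a w)"

text \<open>\<^const>\<open>genideal\<close> generates a two-sided ideal.\<close>

definition finitely_presented :: "'f ring \<Rightarrow> ('f, 'a) module \<Rightarrow> bool" where
  "finitely_presented F A \<longleftrightarrow> assoc_algebra F A \<and>
     (\<exists>m a. a \<in> {..<m} \<rightarrow> carrier A \<and>
        eval_free F A a ` carrier (free_alg F m) = carrier A \<and>
        (\<exists>S. finite S \<and> S \<subseteq> carrier (free_alg F m) \<and>
           a_kernel (free_alg F m) A (eval_free F A a) = Idl\<^bsub>free_alg F m\<^esub> S))"


section \<open>Matrix algebras and full idempotents\<close>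

definition mat_alg :: "nat \<Rightarrow> ('f, 'b) module \<Rightarrow> ('f, nat \<times> nat \<Rightarrow> 'b) module" where
  "mat_alg n B = (let I = {..<n} \<times> {..<n} in \<lparr>
     carrier = I \<rightarrow>\<^sub>E carrier B,
     monoid.mult = (\<lambda>M N. \<lambda>(i, j)\<in>I. \<Oplus>\<^bsub>B\<^esub>k\<in>{..<n}. M (i, k) \<otimes>\<^bsub>B\<^esub> N (k, j)),
     one = (\<lambda>(i, j)\<in>I. if i = j then \<one>\<^bsub>B\<^esub> else \<zero>\<^bsub>B\<^esub>),
     ring.zero = (\<lambda>_\<in>I. \<zero>\<^bsub>B\<^esub>),
     add = (\<lambda>M N. \<lambda>p\<in>I. M p \<oplus>\<^bsub>B\<^esub> N p),
     module.smult = (\<lambda>\<alpha> M. \<lambda>p\<in>I. \<alpha> \<odot>\<^bsub>B\<^esub> M p)\<rparr>)"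

definition corner :: "('f, 'a) module \<Rightarrow> 'a \<Rightarrow> ('f, 'a) module" where
  "corner R e = R\<lparr>carrier := {e \<otimes>\<^bsub>R\<^esub> x \<otimes>\<^bsub>R\<^esub> e | x. x \<in> carrier R}, one := e\<rparr>"

text \<open>\<open>R e R\<close> is the additive subgroup generated by the products \<open>x e y\<close>.\<close>

definition full_idempotent :: "('f, 'a) module \<Rightarrow> 'a \<Rightarrow> bool" where
  "full_idempotent R e \<longleftrightarrow> e \<in> carrier R \<and> e \<otimes>\<^bsub>R\<^esub> e = e \<and>
     generate (add_monoid R) {x \<otimes>\<^bsub>R\<^esub> e \<otimes>\<^bsub>R\<^esub> y | x y. x \<in> carrier R \<and> y \<in> carrier R} = carrier R"


section \<open>Field automorphisms and semilinear isomorphisms\<close>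

definition field_Aut :: "'f ring \<Rightarrow> ('f \<Rightarrow> 'f) monoid" where
  "field_Aut F = BijGroup (carrier F) \<lparr>carrier := ring_iso F F \<inter> Bij (carrier F)\<rparr>"

definition semilinear_iso ::
    "'f ring \<Rightarrow> ('f \<Rightarrow> 'f) \<Rightarrow> ('f, 'b) module \<Rightarrow> ('f, 'c) module \<Rightarrow> ('b \<Rightarrow> 'c) set" where
  "semilinear_iso F \<sigma> B C = {\<phi> \<in> ring_iso B C.
     \<forall>\<alpha>\<in>carrier F. \<forall>b\<in>carrier B. \<phi> (\<alpha> \<odot>\<^bsub>B\<^esub> b) = \<sigma> \<alpha> \<odot>\<^bsub>C\<^esub> \<phi> b}"

definition semilinearly_isomorphic :: "'f ring \<Rightarrow> ('f, 'b) module \<Rightarrow> ('f, 'c) module \<Rightarrow> bool" where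
  "semilinearly_isomorphic F B C \<longleftrightarrow> (\<exists>\<sigma>\<in>carrier (field_Aut F). semilinear_iso F \<sigma> B C \<noteq> {})"

text \<open>\<open>twist \<sigma> B\<close> is \<open>B\<close> with the scalar multiplication pulled back along \<open>\<sigma>\<close>,
  i.e. the algebra usually written \<open>B\<close> with superscript \<open>(\<sigma>)\<close>.\<close>

definition twist :: "('f \<Rightarrow> 'f) \<Rightarrow> ('f, 'b) module \<Rightarrow> ('f, 'b) module" where
  "twist \<sigma> B = B\<lparr>module.smult := (\<lambda>\<alpha> b. \<sigma> \<alpha> \<odot>\<^bsub>B\<^esub> b)\<rparr>"


section \<open>Morita equivalence\<close>

definition linearly_morita_equivalent :: "'f ring \<Rightarrow> ('f, 'a) module \<Rightarrow> ('f, 'b) module \<Rightarrow> bool" where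
  "linearly_morita_equivalent F A B \<longleftrightarrow>
     (\<exists>n\<ge>1. \<exists>e. full_idempotent (mat_alg n B) e \<and> alg_isomorphic F A (corner (mat_alg n B) e))"

text \<open>An algebra and its twist need not be equivalent by an equivalence that is linear over the
  field. The Morita class on which the automorphism group of the field acts is therefore the
  closure of the linear one under twists; it meets the same orbits. Allowing an arbitrary ring
  isomorphism in place of \<^const>\<open>alg_isomorphic\<close> would be too coarse: over a field \<open>F\<close>, the ring
  \<open>F\<close> with scalars acting through a non-surjective endomorphism of \<open>F\<close> would be equivalent
  to \<open>F\<close>.\<close>

definition morita_equivalent :: "'f ring \<Rightarrow> ('f, 'a) module \<Rightarrow> ('f, 'b) module \<Rightarrow> bool" where
  "morita_equivalent F A B \<longleftrightarrow>
     (\<exists>\<sigma>\<in>carrier (field_Aut F). linearly_morita_equivalent F A (twist \<sigma> B))"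

text \<open>The algebras in the class have their carriers in an arbitrary type \<open>'b\<close>, unrelated to the
  type of \<open>A\<close>.\<close>

definition morita_class :: "'f ring \<Rightarrow> ('f, 'a) module \<Rightarrow> ('f, 'b) module set" where
  "morita_class F A = {B. assoc_algebra F B \<and> morita_equivalent F A B}"


section \<open>The action of the automorphism group of the field\<close>

definition alg_iso_class :: "'f ring \<Rightarrow> ('f, 'b) module \<Rightarrow> ('f, 'b) module set" where
  "alg_iso_class F B = {C. assoc_algebra F C \<and> alg_isomorphic F B C}"

definition morita_iso_classes :: "'f ring \<Rightarrow> ('f, 'a) module \<Rightarrow> ('f, 'b) module set set" where
  "morita_iso_classes F A = alg_iso_class F ` morita_class F A"

text \<open>The automorphism \<open>\<sigma>\<close> sends the isomorphism class of \<open>B\<close> to that of the twist of \<open>B\<close> by the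
  inverse of \<open>\<sigma>\<close> (twisting by \<open>\<sigma>\<close> itself gives a right action with the same orbits). The union
  ranges over the representatives, all of which yield the same class.\<close>

definition Aut_action ::
    "'f ring \<Rightarrow> ('f, 'a) module \<Rightarrow> ('f \<Rightarrow> 'f) \<Rightarrow> ('f, 'b) module set \<Rightarrow> ('f, 'b) module set" where
  "Aut_action F A \<sigma> = (\<lambda>K\<in>morita_iso_classes F A.
     \<Union>B\<in>K. alg_iso_class F (twist (inv\<^bsub>field_Aut F\<^esub> \<sigma>) B))"

definition semilinear_rel :: "'f ring \<Rightarrow> ('f, 'a) module \<Rightarrow> (('f, 'b) module \<times> ('f, 'b) module) set" where
  "semilinear_rel F A = {(B, C). B \<in> morita_class F A \<and> C \<in> morita_class F A \<and>
     semilinearly_isomorphic F B C}"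


subsection \<open>Well-definedness\<close>

lemma field_Aut_simps:
  "\<sigma> \<in> carrier (field_Aut F) \<longleftrightarrow> \<sigma> \<in> ring_iso F F \<and> \<sigma> \<in> extensional (carrier F)"
  by (auto simp: field_Aut_def Bij_def ring_iso_def)

lemma subgroup_field_Aut:
  assumes "ring F"
  shows "subgroup (ring_iso F F \<inter> Bij (carrier F)) (BijGroup (carrier F))"
proof (rule subgroup.intro)
  interpret ring F by fact
  show "ring_iso F F \<inter> Bij (carrier F) \<subseteq> carrier (BijGroup (carrier F))"
    by (auto simp: BijGroup_def)
  show "x \<otimes>\<^bsub>BijGroup (carrier F)\<^esub> y \<in> ring_iso F F \<inter> Bij (carrier F)"
    if x: "x \<in> ring_iso F F \<inter> Bij (carrier F)" and y: "y \<in> ring_iso F F \<inter> Bij (carrier F)" for x y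
  proof -
    have "x \<circ> y \<in> ring_iso F F" using x y ring_iso_set_trans by blast
    moreover have "compose (carrier F) x y \<in> Bij (carrier F)" using x y compose_Bij by blast
    ultimately show ?thesis using x y
      by (auto simp: BijGroup_def ring_iso_def ring_hom_def compose_def Bij_def)
  qed
  show "\<one>\<^bsub>BijGroup (carrier F)\<^esub> \<in> ring_iso F F \<inter> Bij (carrier F)"
    by (auto simp: BijGroup_def id_Bij ring_iso_def ring_hom_def Bij_def bij_betw_def inj_on_def)
  show "inv\<^bsub>BijGroup (carrier F)\<^esub> x \<in> ring_iso F F \<inter> Bij (carrier F)"
    if x: "x \<in> ring_iso F F \<inter> Bij (carrier F)" for x
  proof -
    have "inv_into (carrier F) x \<in> ring_iso F F" using x ring_iso_set_sym[OF ring_axioms] by blast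
    moreover have "restrict (inv_into (carrier F) x) (carrier F) \<in> Bij (carrier F)"
      using x restrict_inv_into_Bij by blast
    ultimately show ?thesis using x
      by (auto simp: inv_BijGroup ring_iso_def ring_hom_def Bij_def)
  qed
qed

lemma group_field_Aut: "ring F \<Longrightarrow> group (field_Aut F)"
  unfolding field_Aut_def
  by (intro subgroup.subgroup_is_group subgroup_field_Aut group_BijGroup)

lemma field_Aut_mult:
  assumes "\<sigma> \<in> carrier (field_Aut F)" "\<tau> \<in> carrier (field_Aut F)"
  shows "\<sigma> \<otimes>\<^bsub>field_Aut F\<^esub> \<tau> = compose (carrier F) \<sigma> \<tau>"
  using assms by (auto simp: field_Aut_def BijGroup_def)

lemma field_Aut_one: "\<one>\<^bsub>field_Aut F\<^esub> = (\<lambda>x\<in>carrier F. x)"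
  by (simp add: field_Aut_def BijGroup_def)

lemma field_Aut_ring_hom: "\<sigma> \<in> carrier (field_Aut F) \<Longrightarrow> \<sigma> \<in> ring_hom F F"
  by (auto simp: field_Aut_simps ring_iso_def)

lemma field_Aut_closed: "\<sigma> \<in> carrier (field_Aut F) \<Longrightarrow> \<alpha> \<in> carrier F \<Longrightarrow> \<sigma> \<alpha> \<in> carrier F"
  using field_Aut_ring_hom ring_hom_closed by metis

lemma twist_simps [simp]:
  "carrier (twist \<sigma> B) = carrier B" "x \<otimes>\<^bsub>twist \<sigma> B\<^esub> y = x \<otimes>\<^bsub>B\<^esub> y" "\<one>\<^bsub>twist \<sigma> B\<^esub> = \<one>\<^bsub>B\<^esub>"
  "\<zero>\<^bsub>twist \<sigma> B\<^esub> = \<zero>\<^bsub>B\<^esub>" "x \<oplus>\<^bsub>twist \<sigma> B\<^esub> y = x \<oplus>\<^bsub>B\<^esub> y" "\<alpha> \<odot>\<^bsub>twist \<sigma> B\<^esub> x = \<sigma> \<alpha> \<odot>\<^bsub>B\<^esub> x"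
  "ring.truncate (twist \<sigma> B) = ring.truncate B" "add_monoid (twist \<sigma> B) = add_monoid B"
  by (auto simp: twist_def ring.defs)

lemma ring_iso_twist [simp]:
  "ring_iso (twist \<sigma> B) C = ring_iso B C" "ring_iso B (twist \<tau> C) = ring_iso B C"
  by (auto simp: ring_iso_def ring_hom_def)

lemma semilinearly_isomorphic_iff_twist:
  "semilinearly_isomorphic F B C \<longleftrightarrow> (\<exists>\<sigma>\<in>carrier (field_Aut F). alg_isomorphic F B (twist \<sigma> C))"
  by (simp add: semilinearly_isomorphic_def semilinear_iso_def alg_isomorphic_def alg_iso_def)

lemma twist_assoc_algebra:
  assumes "assoc_algebra F B" "\<sigma> \<in> carrier (field_Aut F)"
  shows "assoc_algebra F (twist \<sigma> B)"
proof -
  interpret M: ring B using assms(1) by (simp add: assoc_algebra_def)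
  interpret assoc_algebra F B by fact
  note \<sigma> = field_Aut_ring_hom[OF assms(2)]
  have B: "ring (twist \<sigma> B)"
    by (intro ringI abelian_groupI monoidI)
       (auto simp: M.add.m_ac M.m_assoc M.l_distr M.r_distr intro: M.add.l_inv_ex)
  have "module F (twist \<sigma> B)"
    using \<sigma> by (intro moduleI R.is_cring ring.is_abelian_group[OF B])
      (auto simp: ring_hom_closed ring_hom_add ring_hom_mult ring_hom_one
        smult_l_distr smult_r_distr smult_assoc1)
  then show ?thesis
    using B \<sigma> unfolding assoc_algebra_def assoc_algebra_axioms_def
    by (auto simp: ring_hom_closed smult_mult_l smult_mult_r)
qed

lemma alg_isomorphic_refl:
  assumes "carrier B = carrier C" "\<And>x y. x \<otimes>\<^bsub>B\<^esub> y = x \<otimes>\<^bsub>C\<^esub> y" "\<And>x y. x \<oplus>\<^bsub>B\<^esub> y = x \<oplus>\<^bsub>C\<^esub> y"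
    "\<one>\<^bsub>B\<^esub> = \<one>\<^bsub>C\<^esub>" "\<And>\<alpha> x. \<alpha> \<in> carrier F \<Longrightarrow> x \<in> carrier B \<Longrightarrow> \<alpha> \<odot>\<^bsub>B\<^esub> x = \<alpha> \<odot>\<^bsub>C\<^esub> x"
  shows "alg_isomorphic F B C"
proof -
  have "id \<in> alg_iso F B C"
    using assms by (auto simp: alg_iso_def ring_iso_def ring_hom_def)
  then show ?thesis by (auto simp: alg_isomorphic_def)
qed

lemma alg_isomorphic_sym:
  assumes "assoc_algebra F B" "alg_isomorphic F B C"
  shows "alg_isomorphic F C B"
proof -
  interpret M: ring B using assms(1) by (simp add: assoc_algebra_def)
  interpret assoc_algebra F B by fact
  obtain h where h: "h \<in> ring_iso B C"
    "\<And>\<alpha> x. \<alpha> \<in> carrier F \<Longrightarrow> x \<in> carrier B \<Longrightarrow> h (\<alpha> \<odot>\<^bsub>B\<^esub> x) = \<alpha> \<odot>\<^bsub>C\<^esub> h x"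
    using assms(2) by (auto simp: alg_isomorphic_def alg_iso_def)
  have b: "bij_betw h (carrier B) (carrier C)" using h by (simp add: ring_iso_def)
  have i: "inv_into (carrier B) h \<in> ring_iso C B" using h ring_iso_set_sym M.ring_axioms by blast
  have "inv_into (carrier B) h (\<alpha> \<odot>\<^bsub>C\<^esub> y) = \<alpha> \<odot>\<^bsub>B\<^esub> inv_into (carrier B) h y"
    if \<alpha>: "\<alpha> \<in> carrier F" and y: "y \<in> carrier C" for \<alpha> y
  proof -
    obtain x where x: "x \<in> carrier B" "y = h x" using b y by (auto simp: bij_betw_def)
    then have "\<alpha> \<odot>\<^bsub>C\<^esub> y = h (\<alpha> \<odot>\<^bsub>B\<^esub> x)" using h \<alpha> by simp
    then show ?thesis using x \<alpha> b by (simp add: bij_betw_def)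
  qed
  then have "inv_into (carrier B) h \<in> alg_iso F C B" using i by (simp add: alg_iso_def)
  then show ?thesis by (auto simp: alg_isomorphic_def)
qed

lemma alg_isomorphic_trans:
  assumes "alg_isomorphic F B C" "alg_isomorphic F C D"
  shows "alg_isomorphic F B D"
proof -
  obtain g h where "g \<in> alg_iso F B C" "h \<in> alg_iso F C D"
    using assms by (auto simp: alg_isomorphic_def)
  then have "h \<circ> g \<in> alg_iso F B D"
    using ring_iso_set_trans ring_iso_memE(1) by (fastforce simp: alg_iso_def)
  then show ?thesis by (auto simp: alg_isomorphic_def)
qed

lemma alg_isomorphic_twist:
  assumes "alg_isomorphic F B C" "\<sigma> \<in> carrier (field_Aut F)"
  shows "alg_isomorphic F (twist \<sigma> B) (twist \<sigma> C)"
  using assms by (auto simp: alg_isomorphic_def alg_iso_def field_Aut_closed)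

lemma alg_iso_class_eq_iff:
  assumes "assoc_algebra F B" "assoc_algebra F C"
  shows "alg_iso_class F B = alg_iso_class F C \<longleftrightarrow> alg_isomorphic F B C"
proof
  assume "alg_iso_class F B = alg_iso_class F C"
  moreover have "C \<in> alg_iso_class F C"
    using assms by (auto simp: alg_iso_class_def intro: alg_isomorphic_refl)
  ultimately show "alg_isomorphic F B C" by (auto simp: alg_iso_class_def)
next
  assume "alg_isomorphic F B C"
  then show "alg_iso_class F B = alg_iso_class F C"
    using assms alg_isomorphic_sym alg_isomorphic_trans unfolding alg_iso_class_def by blast
qed

lemma corner_mat_alg_twist:
  "full_idempotent (mat_alg n (twist \<sigma> B)) = full_idempotent (mat_alg n B)"
  "corner (mat_alg n (twist \<sigma> B)) e = twist \<sigma> (corner (mat_alg n B) e)"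
proof -
  have fs: "finsum (twist \<sigma> B) = finsum B" by (simp add: finsum_def twist_def fun_eq_iff)
  have m: "mat_alg n (twist \<sigma> B) = twist \<sigma> (mat_alg n B)"
    by (simp add: mat_alg_def Let_def fs cong: if_cong) (simp add: twist_def)
  show "full_idempotent (mat_alg n (twist \<sigma> B)) = full_idempotent (mat_alg n B)"
    by (rule ext) (simp add: m full_idempotent_def, simp add: twist_def)
  show "corner (mat_alg n (twist \<sigma> B)) e = twist \<sigma> (corner (mat_alg n B) e)"
    by (simp add: m corner_def) (simp add: twist_def)
qed

lemma linearly_morita_equivalent_cong:
  assumes "linearly_morita_equivalent F A (twist \<sigma> B)"
    and "\<And>\<alpha>. \<alpha> \<in> carrier F \<Longrightarrow> \<sigma> \<alpha> = \<tau> \<alpha>"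
  shows "linearly_morita_equivalent F A (twist \<tau> B)"
proof -
  have "alg_iso F A (twist \<sigma> C) = alg_iso F A (twist \<tau> C)" for C :: "('a, nat \<times> nat \<Rightarrow> 'c) module"
    using assms(2) by (auto simp: alg_iso_def)
  then show ?thesis
    using assms(1)
    by (simp add: linearly_morita_equivalent_def corner_mat_alg_twist alg_isomorphic_def)
qed

lemma linearly_morita_equivalent_imp_morita_equivalent:
  assumes "ring F" "linearly_morita_equivalent F A B"
  shows "morita_equivalent F A B"
proof -
  have "linearly_morita_equivalent F A (twist (\<lambda>\<alpha>. \<alpha>) B)"
    using assms(2) by (simp add: twist_def)
  then have "linearly_morita_equivalent F A (twist \<one>\<^bsub>field_Aut F\<^esub> B)"
    by (rule linearly_morita_equivalent_cong) (simp add: field_Aut_one)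
  moreover have "\<one>\<^bsub>field_Aut F\<^esub> \<in> carrier (field_Aut F)"
    using group_field_Aut[OF assms(1)] by (simp add: group.is_monoid monoid.one_closed)
  ultimately show ?thesis unfolding morita_equivalent_def by (rule_tac bexI)
qed

lemma morita_class_twist:
  assumes "ring F" "B \<in> morita_class F A" "\<sigma> \<in> carrier (field_Aut F)"
  shows "twist \<sigma> B \<in> morita_class F A"
proof -
  interpret group "field_Aut F" using assms(1) by (rule group_field_Aut)
  obtain \<tau> where \<tau>: "\<tau> \<in> carrier (field_Aut F)" "linearly_morita_equivalent F A (twist \<tau> B)"
    using assms(2) by (auto simp: morita_class_def morita_equivalent_def)
  define \<rho> where "\<rho> = inv\<^bsub>field_Aut F\<^esub> \<sigma> \<otimes>\<^bsub>field_Aut F\<^esub> \<tau>"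
  have \<rho>: "\<rho> \<in> carrier (field_Aut F)" using assms(3) \<tau> by (simp add: \<rho>_def)
  have "\<sigma> \<otimes>\<^bsub>field_Aut F\<^esub> \<rho> = \<tau>" using assms(3) \<tau> by (simp add: \<rho>_def m_assoc[symmetric])
  then have "\<tau> \<alpha> = \<sigma> (\<rho> \<alpha>)" if "\<alpha> \<in> carrier F" for \<alpha>
    using field_Aut_mult[OF assms(3) \<rho>] that by (auto simp: compose_def)
  then have "linearly_morita_equivalent F A (twist (\<sigma> \<circ> \<rho>) B)"
    by (intro linearly_morita_equivalent_cong[OF \<tau>(2)]) simp
  also have "twist (\<sigma> \<circ> \<rho>) B = twist \<rho> (twist \<sigma> B)" by (simp add: twist_def)
  finally show ?thesis
    using \<rho> assms twist_assoc_algebra by (auto simp: morita_class_def morita_equivalent_def)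
qed

lemma Aut_action_iso_class:
  assumes "ring F" "\<sigma> \<in> carrier (field_Aut F)" "B \<in> morita_class F A"
  shows "Aut_action F A \<sigma> (alg_iso_class F B) = alg_iso_class F (twist (inv\<^bsub>field_Aut F\<^esub> \<sigma>) B)"
proof -
  interpret group "field_Aut F" using assms(1) by (rule group_field_Aut)
  let ?\<tau> = "inv\<^bsub>field_Aut F\<^esub> \<sigma>"
  have \<tau>: "?\<tau> \<in> carrier (field_Aut F)" using assms by simp
  have B: "assoc_algebra F B" using assms(3) by (simp add: morita_class_def)
  have "alg_iso_class F (twist ?\<tau> C) = alg_iso_class F (twist ?\<tau> B)" if "C \<in> alg_iso_class F B" for C
  proof -
    have C: "assoc_algebra F C" "alg_isomorphic F B C" using that by (auto simp: alg_iso_class_def)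
    then show ?thesis
      using alg_iso_class_eq_iff twist_assoc_algebra B \<tau> alg_isomorphic_twist by metis
  qed
  moreover have "B \<in> alg_iso_class F B"
    using B by (auto simp: alg_iso_class_def intro: alg_isomorphic_refl)
  ultimately have "(\<Union>C\<in>alg_iso_class F B. alg_iso_class F (twist ?\<tau> C)) = alg_iso_class F (twist ?\<tau> B)"
    by blast
  then show ?thesis using assms(3) by (simp add: Aut_action_def morita_iso_classes_def)
qed

theorem Aut_action_group_action:
  fixes F :: "'f ring" and A :: "('f, 'a) module"
  assumes "ring F"
  shows "group_action (field_Aut F)
    (morita_iso_classes F A :: ('f, 'b) module set set) (Aut_action F A)"
proof -
  interpret group "field_Aut F" using assms by (rule group_field_Aut)
  let ?G = "field_Aut F" and ?E = "morita_iso_classes F A :: ('f, 'b) module set set"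
    and ?act = "Aut_action F A :: ('f \<Rightarrow> 'f) \<Rightarrow> ('f, 'b) module set \<Rightarrow> ('f, 'b) module set"
  have alg: "assoc_algebra F B" if "B \<in> morita_class F A" for B :: "('f, 'b) module"
    using that by (simp add: morita_class_def)
  have closed: "?act \<sigma> \<in> ?E \<rightarrow> ?E" if "\<sigma> \<in> carrier ?G" for \<sigma>
  proof
    fix K assume "K \<in> ?E"
    then obtain B where B: "B \<in> morita_class F A" "K = alg_iso_class F B"
      by (auto simp: morita_iso_classes_def)
    then have "twist (inv\<^bsub>?G\<^esub> \<sigma>) B \<in> morita_class F A"
      using that assms by (simp add: morita_class_twist)
    then show "?act \<sigma> K \<in> ?E"
      using that assms B by (simp add: Aut_action_iso_class morita_iso_classes_def)
  qed
  have comp: "?act (\<sigma> \<otimes>\<^bsub>?G\<^esub> \<tau>) K = ?act \<sigma> (?act \<tau> K)"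
    if \<sigma>: "\<sigma> \<in> carrier ?G" and \<tau>: "\<tau> \<in> carrier ?G" and K: "K \<in> ?E" for \<sigma> \<tau> K
  proof -
    obtain B where B: "B \<in> morita_class F A" "K = alg_iso_class F B"
      using K by (auto simp: morita_iso_classes_def)
    let ?s = "inv\<^bsub>?G\<^esub> \<sigma>" and ?t = "inv\<^bsub>?G\<^esub> \<tau>"
    have st: "?s \<in> carrier ?G" "?t \<in> carrier ?G" using \<sigma> \<tau> by auto
    have tB: "twist ?t B \<in> morita_class F A" using morita_class_twist assms B st by blast
    have "inv\<^bsub>?G\<^esub> (\<sigma> \<otimes>\<^bsub>?G\<^esub> \<tau>) = compose (carrier F) ?t ?s"
      using inv_mult_group[OF \<sigma> \<tau>] field_Aut_mult[OF st(2,1)] by simp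
    then have "alg_isomorphic F (twist (inv\<^bsub>?G\<^esub> (\<sigma> \<otimes>\<^bsub>?G\<^esub> \<tau>)) B) (twist ?s (twist ?t B))"
      by (intro alg_isomorphic_refl) (auto simp: compose_def)
    then have "alg_iso_class F (twist (inv\<^bsub>?G\<^esub> (\<sigma> \<otimes>\<^bsub>?G\<^esub> \<tau>)) B) = alg_iso_class F (twist ?s (twist ?t B))"
      using \<sigma> \<tau> st B(1) tB alg by (subst alg_iso_class_eq_iff) (auto intro!: twist_assoc_algebra)
    then show ?thesis
      using Aut_action_iso_class[OF assms _ B(1)] Aut_action_iso_class[OF assms \<sigma> tB] \<sigma> \<tau> B(2) by simp
  qed
  have one: "?act \<one>\<^bsub>?G\<^esub> K = K" if K: "K \<in> ?E" for K
  proof -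
    obtain B where B: "B \<in> morita_class F A" "K = alg_iso_class F B"
      using K by (auto simp: morita_iso_classes_def)
    have "alg_isomorphic F (twist \<one>\<^bsub>?G\<^esub> B) B"
      by (intro alg_isomorphic_refl) (auto simp: field_Aut_one)
    then show ?thesis
      using Aut_action_iso_class[OF assms one_closed B(1)] B alg_iso_class_eq_iff alg
        twist_assoc_algebra one_closed by (metis inv_one)
  qed
  have bij: "?act \<sigma> \<in> Bij ?E" if \<sigma>: "\<sigma> \<in> carrier ?G" for \<sigma>
  proof -
    let ?s = "inv\<^bsub>?G\<^esub> \<sigma>"
    have s: "?s \<in> carrier ?G" using \<sigma> by simp
    have "?act ?s (?act \<sigma> K) = K" "?act \<sigma> (?act ?s K) = K" if "K \<in> ?E" for K
      using that comp[OF s \<sigma> that, symmetric] comp[OF \<sigma> s that, symmetric] one \<sigma> by simp_all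
    then have "bij_betw (?act \<sigma>) ?E ?E"
      by (intro bij_betwI[where g = "?act ?s"] closed \<sigma> s)
    then show ?thesis by (simp add: Bij_def Aut_action_def)
  qed
  have "?act \<in> hom ?G (BijGroup ?E)"
  proof (rule homI)
    show "?act \<sigma> \<in> carrier (BijGroup ?E)" if "\<sigma> \<in> carrier ?G" for \<sigma>
      using bij that by (simp add: BijGroup_def)
    show "?act (\<sigma> \<otimes>\<^bsub>?G\<^esub> \<tau>) = ?act \<sigma> \<otimes>\<^bsub>BijGroup ?E\<^esub> ?act \<tau>"
      if \<sigma>: "\<sigma> \<in> carrier ?G" and \<tau>: "\<tau> \<in> carrier ?G" for \<sigma> \<tau>
    proof
      fix K
      show "?act (\<sigma> \<otimes>\<^bsub>?G\<^esub> \<tau>) K = (?act \<sigma> \<otimes>\<^bsub>BijGroup ?E\<^esub> ?act \<tau>) K"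
      proof (cases "K \<in> ?E")
        case True
        then show ?thesis
          using comp[OF \<sigma> \<tau> True] bij[OF \<sigma>] bij[OF \<tau>] by (simp add: BijGroup_def compose_def)
      next
        case False
        moreover have "?act (\<sigma> \<otimes>\<^bsub>?G\<^esub> \<tau>) K = undefined"
          using False by (simp add: Aut_action_def)
        ultimately show ?thesis
          using bij[OF \<sigma>] bij[OF \<tau>] by (simp add: BijGroup_def compose_def)
      qed
    qed
  qed
  then show ?thesis
    by (intro group_action.intro group_hom.intro group_hom_axioms.intro group_BijGroup is_group)
qed

end

theory Submission
  imports Defs
begin

text \<open>Suppose that \<open>A\<close> is linearly Morita equivalent to \<open>B\<close>, say \<open>A \<cong> e M\<^sub>n(B) e\<close> with \<open>e\<close> full. Then
\<open>B\<close> is in turn a corner \<open>E M\<^sub>m(A) E\<close>: writing \<open>1 = \<Sum> x\<^sub>i e y\<^sub>i\<close>, and cutting the \<open>x\<^sub>i\<close> and \<open>y\<^sub>i\<close> down to a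
matrix unit, the map \<open>b \<mapsto> (y\<^sub>i b x\<^sub>j)\<close> is an isomorphism onto the corner at \<open>E = (y\<^sub>i x\<^sub>j)\<close>
(\<open>corner_isomorphic_matrix_corner\<close>). So every algebra in the class is described, up to a twist, by a
finite matrix \<open>E\<close> over \<open>A\<close>, and the entries of \<open>E\<close> are values of noncommutative polynomials at the
generators of \<open>A\<close>: only finitely many scalars are involved.

An automorphism of \<open>F\<close> that fixes the finitely many coefficients of the relators acts on \<open>A\<close> by acting
on coefficients (\<open>induced_semilinear_automorphism\<close>), hence on matrices over \<open>A\<close>, and it carries the
corner at \<open>E\<close> semilinearly onto the corner at the image of \<open>E\<close>. It therefore suffices to find one
countable set \<open>C\<close> of scalars into which any finite set of scalars can be moved by such an
automorphism: there are only countably many matrices whose entries are values of polynomials with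
coefficients in \<open>C\<close>.

The existence of \<open>C\<close> is a fact about algebraically closed fields
(\<open>exists_countable_set_meeting_orbits\<close>). If \<open>F\<close> is countable, take \<open>C = F\<close>. Otherwise take the union
of a strictly increasing sequence of countable subfields \<open>M\<^sub>n\<close> that are algebraically closed in \<open>F\<close>.
The scalars are moved into the union one after the other, because the automorphisms that fix \<open>M\<^sub>n\<close>
are transitive on the complement of \<open>M\<^sub>n\<close>: given \<open>a\<close> and \<open>b\<close> outside \<open>M\<^sub>n\<close>, some \<open>c\<close> is transcendental
over both \<open>M\<^sub>n(a)\<close> and \<open>M\<^sub>n(b)\<close>, and an automorphism can exchange \<open>a\<close> with \<open>c\<close>, another \<open>b\<close> with \<open>c\<close>.

The exchange of \<open>a\<close> and \<open>c\<close> comes from two applications of Zorn's lemma to partial automorphisms, which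
are treated as subrings of \<open>F \<times> F\<close>. The first one enlarges the exchange to a partial automorphism
\<open>G\<close> over whose domain \<open>F\<close> is algebraic. Keeping \<open>G\<close> equal to its converse makes domain and range agree,
so that a new transcendental element can always be sent to itself; this takes the place of comparing
transcendence degrees. The second one extends \<open>G\<close> along the algebraic extension to all of \<open>F\<close>.\<close>

section \<open>Extending partial automorphisms of an algebraically closed field\<close>

lemma RDirProd_simps [simp]:
  "carrier (RDirProd R S) = carrier R \<times> carrier S"
  "(x, y) \<otimes>\<^bsub>RDirProd R S\<^esub> (x', y') = (x \<otimes>\<^bsub>R\<^esub> x', y \<otimes>\<^bsub>S\<^esub> y')"
  "(x, y) \<oplus>\<^bsub>RDirProd R S\<^esub> (x', y') = (x \<oplus>\<^bsub>R\<^esub> x', y \<oplus>\<^bsub>S\<^esub> y')"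
  "\<one>\<^bsub>RDirProd R S\<^esub> = (\<one>\<^bsub>R\<^esub>, \<one>\<^bsub>S\<^esub>)" "\<zero>\<^bsub>RDirProd R S\<^esub> = (\<zero>\<^bsub>R\<^esub>, \<zero>\<^bsub>S\<^esub>)"
  by (simp_all add: RDirProd_def DirProd_def monoid.defs)

lemma (in cring) RDirProd_cring: "cring (RDirProd R R)"
  using RDirProd_ring[OF ring_axioms ring_axioms]
  by (auto simp: cring_def comm_monoid_def comm_monoid_axioms_def ring_def m_comm)

lemma (in cring) RDirProd_uminus:
  assumes "x \<in> carrier R" "y \<in> carrier R"
  shows "\<ominus>\<^bsub>RDirProd R R\<^esub> (x, y) = (\<ominus> x, \<ominus> y)"
proof -
  interpret P: cring "RDirProd R R" by (rule RDirProd_cring)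
  show ?thesis
    using assms by (intro P.minus_equality) (auto simp: l_neg)
qed

lemma (in cring) simple_extension_subring:
  assumes "subring K R" "x \<in> carrier R"
  shows "subring (simple_extension K x) R"
proof -
  let ?S = "simple_extension K x"
  note K = subringE[OF assms(1)]
  have S: "?S \<subseteq> carrier R" using simple_extension_in_carrier K(1) assms(2) by simp
  note [simp] = subsetD[OF S] subsetD[OF K(1)] assms(2)
  have add: "u \<oplus> v \<in> ?S" if "u \<in> ?S" "v \<in> ?S" for u v
    using that
  proof (induction arbitrary: v rule: simple_extension.induct)
    case zero then show ?case by simp
  next
    case (lin k1 k2)
    note IH = lin
    show ?case
      using IH(4)
    proof (cases rule: simple_extension.cases)
      case zero then show ?thesis using IH by (simp add: simple_extension.lin)
    next
      case (lin l1 l2)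
      have "(k1 \<otimes> x \<oplus> k2) \<oplus> v = (k1 \<oplus> l1) \<otimes> x \<oplus> (k2 \<oplus> l2)"
        using IH(1,2) lin by (simp add: l_distr a_ac)
      then show ?thesis using IH lin K(7) simple_extension.lin by metis
    qed
  qed
  have smult: "k \<otimes> u \<in> ?S" if "u \<in> ?S" "k \<in> K" for u k
    using that
  proof (induction rule: simple_extension.induct)
    case (lin k1 k2)
    have "k \<otimes> (k1 \<otimes> x \<oplus> k2) = (k \<otimes> k1) \<otimes> x \<oplus> (k \<otimes> k2)"
      using lin by (simp add: r_distr m_assoc)
    then show ?case using lin K(6) simple_extension.lin by metis
  qed simp
  have xmult: "u \<otimes> x \<in> ?S" if "u \<in> ?S" for u
    using simple_extension.lin[OF that K(2)] that by simp
  have mult: "u \<otimes> v \<in> ?S" if "u \<in> ?S" "v \<in> ?S" for u v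
    using that
  proof (induction rule: simple_extension.induct)
    case (lin k1 k2)
    have "(k1 \<otimes> x \<oplus> k2) \<otimes> v = (k1 \<otimes> v) \<otimes> x \<oplus> k2 \<otimes> v"
      using lin by (simp add: l_distr r_distr m_ac)
    then show ?case using lin smult add xmult by metis
  qed simp
  have "\<ominus> u \<in> ?S" if "u \<in> ?S" for u
    using smult[OF that, of "\<ominus> \<one>"] K(3,5) that by (simp add: l_minus)
  then show ?thesis
    using add mult S simple_extension_incl[OF K(1) assms(2)] K(3) by (intro subringI) auto
qed

context cring begin

text \<open>A homomorphism between subrings of \<open>R\<close> is represented by its graph, a subring of \<open>R \<times> R\<close>. Unions of
chains and adjunction of a pair of elements then are plain operations on subrings. Functionality need
only be required at \<open>\<zero>\<close>, since differences of elements of the graph stay in the graph.\<close>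

definition graph_hom :: "('a \<times> 'a) set \<Rightarrow> bool" where
  "graph_hom G \<longleftrightarrow> subring G (RDirProd R R) \<and> (\<forall>y. (\<zero>, y) \<in> G \<longrightarrow> y = \<zero>)"

lemma graph_homD:
  assumes "graph_hom G"
  shows "G \<subseteq> carrier R \<times> carrier R" "(\<one>, \<one>) \<in> G" "(\<zero>, \<zero>) \<in> G"
    "(x, y) \<in> G \<Longrightarrow> (x', y') \<in> G \<Longrightarrow> (x \<oplus> x', y \<oplus> y') \<in> G"
    "(x, y) \<in> G \<Longrightarrow> (x', y') \<in> G \<Longrightarrow> (x \<otimes> x', y \<otimes> y') \<in> G"
    "(x, y) \<in> G \<Longrightarrow> (\<ominus> x, \<ominus> y) \<in> G"
    "(\<zero>, y) \<in> G \<Longrightarrow> y = \<zero>"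
    "(x, y) \<in> G \<Longrightarrow> x \<in> carrier R" "(x, y) \<in> G \<Longrightarrow> y \<in> carrier R"
proof -
  have s: "subring G (RDirProd R R)" using assms by (simp add: graph_hom_def)
  note S = subringE[OF s]
  show 1: "G \<subseteq> carrier R \<times> carrier R" using S(1) by simp
  show "(\<one>, \<one>) \<in> G" "(\<zero>, \<zero>) \<in> G" using S(2,3) by simp_all
  show "(x, y) \<in> G \<Longrightarrow> (x', y') \<in> G \<Longrightarrow> (x \<oplus> x', y \<oplus> y') \<in> G" using S(7) by fastforce
  show "(x, y) \<in> G \<Longrightarrow> (x', y') \<in> G \<Longrightarrow> (x \<otimes> x', y \<otimes> y') \<in> G" using S(6) by fastforce
  show "(x, y) \<in> G \<Longrightarrow> (\<ominus> x, \<ominus> y) \<in> G" using S(5)[of "(x, y)"] 1 RDirProd_uminus[of x y] by auto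
  show "(\<zero>, y) \<in> G \<Longrightarrow> y = \<zero>" using assms by (simp add: graph_hom_def)
  show "(x, y) \<in> G \<Longrightarrow> x \<in> carrier R" "(x, y) \<in> G \<Longrightarrow> y \<in> carrier R" using 1 by auto
qed

lemma graph_subringI:
  assumes "G \<subseteq> carrier R \<times> carrier R" "(\<one>, \<one>) \<in> G"
    "\<And>x y x' y'. (x, y) \<in> G \<Longrightarrow> (x', y') \<in> G \<Longrightarrow> (x \<oplus> x', y \<oplus> y') \<in> G"
    "\<And>x y x' y'. (x, y) \<in> G \<Longrightarrow> (x', y') \<in> G \<Longrightarrow> (x \<otimes> x', y \<otimes> y') \<in> G"
    "\<And>x y. (x, y) \<in> G \<Longrightarrow> (\<ominus> x, \<ominus> y) \<in> G"
  shows "subring G (RDirProd R R)"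
proof -
  interpret P: cring "RDirProd R R" by (rule RDirProd_cring)
  show ?thesis
    using assms RDirProd_uminus by (intro P.subringI) (auto simp: subset_iff)
qed

lemma graph_hom_fun:
  assumes "graph_hom G" "(x, y) \<in> G" "(x, y') \<in> G"
  shows "y = y'"
proof -
  note G = graph_homD[OF assms(1)]
  have "(x \<oplus> \<ominus> x, y \<oplus> \<ominus> y') \<in> G" using assms G(4,6) by blast
  then have "y \<oplus> \<ominus> y' = \<zero>" using G(7) G(8)[OF assms(2)] by (simp add: r_neg)
  then show ?thesis using G(9)[OF assms(2)] G(9)[OF assms(3)]
    by (metis add.inv_closed minus_equality minus_minus)
qed

lemma subring_converse:
  "subring G (RDirProd R R) \<Longrightarrow> subring (G\<inverse>) (RDirProd R R)"
proof -
  assume s: "subring G (RDirProd R R)"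
  note S = subringE[OF s]
  show ?thesis
  proof (rule graph_subringI)
    show "G\<inverse> \<subseteq> carrier R \<times> carrier R" using S(1) by auto
    show "(\<one>, \<one>) \<in> G\<inverse>" using S(3) by auto
    show "(x \<oplus> x', y \<oplus> y') \<in> G\<inverse>" "(x \<otimes> x', y \<otimes> y') \<in> G\<inverse>"
      if "(x, y) \<in> G\<inverse>" "(x', y') \<in> G\<inverse>" for x y x' y'
      using that S(6,7) by fastforce+
    show "(\<ominus> x, \<ominus> y) \<in> G\<inverse>" if "(x, y) \<in> G\<inverse>" for x y
      using that S(5)[of "(y, x)"] S(1) RDirProd_uminus[of y x] by auto
  qed
qed

lemma subring_fst:
  assumes "subring G (RDirProd R R)" shows "subring (fst ` G) R"
proof -
  note S = subringE[OF assms]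
  show ?thesis
  proof (rule subringI)
    show "fst ` G \<subseteq> carrier R" using S(1) by auto
    show "\<one> \<in> fst ` G" using S(3) by force
    show "\<ominus> h \<in> fst ` G" if h: "h \<in> fst ` G" for h
    proof -
      obtain y where "(h, y) \<in> G" using h by auto
      then have "(\<ominus> h, \<ominus> y) \<in> G" using S(1) S(5)[of "(h, y)"] RDirProd_uminus[of h y] by auto
      then show ?thesis by force
    qed
    show "h \<otimes> h' \<in> fst ` G" "h \<oplus> h' \<in> fst ` G" if hh: "h \<in> fst ` G" "h' \<in> fst ` G" for h h'
    proof -
      obtain y y' where "(h, y) \<in> G" "(h', y') \<in> G" using hh by auto
      then show "h \<otimes> h' \<in> fst ` G" "h \<oplus> h' \<in> fst ` G"
        using S(6)[of "(h, y)" "(h', y')"] S(7)[of "(h, y)" "(h', y')"] by force+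
    qed
  qed
qed

lemma eval_pairs:
  assumes "set p \<subseteq> carrier R \<times> carrier R" "a \<in> carrier R" "b \<in> carrier R"
  shows "ring.eval (RDirProd R R) p (a, b) = (eval (map fst p) a, eval (map snd p) b)"
proof -
  interpret P: cring "RDirProd R R" by (rule RDirProd_cring)
  interpret f: ring_hom_ring "RDirProd R R" R fst
    by (rule ring_hom_ringI2[OF P.ring_axioms ring_axioms]) (auto simp: ring_hom_def)
  interpret s: ring_hom_ring "RDirProd R R" R snd
    by (rule ring_hom_ringI2[OF P.ring_axioms ring_axioms]) (auto simp: ring_hom_def)
  have "fst (P.eval p (a, b)) = eval (map fst p) a" "snd (P.eval p (a, b)) = eval (map snd p) b"
    using f.eval_hom'[of "(a, b)" p] s.eval_hom'[of "(a, b)" p] assms by simp_all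
  then show ?thesis by (metis prod.collapse)
qed

text \<open>Sending \<open>a\<close> to \<open>b\<close> means adjoining the single element \<open>(a, b)\<close> of the product ring: the elements of
\<open>G[(a, b)]\<close> are the pairs \<open>(p(a), p'(b))\<close>, where \<open>p'\<close> arises from \<open>p\<close> by applying \<open>G\<close> to the
coefficients.\<close>

abbreviation adjoin :: "('a \<times> 'a) set \<Rightarrow> 'a \<Rightarrow> 'a \<Rightarrow> ('a \<times> 'a) set" where
  "adjoin G a b \<equiv> ring.simple_extension (RDirProd R R) G (a, b)"

lemma adjoin_subring:
  assumes "subring G (RDirProd R R)" "a \<in> carrier R" "b \<in> carrier R"
  shows "subring (adjoin G a b) (RDirProd R R)" "G \<subseteq> adjoin G a b" "(a, b) \<in> adjoin G a b"
proof -
  interpret P: cring "RDirProd R R" by (rule RDirProd_cring)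
  note S = subringE(1)[OF assms(1)]
  have ab: "(a, b) \<in> carrier (RDirProd R R)" using assms by simp
  show "subring (adjoin G a b) (RDirProd R R)" "G \<subseteq> adjoin G a b" "(a, b) \<in> adjoin G a b"
    using P.simple_extension_subring[OF assms(1) ab] P.simple_extension_incl[OF S ab]
      P.simple_extension_mem[OF assms(1) ab] by auto
qed

lemma adjoinE:
  assumes "subring G (RDirProd R R)" "a \<in> carrier R" "b \<in> carrier R" "z \<in> adjoin G a b"
  obtains p where "set p \<subseteq> G" "p = [] \<or> hd p \<noteq> (\<zero>, \<zero>)"
    "z = (eval (map fst p) a, eval (map snd p) b)"
proof -
  interpret P: cring "RDirProd R R" by (rule RDirProd_cring)
  note S = subringE(1)[OF assms(1)]
  have ab: "(a, b) \<in> carrier (RDirProd R R)" using assms by simp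
  obtain p where p: "p \<in> carrier (G[X]\<^bsub>RDirProd R R\<^esub>)" "z = P.eval p (a, b)"
    using P.simple_extension_as_eval_img[OF S ab] assms(4) by auto
  then have *: "set p \<subseteq> G" "p = [] \<or> hd p \<noteq> (\<zero>, \<zero>)"
    by (auto simp: univ_poly_carrier[symmetric] polynomial_def)
  show thesis
    by (rule that[OF *]) (use p * S eval_pairs assms in auto)
qed

lemma fst_adjoin:
  assumes "subring G (RDirProd R R)" "a \<in> carrier R" "b \<in> carrier R"
  shows "fst ` adjoin G a b = simple_extension (fst ` G) a"
proof -
  interpret P: cring "RDirProd R R" by (rule RDirProd_cring)
  note S = subringE(1)[OF assms(1)]
  have "fst z \<in> simple_extension (fst ` G) a" if "z \<in> adjoin G a b" for z
    using that
  proof (induction rule: P.simple_extension.induct)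
    case zero then show ?case by simp
  next
    case (lin k1 k2)
    obtain u1 v1 u2 v2 where k: "k1 = (u1, v1)" "k2 = (u2, v2)" by (cases k1; cases k2)
    have "u2 \<in> fst ` G" using lin(2) k by force
    then show ?case using lin k simple_extension.lin[of u1 "fst ` G" a u2] by simp
  qed
  moreover have "\<exists>y. (x, y) \<in> adjoin G a b" if "x \<in> simple_extension (fst ` G) a" for x
    using that
  proof (induction rule: simple_extension.induct)
    case zero then show ?case using P.simple_extension.zero by auto
  next
    case (lin k1 k2)
    then obtain y1 y2 where "(k1, y1) \<in> adjoin G a b" "(k2, y2) \<in> G" by auto
    from P.simple_extension.lin[OF this] show ?case by auto
  qed
  ultimately show ?thesis by force
qed

text \<open>The universal property of the polynomial ring: if \<open>p(a) = \<zero>\<close>, then \<open>p\<close> is the zero polynomial, so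
every coefficient of its transported copy vanishes too.\<close>

lemma graph_hom_adjoin_transcendental:
  assumes "graph_hom G" "a \<in> carrier R" "b \<in> carrier R" "(transcendental over (fst ` G)) a"
  shows "graph_hom (adjoin G a b)"
proof -
  have s: "subring G (RDirProd R R)" using assms by (simp add: graph_hom_def)
  have "y = \<zero>" if xy: "(\<zero>, y) \<in> adjoin G a b" for y
  proof -
    obtain p where p: "set p \<subseteq> G" "p = [] \<or> hd p \<noteq> (\<zero>, \<zero>)"
      "\<zero> = eval (map fst p) a" "y = eval (map snd p) b"
      using adjoinE[OF s assms(2,3) xy] by (metis prod.inject)
    have "p = []"
    proof (rule ccontr)
      assume ne: "p \<noteq> []"
      then have "hd p \<in> G" using p(1) hd_in_set by blast
      then have "fst (hd p) \<noteq> \<zero>" using p(2) ne graph_homD(7)[OF assms(1)]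
        by (metis prod.collapse)
      then have "map fst p \<in> carrier ((fst ` G)[X])"
        using p(1) ne by (auto simp: univ_poly_carrier[symmetric] polynomial_def hd_map)
      then show False using eval_transcendental[OF assms(4) _ p(3)[symmetric]] ne by simp
    qed
    then show ?thesis using p(4) by simp
  qed
  then show ?thesis using adjoin_subring(1)[OF s assms(2,3)] by (simp add: graph_hom_def)
qed


lemma graph_hom_Union:
  assumes "C \<noteq> {}" "\<And>G. G \<in> C \<Longrightarrow> graph_hom G" "\<And>G H. G \<in> C \<Longrightarrow> H \<in> C \<Longrightarrow> G \<subseteq> H \<or> H \<subseteq> G"
  shows "graph_hom (\<Union>C)"
proof -
  note D = graph_homD[OF assms(2)]
  have two: "\<exists>K\<in>C. z \<in> K \<and> z' \<in> K" if "z \<in> \<Union>C" "z' \<in> \<Union>C" for z z'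
    using that assms(3) by blast
  have "subring (\<Union>C) (RDirProd R R)"
  proof (rule graph_subringI)
    show "\<Union>C \<subseteq> carrier R \<times> carrier R" using D(1) by blast
    show "(\<one>, \<one>) \<in> \<Union>C" using D(2) assms(1) by blast
    show "(x \<oplus> x', y \<oplus> y') \<in> \<Union>C" "(x \<otimes> x', y \<otimes> y') \<in> \<Union>C"
      if "(x, y) \<in> \<Union>C" "(x', y') \<in> \<Union>C" for x y x' y'
      using two[OF that] D(4,5) by blast+
    show "(\<ominus> x, \<ominus> y) \<in> \<Union>C" if "(x, y) \<in> \<Union>C" for x y
      using that D(6) by blast
  qed
  then show ?thesis using D(7) unfolding graph_hom_def by blast
qed

definition graph_iso :: "('a \<times> 'a) set \<Rightarrow> bool" where
  "graph_iso G \<longleftrightarrow> graph_hom G \<and> graph_hom (G\<inverse>)"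

lemma graph_iso_converse [simp]: "graph_iso (G\<inverse>) \<longleftrightarrow> graph_iso G"
  by (auto simp: graph_iso_def)

lemma graph_iso_Union:
  assumes "C \<noteq> {}" "\<And>G. G \<in> C \<Longrightarrow> graph_iso G" "\<And>G H. G \<in> C \<Longrightarrow> H \<in> C \<Longrightarrow> G \<subseteq> H \<or> H \<subseteq> G"
  shows "graph_iso (\<Union>C)"
proof -
  have "graph_hom (\<Union>C)" using assms by (intro graph_hom_Union) (auto simp: graph_iso_def)
  moreover have "graph_hom (\<Union>(converse ` C))"
    using assms by (intro graph_hom_Union) (auto simp: graph_iso_def)
  moreover have "\<Union>(converse ` C) = (\<Union>C)\<inverse>" by auto
  ultimately show ?thesis by (simp add: graph_iso_def)
qed

lemma graph_hom_diagonal: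
  assumes "subring K R" shows "graph_hom (Id_on K)"
  using subringE[OF assms] unfolding graph_hom_def by (auto intro!: graph_subringI)

lemma adjoin_minimal:
  assumes "subring H (RDirProd R R)" "G \<subseteq> H" "(a, b) \<in> H"
  shows "adjoin G a b \<subseteq> H"
proof -
  interpret P: cring "RDirProd R R" by (rule RDirProd_cring)
  show ?thesis using P.simple_extension_subring_incl assms by blast
qed

end

text \<open>A partial isomorphism extends to fractions, so a maximal one has a field as its domain. Injectivity
is essential here: a homomorphism that kills a nonzero element cannot be extended to its inverse.\<close>

lemma (in field) subfield_fst_maximal_graph_iso:
  assumes H: "graph_iso H" and max: "\<And>H'. graph_iso H' \<Longrightarrow> H \<subseteq> H' \<Longrightarrow> H' = H"
  shows "subfield (fst ` H) R"
proof -
  have g: "graph_hom H" "graph_hom (H\<inverse>)" using H by (auto simp: graph_iso_def)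
  note D = graph_homD[OF g(1)]
  have nz: "v \<noteq> \<zero> \<longleftrightarrow> w \<noteq> \<zero>" if "(v, w) \<in> H" for v w
    using that D(7) graph_homD(7)[OF g(2)] by auto
  \<comment> \<open>all pairs of fractions \<open>(u / v, u' / v')\<close> with \<open>(u, u')\<close> and \<open>(v, v')\<close> in \<open>H\<close>\<close>
  define H' where "H' = {(x, y) \<in> carrier R \<times> carrier R. \<exists>v w. (v, w) \<in> H \<and> v \<noteq> \<zero> \<and> (x \<otimes> v, y \<otimes> w) \<in> H}"
  have sub: "subring H' (RDirProd R R)"
  proof (rule graph_subringI)
    show "H' \<subseteq> carrier R \<times> carrier R" by (auto simp: H'_def)
    show "(\<one>, \<one>) \<in> H'" using D(2) by (auto simp: H'_def intro!: exI[of _ "\<one>"])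
    show "(\<ominus> x, \<ominus> y) \<in> H'" if xy: "(x, y) \<in> H'" for x y
    proof -
      obtain v w where *: "(v, w) \<in> H" "v \<noteq> \<zero>" "(x \<otimes> v, y \<otimes> w) \<in> H" "x \<in> carrier R" "y \<in> carrier R"
        using xy by (auto simp: H'_def)
      then have "(\<ominus> x \<otimes> v, \<ominus> y \<otimes> w) \<in> H" using D(6)[OF *(3)] D(8,9)[OF *(1)] by (simp add: l_minus)
      then show ?thesis using * by (auto simp: H'_def)
    qed
    fix x y x' y' assume xy: "(x, y) \<in> H'" "(x', y') \<in> H'"
    obtain v w where *: "(v, w) \<in> H" "v \<noteq> \<zero>" "(x \<otimes> v, y \<otimes> w) \<in> H" "x \<in> carrier R" "y \<in> carrier R"
      using xy by (auto simp: H'_def)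
    obtain v' w' where **: "(v', w') \<in> H" "v' \<noteq> \<zero>" "(x' \<otimes> v', y' \<otimes> w') \<in> H"
      "x' \<in> carrier R" "y' \<in> carrier R"
      using xy by (auto simp: H'_def)
    note c = * ** D(8,9)[OF *(1)] D(8,9)[OF **(1)]
    have vv: "(v \<otimes> v', w \<otimes> w') \<in> H" "v \<otimes> v' \<noteq> \<zero>"
      using c D(5) integral by blast+
    have "((x \<otimes> v) \<otimes> (x' \<otimes> v'), (y \<otimes> w) \<otimes> (y' \<otimes> w')) \<in> H" using c D(5) by blast
    then have "((x \<otimes> x') \<otimes> (v \<otimes> v'), (y \<otimes> y') \<otimes> (w \<otimes> w')) \<in> H" using c by (simp add: m_ac)
    then show "(x \<otimes> x', y \<otimes> y') \<in> H'" using vv c by (auto simp: H'_def)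
    have "((x \<otimes> v) \<otimes> v' \<oplus> (x' \<otimes> v') \<otimes> v, (y \<otimes> w) \<otimes> w' \<oplus> (y' \<otimes> w') \<otimes> w) \<in> H"
      using c D(4,5) by blast
    then have "((x \<oplus> x') \<otimes> (v \<otimes> v'), (y \<oplus> y') \<otimes> (w \<otimes> w')) \<in> H" using c by (simp add: m_ac l_distr r_distr)
    then show "(x \<oplus> x', y \<oplus> y') \<in> H'" using vv c by (auto simp: H'_def)
  qed
  have "x = \<zero> \<longleftrightarrow> y = \<zero>" if xy: "(x, y) \<in> H'" for x y
  proof -
    obtain v w where *: "(v, w) \<in> H" "v \<noteq> \<zero>" "(x \<otimes> v, y \<otimes> w) \<in> H" "x \<in> carrier R" "y \<in> carrier R"
      using xy by (auto simp: H'_def)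
    have "x = \<zero> \<longleftrightarrow> x \<otimes> v = \<zero>" using * D(8)[OF *(1)] integral_iff by auto
    also have "\<dots> \<longleftrightarrow> y \<otimes> w = \<zero>" using nz[OF *(3)] by auto
    also have "\<dots> \<longleftrightarrow> y = \<zero>" using * D(9)[OF *(1)] nz[OF *(1)] integral_iff by auto
    finally show ?thesis .
  qed
  then have "graph_iso H'" using sub subring_converse[OF sub] by (auto simp: graph_iso_def graph_hom_def)
  moreover have "H \<subseteq> H'"
  proof
    fix z assume "z \<in> H"
    then show "z \<in> H'" using D(2,8,9) one_not_zero
      by (cases z) (auto simp: H'_def intro!: exI[of _ "\<one>"])
  qed
  ultimately have eq: "H' = H" by (rule max)
  show ?thesis
  proof (rule subfieldI')
    show "subring (fst ` H) R" using g(1) subring_fst by (simp add: graph_hom_def)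
    fix x assume "x \<in> fst ` H - {\<zero>}"
    then obtain y where xy: "(x, y) \<in> H" "x \<noteq> \<zero>" by auto
    have u: "x \<in> Units R" "y \<in> Units R"
      using xy nz[OF xy(1)] D(8,9)[OF xy(1)] by (auto simp: field_Units)
    then have "(inv x, inv y) \<in> carrier R \<times> carrier R" "(inv x \<otimes> x, inv y \<otimes> y) \<in> H" using D(2) by simp_all
    then have "(inv x, inv y) \<in> H'" using xy unfolding H'_def by blast
    then show "inv x \<in> fst ` H" unfolding eq by force
  qed
qed

context algebraically_closed begin

lemma exists_root_if_nonconstant:
  assumes "p \<in> carrier (poly_ring L)" "degree p > 0"
  obtains b where "b \<in> carrier L" "eval p b = \<zero>"
proof -
  have "size (roots p) > 0" using roots_over_carrier[OF assms(1)] assms(2) by (simp add: splitted_def)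
  then obtain b where "b \<in># roots p" by (metis multiset_nonemptyE nonempty_has_size)
  then have "is_root p b" using roots_mem_iff_is_root[OF assms(1)] by blast
  then show thesis using that by (auto simp: is_root_def)
qed

text \<open>The image \<open>b\<close> of an algebraic element \<open>a\<close> is a root of the transported minimal polynomial. The extended
map is then well defined, because a polynomial that vanishes at \<open>a\<close> is a multiple of the minimal
polynomial, and it is injective because its domain is a field.\<close>

lemma graph_iso_adjoin_algebraic:
  assumes G: "graph_iso G" and K: "subfield (fst ` G) L"
    and a: "a \<in> carrier L" "(algebraic over (fst ` G)) a"
  obtains b where "b \<in> carrier L" "graph_iso (adjoin G a b)"
proof -
  define K where "K = fst ` G"
  note K' = K[folded K_def] and a' = a(2)[folded K_def]
  have g: "graph_hom G" "graph_hom (G\<inverse>)" using G by (auto simp: graph_iso_def)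
  have s: "subring G (RDirProd L L)" using g by (simp add: graph_hom_def)
  note D = graph_homD[OF g(1)]
  define h where "h x = (THE y. (x, y) \<in> G)" for x
  have h: "h x = y" if "(x, y) \<in> G" for x y
    unfolding h_def using that graph_hom_fun[OF g(1)] by (intro the_equality) blast+
  have hG: "(x, h x) \<in> G" if "x \<in> K" for x
    using that h by (auto simp: K_def)
  have fK: "field (L\<lparr>carrier := K\<rparr>)" using subfield_iff(2)[OF K'] .
  have hom: "h \<in> ring_hom (L\<lparr>carrier := K\<rparr>) L"
    using hG D(2,4,5) D(9)[OF hG] by (auto intro!: ring_hom_memI h)
  interpret Kf: field "L\<lparr>carrier := K\<rparr>" by (rule fK)
  interpret Hom: ring_hom_ring "L\<lparr>carrier := K\<rparr>" L h
    by (rule ring_hom_ringI2[OF Kf.ring_axioms ring_axioms hom])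
  have sK: "subring K L" using subfieldE(1)[OF K'] .
  have KX: "K[X]\<^bsub>L\<^esub> = poly_ring (L\<lparr>carrier := K\<rparr>)" using univ_poly_consistent[OF sK] by simp
  define q where "q = Irr K a"
  have q: "q \<in> carrier (K[X])" "pirreducible K q" using IrrE[OF K' a(1) a'] by (simp_all add: q_def)
  have hq: "map h q \<in> carrier (poly_ring L)"
    using polynomial_hom[OF hom fK field_axioms] q(1) KX by simp
  have "degree q > 0" using pirreducible_degree[OF K' q] by simp
  then obtain b where b: "b \<in> carrier L" "eval (map h q) b = \<zero>"
    using exists_root_if_nonconstant[OF hq] by auto
  have "y = \<zero>" if xy: "(\<zero>, y) \<in> adjoin G a b" for y
  proof -
    obtain p where p: "set p \<subseteq> G" "p = [] \<or> hd p \<noteq> (\<zero>, \<zero>)"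
      "\<zero> = eval (map fst p) a" "y = eval (map snd p) b"
      using adjoinE[OF s a(1) b(1) xy] by (metis prod.inject)
    have pX: "map fst p \<in> carrier (K[X])"
    proof (cases "p = []")
      case False
      then have "hd p \<in> G" using p(1) hd_in_set by blast
      then have "fst (hd p) \<noteq> \<zero>" using p(2) False D(7) by (metis prod.collapse)
      then show ?thesis
        using p(1) False by (auto simp: univ_poly_carrier[symmetric] polynomial_def hd_map K_def)
    qed (simp add: univ_poly_zero_closed)
    have "q pdivides (map fst p)" using Irr_minimal[OF K' a(1) a' pX] p(3) by (simp add: q_def)
    then have "q divides\<^bsub>K[X]\<^esub> (map fst p)" using pdivides_iff_shell[OF K' q(1) pX] by simp
    then obtain r where r: "r \<in> carrier (K[X])" "map fst p = q \<otimes>\<^bsub>K[X]\<^esub> r" by (auto simp: factor_def)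
    have set: "set q \<subseteq> K" "set r \<subseteq> K" using q(1) r(1) 
      by (auto simp: univ_poly_carrier[symmetric] polynomial_def)
    then have hs: "set (map h q) \<subseteq> carrier L" "set (map h r) \<subseteq> carrier L"
      using Hom.hom_closed by auto
    have "map snd p = map h (map fst p)" using p(1) h by auto
    also have "map fst p = poly_mult q r" using r(2) by (simp add: univ_poly_mult)
    finally have eq: "map snd p = map h (poly_mult q r)" .
    have sp: "set (map snd p) \<subseteq> carrier L" using p(1) D(1) by auto
    have "y = eval (normalize (map h (poly_mult q r))) b"
      using p(4) eval_normalize[OF sp b(1)] eq by simp
    also have "normalize (map h (poly_mult q r)) = poly_mult (map h q) (map h r)"
      using Hom.poly_mult_hom'[of q r] set poly_mult_consistent[OF sK] by simp
    also have "eval \<dots> b = eval (map h q) b \<otimes> eval (map h r) b"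
      using eval_poly_mult[OF hs b(1)] .
    also have "\<dots> = \<zero>" using b eval_in_carrier[OF hs(2) b(1)] by simp
    finally show ?thesis .
  qed
  then have g1: "graph_hom (adjoin G a b)"
    using adjoin_subring(1)[OF s a(1) b(1)] by (simp add: graph_hom_def)
  have "x = \<zero>" if xy: "(x, \<zero>) \<in> adjoin G a b" for x
  proof (rule ccontr)
    assume "x \<noteq> \<zero>"
    have sf: "subfield (simple_extension K a) L" using simple_extension_is_subfield[OF K' a(1)] a' by simp
    have x: "x \<in> simple_extension K a" "x \<in> carrier L"
      using xy fst_adjoin[OF s a(1) b(1)] graph_homD(8)[OF g1] by (force simp: K_def)+
    then have "inv x \<in> simple_extension K a" using subfield_m_inv(1)[OF sf] \<open>x \<noteq> \<zero>\<close> by blast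
    then obtain w where w: "(inv x, w) \<in> adjoin G a b"
      using fst_adjoin[OF s a(1) b(1)] by (force simp: K_def)
    \<comment> \<open>a nonzero \<open>x\<close> that is sent to \<open>\<zero>\<close> would force \<open>\<one>\<close> to be sent to \<open>\<zero>\<close>\<close>
    have "(x \<otimes> inv x, \<zero> \<otimes> w) \<in> adjoin G a b" using graph_homD(5)[OF g1 xy w] .
    then have "(\<one>, \<zero>) \<in> adjoin G a b"
      using x \<open>x \<noteq> \<zero>\<close> graph_homD(9)[OF g1 w] by (simp add: field_Units)
    then show False using graph_hom_fun[OF g1 _ graph_homD(2)[OF g1]] one_not_zero by metis
  qed
  then have "graph_iso (adjoin G a b)"
    using g1 subring_converse[of "adjoin G a b"] by (auto simp: graph_iso_def graph_hom_def)
  then show thesis using that b(1) by blast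
qed

text \<open>Uniqueness of the algebraic closure in the form needed here. A maximal partial isomorphism above \<open>G\<close>
is defined everywhere, since its domain is a field over which \<open>L\<close> is algebraic. Because \<open>G\<close> is its own
converse, the same argument applied to the converse shows that it is onto.\<close>

lemma exists_automorphism_extending_graph:
  assumes G: "graph_iso G" and alg: "\<And>x. x \<in> carrier L \<Longrightarrow> (algebraic over (fst ` G)) x"
    and sym: "G\<inverse> = G"
  obtains \<sigma> where "\<sigma> \<in> ring_iso L L" "\<And>x y. (x, y) \<in> G \<Longrightarrow> \<sigma> x = y"
proof -
  let ?A = "{H. graph_iso H \<and> G \<subseteq> H}"
  have "\<exists>M\<in>?A. \<forall>W\<in>?A. M \<subseteq> W \<longrightarrow> W = M"
  proof (rule subset_Zorn_nonempty)
    show "?A \<noteq> {}" using G by blast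
    fix C assume C: "C \<noteq> {}" "subset.chain ?A C"
    have "graph_iso (\<Union>C)" using C by (intro graph_iso_Union) (auto simp: subset_chain_def)
    moreover have "G \<subseteq> \<Union>C" using C unfolding subset_chain_def by blast
    ultimately show "\<Union>C \<in> ?A" by blast
  qed
  then obtain H where "H \<in> ?A" and maximal: "\<forall>W\<in>?A. H \<subseteq> W \<longrightarrow> W = H" by blast
  then have H: "graph_iso H" "G \<subseteq> H" by simp_all
  have max: "H' = H" if "graph_iso H'" "H \<subseteq> H'" for H'
    using maximal H(2) that by blast
  have full: "fst ` H' = carrier L"
    if H': "graph_iso H'" "G \<subseteq> H'" and max': "\<And>W. graph_iso W \<Longrightarrow> H' \<subseteq> W \<Longrightarrow> W = H'" for H'
  proof
    have gh: "graph_hom H'" using H' by (simp add: graph_iso_def)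
    show "fst ` H' \<subseteq> carrier L" using graph_homD(1)[OF gh] by auto
    show "carrier L \<subseteq> fst ` H'"
    proof
      fix a assume a: "a \<in> carrier L"
      have K: "subfield (fst ` H') L" using subfield_fst_maximal_graph_iso[OF H'(1) max'] .
      have "(algebraic over (fst ` H')) a"
        using algebraic_mono[OF image_mono[OF H'(2)] alg[OF a]] .
      then obtain b where b: "b \<in> carrier L" "graph_iso (adjoin H' a b)"
        using graph_iso_adjoin_algebraic[OF H'(1) K a] by blast
      have s: "subring H' (RDirProd L L)" using gh by (simp add: graph_hom_def)
      have "adjoin H' a b = H'" using max'[OF b(2)] adjoin_subring(2)[OF s a b(1)] by simp
      then show "a \<in> fst ` H'" using adjoin_subring(3)[OF s a b(1)] by force
    qed
  qed
  have fst_H: "fst ` H = carrier L" using full[OF H max] .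
  have max_conv: "W = H\<inverse>" if "graph_iso W" "H\<inverse> \<subseteq> W" for W
  proof -
    have "H \<subseteq> W\<inverse>" using that(2) by auto
    then have "W\<inverse> = H" using that(1) by (intro max) simp_all
    then show ?thesis by auto
  qed
  have "G\<inverse> \<subseteq> H\<inverse>" using H(2) by auto
  then have "G \<subseteq> H\<inverse>" unfolding sym .
  then have "fst ` (H\<inverse>) = carrier L" using H(1) by (intro full max_conv) simp_all
  moreover have "fst ` (H\<inverse>) = snd ` H" by (force simp: image_iff)
  ultimately have snd_H: "snd ` H = carrier L" by simp
  have gh: "graph_hom H" "graph_hom (H\<inverse>)" using H(1) by (auto simp: graph_iso_def)
  define \<sigma> where "\<sigma> x = (THE y. (x, y) \<in> H)" for x
  have \<sigma>: "\<sigma> x = y" if "(x, y) \<in> H" for x y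
    unfolding \<sigma>_def using that graph_hom_fun[OF gh(1)] by (intro the_equality) blast+
  have \<sigma>H: "(x, \<sigma> x) \<in> H" if "x \<in> carrier L" for x
  proof -
    obtain y where "(x, y) \<in> H" using \<open>x \<in> carrier L\<close> fst_H by force
    then show ?thesis using \<sigma> by simp
  qed
  note D = graph_homD[OF gh(1)]
  have "\<sigma> \<in> ring_hom L L"
    using \<sigma>H D(2,4,5) D(9)[OF \<sigma>H] by (intro ring_hom_memI) (simp_all add: \<sigma>)
  moreover have "bij_betw \<sigma> (carrier L) (carrier L)"
  proof (rule bij_betw_imageI)
    show "inj_on \<sigma> (carrier L)"
    proof (rule inj_onI)
      fix x x' assume "x \<in> carrier L" "x' \<in> carrier L" "\<sigma> x = \<sigma> x'"
      then have "(\<sigma> x, x) \<in> H\<inverse>" "(\<sigma> x, x') \<in> H\<inverse>" using \<sigma>H by force+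
      then show "x = x'" using graph_hom_fun[OF gh(2)] by blast
    qed
    show "\<sigma> ` carrier L = carrier L"
    proof
      show "\<sigma> ` carrier L \<subseteq> carrier L" using D(9)[OF \<sigma>H] by blast
      show "carrier L \<subseteq> \<sigma> ` carrier L"
      proof
        fix y assume "y \<in> carrier L"
        then obtain x where "(x, y) \<in> H" using snd_H by force
        then show "y \<in> \<sigma> ` carrier L" using \<sigma> D(8) by force
      qed
    qed
  qed
  ultimately have "\<sigma> \<in> ring_iso L L" by (simp add: ring_iso_def)
  then show thesis using that \<sigma> H(2) by blast
qed

text \<open>The graph generated by \<open>(a, c)\<close> and \<open>(c, a)\<close> over the identity of \<open>K\<close> is functional, because both
adjunctions are transcendental. It is invariant under taking the converse, hence also injective.

Within the graphs that equal their converse, a maximal one has a domain over which \<open>L\<close> is algebraic: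
an element \<open>x\<close> that is transcendental over the domain could be sent to itself.\<close>

lemma exists_automorphism_swapping:
  assumes K: "subring K L" and a: "a \<in> carrier L" "(transcendental over K) a"
    and c: "c \<in> carrier L" "(transcendental over (simple_extension K a)) c"
  obtains \<sigma> where "\<sigma> \<in> ring_iso L L" "\<And>x. x \<in> K \<Longrightarrow> \<sigma> x = x" "\<sigma> a = c" "\<sigma> c = a"
proof -
  have g0: "graph_hom (Id_on K)" using K by (rule graph_hom_diagonal)
  let ?G1 = "adjoin (Id_on K) a c"
  let ?G2 = "adjoin ?G1 c a"
  have f0: "fst ` Id_on K = K" by force
  have s0: "subring (Id_on K) (RDirProd L L)" using g0 by (simp add: graph_hom_def)
  have g1: "graph_hom ?G1" by (rule graph_hom_adjoin_transcendental) (simp_all add: f0 g0 a c(1))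
  have s1: "subring ?G1 (RDirProd L L)" using g1 by (simp add: graph_hom_def)
  have f1: "fst ` ?G1 = simple_extension K a" using fst_adjoin[OF s0 a(1) c(1)] f0 by simp
  have g2: "graph_hom ?G2" by (rule graph_hom_adjoin_transcendental) (simp_all add: f1 g1 a(1) c)
  have s2: "subring ?G2 (RDirProd L L)" using g2 by (simp add: graph_hom_def)
  note m1 = adjoin_subring[OF s0 a(1) c(1)] and m2 = adjoin_subring[OF s1 c(1) a(1)]
  have "Id_on K \<subseteq> ?G2\<inverse>" "(a, c) \<in> ?G2\<inverse>" "(c, a) \<in> ?G2\<inverse>"
    using m1(2,3) m2(2,3) by blast+
  then have "?G2 \<subseteq> ?G2\<inverse>"
    by (intro adjoin_minimal subring_converse[OF s2])
  then have sym2: "?G2\<inverse> = ?G2" by auto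
  let ?A = "{G. graph_hom G \<and> G\<inverse> = G \<and> ?G2 \<subseteq> G}"
  have "\<exists>M\<in>?A. \<forall>W\<in>?A. M \<subseteq> W \<longrightarrow> W = M"
  proof (rule subset_Zorn_nonempty)
    show "?A \<noteq> {}" using g2 sym2 by blast
    fix C assume C: "C \<noteq> {}" "subset.chain ?A C"
    have "graph_hom (\<Union>C)" using C by (intro graph_hom_Union) (auto simp: subset_chain_def)
    moreover have "(y, x) \<in> G \<longleftrightarrow> (x, y) \<in> G" if "G \<in> C" for G x y
      using that C(2) converse_iff[of y x G] unfolding subset_chain_def by fastforce
    then have "(\<Union>C)\<inverse> = \<Union>C" by auto
    moreover have "?G2 \<subseteq> \<Union>C" using C unfolding subset_chain_def by blast
    ultimately show "\<Union>C \<in> ?A" by blast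
  qed
  then obtain G where "G \<in> ?A" and maximal: "\<forall>W\<in>?A. G \<subseteq> W \<longrightarrow> W = G" by blast
  then have G: "graph_hom G" "G\<inverse> = G" "?G2 \<subseteq> G" by simp_all
  have max: "W = G" if "graph_hom W" "W\<inverse> = W" "G \<subseteq> W" for W
    using maximal G(3) that by (metis (mono_tags, lifting) mem_Collect_eq subset_trans)
  have sG: "subring G (RDirProd L L)" using G by (simp add: graph_hom_def)
  have alg: "(algebraic over (fst ` G)) x" if x: "x \<in> carrier L" for x
  proof (rule ccontr)
    assume "\<not> (algebraic over (fst ` G)) x"
    then have tr: "(transcendental over (fst ` G)) x" by (simp add: over_def)
    let ?W = "adjoin G x x"
    note m = adjoin_subring[OF sG x x]
    have "G\<inverse> \<subseteq> ?W\<inverse>" "(x, x) \<in> ?W\<inverse>" using m(2,3) by auto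
    then have "?W \<subseteq> ?W\<inverse>"
      unfolding G(2) by (rule adjoin_minimal[OF subring_converse[OF m(1)]])
    then have "?W\<inverse> = ?W" by auto
    then have "?W = G" using max[OF graph_hom_adjoin_transcendental[OF G(1) x x tr]] m(2) by blast
    then have "x \<in> fst ` G" using m(3) by force
    then have "(algebraic over (fst ` G)) x" using algebraic_self[OF subring_fst[OF sG]] by blast
    then show False using \<open>\<not> (algebraic over (fst ` G)) x\<close> by blast
  qed
  have "graph_iso G" using G by (simp add: graph_iso_def)
  then obtain \<sigma> where \<sigma>: "\<sigma> \<in> ring_iso L L" "\<And>x y. (x, y) \<in> G \<Longrightarrow> \<sigma> x = y"
    using exists_automorphism_extending_graph[OF _ alg G(2)] by blast
  show thesis
  proof (rule that[OF \<sigma>(1)])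
    have sub: "Id_on K \<subseteq> G" "(a, c) \<in> G" "(c, a) \<in> G" using m1(2,3) m2(2,3) G(3) by (meson subset_trans subsetD)+
    show "\<sigma> x = x" if "x \<in> K" for x using sub(1) that by (intro \<sigma>(2)) blast
    show "\<sigma> a = c" "\<sigma> c = a" using sub by (simp_all add: \<sigma>(2))
  qed
qed

end

section \<open>A countable set that every finite set of scalars can be moved into\<close>

context field begin

text \<open>Elements outside such an \<open>M\<close> are transcendental over \<open>M\<close>. The inverse of a nonzero element \<open>x\<close>
of \<open>M\<close> is a root of \<open>x t - 1\<close>, so such a subring is a subfield.\<close>

definition alg_closed_in :: "'a set \<Rightarrow> bool" where
  "alg_closed_in M \<longleftrightarrow> subring M R \<and> (\<forall>x\<in>carrier R. (algebraic over M) x \<longrightarrow> x \<in> M)"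

text \<open>Close under the ring operations and under adding the roots of polynomials, countably often. A
polynomial over the union has its finitely many coefficients in one of the stages.\<close>

lemma countable_alg_closed_superset:
  assumes S: "countable S" "S \<subseteq> carrier R"
  obtains M where "S \<subseteq> M" "countable M" "alg_closed_in M"
proof -
  define poly where "poly N = {p \<in> carrier (poly_ring R). p \<in> lists N}" for N
  define step where "step N = N \<union> {\<one>} \<union> (\<lambda>x. \<ominus> x) ` N \<union> (\<lambda>(x, y). x \<otimes> y) ` (N \<times> N) \<union>
    (\<lambda>(x, y). x \<oplus> y) ` (N \<times> N) \<union> (\<Union>p\<in>poly N. {x. is_root p x})" for N
  define stage where "stage n = (step ^^ n) S" for n
  have stage_Suc: "stage (Suc n) = step (stage n)" for n by (simp add: stage_def)
  have countable: "countable (stage n)" for n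
  proof (induction n)
    case 0 then show ?case using S by (simp add: stage_def)
  next
    case (Suc n)
    have "countable (poly (stage n))"
      unfolding poly_def by (rule countable_subset[OF _ countable_lists[OF Suc]]) auto
    moreover have "countable {x. is_root p x}" if "p \<in> poly (stage n)" for p
      using that finite_number_of_roots by (auto simp: poly_def intro: countable_finite)
    ultimately show ?case using Suc unfolding stage_Suc step_def
      by (intro countable_Un countable_UN countable_image countable_SIGMA) simp_all
  qed
  have carrier: "stage n \<subseteq> carrier R" for n
  proof (induction n)
    case 0 then show ?case using S by (simp add: stage_def)
  next
    case (Suc n)
    then show ?case unfolding stage_Suc step_def by (auto simp: is_root_def)
  qed
  have mono: "stage m \<subseteq> stage n" if "m \<le> n" for m n
    by (rule lift_Suc_mono_le[OF _ that]) (auto simp: stage_Suc step_def)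
  define M where "M = (\<Union>n. stage n)"
  have finite_in: "\<exists>n. B \<subseteq> stage n" if "finite B" "B \<subseteq> M" for B
    using that
  proof (induction B rule: finite_induct)
    case (insert x B)
    then obtain n k where "B \<subseteq> stage n" "x \<in> stage k" by (auto simp: M_def)
    then have "insert x B \<subseteq> stage (max n k)" using mono[of n "max n k"] mono[of k "max n k"] by auto
    then show ?case ..
  qed simp
  have sub: "subring M R"
  proof (rule subringI)
    show "M \<subseteq> carrier R" using carrier by (auto simp: M_def)
    show "\<one> \<in> M" using stage_Suc[of 0] by (auto simp: M_def step_def)
    show "\<ominus> x \<in> M" if "x \<in> M" for x
    proof -
      obtain n where "x \<in> stage n" using \<open>x \<in> M\<close> by (auto simp: M_def)
      then have "\<ominus> x \<in> stage (Suc n)" by (auto simp: stage_Suc step_def)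
      then show ?thesis unfolding M_def by blast
    qed
    show "x \<otimes> y \<in> M" "x \<oplus> y \<in> M" if "x \<in> M" "y \<in> M" for x y
    proof -
      obtain n where "{x, y} \<subseteq> stage n" using finite_in[of "{x, y}"] \<open>x \<in> M\<close> \<open>y \<in> M\<close> by blast
      then have "x \<otimes> y \<in> stage (Suc n)" "x \<oplus> y \<in> stage (Suc n)"
        by (auto simp: stage_Suc step_def)
      then show "x \<otimes> y \<in> M" "x \<oplus> y \<in> M" unfolding M_def by blast+
    qed
  qed
  have "x \<in> M" if x: "x \<in> carrier R" "(algebraic over M) x" for x
  proof -
    obtain p where p: "p \<in> carrier (M[X])" "p \<noteq> []" "eval p x = \<zero>"
      using algebraicE[OF sub x] .
    have "set p \<subseteq> M" using p(1) by (auto simp: univ_poly_carrier[symmetric] polynomial_def)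
    then obtain n where "set p \<subseteq> stage n" using finite_in[of "set p"] by auto
    moreover have "p \<in> carrier (poly_ring R)" using p(1) sub carrier_polynomial_shell by blast
    ultimately have "p \<in> poly (stage n)" by (auto simp: poly_def)
    then have "x \<in> stage (Suc n)" using p x by (auto simp: stage_Suc step_def is_root_def)
    then show ?thesis unfolding M_def by blast
  qed
  then have "alg_closed_in M" using sub by (simp add: alg_closed_in_def)
  moreover have "S \<subseteq> M" using stage_def[of 0] by (auto simp: M_def)
  ultimately show thesis using that countable by (auto simp: M_def)
qed

end

context algebraically_closed begin

text \<open>An element \<open>c\<close> that avoids two countable sets can be exchanged with \<open>a\<close> and with \<open>b\<close>; composing the
two exchanges moves \<open>a\<close> to \<open>b\<close>.\<close>

lemma exists_automorphism_moving:
  assumes "uncountable (carrier L)" and M: "countable M" "alg_closed_in M"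
    and a: "a \<in> carrier L" "a \<notin> M" and b: "b \<in> carrier L" "b \<notin> M"
  obtains \<phi> where "\<phi> \<in> ring_iso L L" "\<And>x. x \<in> M \<Longrightarrow> \<phi> x = x" "\<phi> a = b"
proof -
  have M': "subring M L" "M \<subseteq> carrier L" using M(2) subringE(1) by (auto simp: alg_closed_in_def)
  obtain A where A: "insert a M \<subseteq> A" "countable A" "alg_closed_in A"
    using countable_alg_closed_superset[of "insert a M"] M(1) M'(2) a(1) by auto
  obtain B where B: "insert b M \<subseteq> B" "countable B" "alg_closed_in B"
    using countable_alg_closed_superset[of "insert b M"] M(1) M'(2) b(1) by auto
  have "uncountable (carrier L - (A \<union> B))"
    using assms(1) A(2) B(2) by (simp add: uncountable_minus_countable)
  then obtain c where c: "c \<in> carrier L" "c \<notin> A" "c \<notin> B"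
    by (metis Diff_iff UnI1 UnI2 countable_empty ex_in_conv)
  have swap: "\<exists>\<phi>\<in>ring_iso L L. (\<forall>x\<in>M. \<phi> x = x) \<and> \<phi> d = c \<and> \<phi> c = d"
    if d: "d \<in> carrier L" "d \<notin> M" and D: "insert d M \<subseteq> D" "alg_closed_in D" "c \<notin> D" for d D
  proof -
    have sD: "subring D L" using D(2) by (simp add: alg_closed_in_def)
    have "(transcendental over M) d"
      using M(2) d by (auto simp: alg_closed_in_def over_def)
    moreover have "(transcendental over D) c"
      using D(2,3) c(1) by (auto simp: alg_closed_in_def over_def)
    then have "(transcendental over (simple_extension M d)) c"
      using transcendental_mono simple_extension_subring_incl[OF sD] D(1) by blast
    ultimately show ?thesis
      using exists_automorphism_swapping[OF M'(1) d(1) _ c(1)] by metis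
  qed
  obtain \<phi> where \<phi>: "\<phi> \<in> ring_iso L L" "\<forall>x\<in>M. \<phi> x = x" "\<phi> a = c"
    using swap[OF a A(1,3) c(2)] by blast
  obtain \<psi> where \<psi>: "\<psi> \<in> ring_iso L L" "\<forall>x\<in>M. \<psi> x = x" "\<psi> c = b"
    using swap[OF b B(1,3) c(3)] by blast
  show thesis
    by (rule that[of "\<psi> \<circ> \<phi>"]) (use \<phi> \<psi> ring_iso_set_trans in auto)
qed

text \<open>\<open>C\<close> is the union of the sets \<open>M n\<close>, where \<open>M (n + 1)\<close> contains an element outside \<open>M n\<close>. Once a part
of \<open>T\<close> has been moved into \<open>M n\<close>, the next element either lies in \<open>M n\<close> already or can be moved into
\<open>M (n + 1)\<close> without disturbing \<open>M n\<close>.\<close>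

lemma exists_countable_set_meeting_orbits:
  assumes S: "countable S" "S \<subseteq> carrier L"
  obtains C where "countable C" "C \<subseteq> carrier L"
    "\<And>T. finite T \<Longrightarrow> T \<subseteq> carrier L \<Longrightarrow>
      \<exists>\<phi>\<in>ring_iso L L. (\<forall>x\<in>S. \<phi> x = x) \<and> \<phi> ` T \<subseteq> C"
proof (cases "countable (carrier L)")
  case True
  have "id \<in> ring_iso L L" by (rule ring_iso_set_refl)
  then show thesis by (intro that[OF True]) (auto intro!: bexI[of _ id])
next
  case False
  define cl where "cl N = (SOME M. N \<subseteq> M \<and> countable M \<and> alg_closed_in M)" for N
  have cl: "N \<subseteq> cl N \<and> countable (cl N) \<and> alg_closed_in (cl N)"
    if N: "countable N" "N \<subseteq> carrier L" for N
    unfolding cl_def by (rule someI_ex) (meson N countable_alg_closed_superset)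
  define y where "y N = (SOME y. y \<in> carrier L - N)" for N
  have y: "y N \<in> carrier L - N" if "countable N" for N
    unfolding y_def
    by (rule someI_ex) (metis False countable_empty ex_in_conv that uncountable_minus_countable)
  define M where "M n = ((\<lambda>N. cl (insert (y N) N)) ^^ n) (cl S)" for n
  have M_Suc: "M (Suc n) = cl (insert (y (M n)) (M n))" for n by (simp add: M_def)
  have ac: "N \<subseteq> carrier L" if "alg_closed_in N" for N
    using that subringE(1) by (auto simp: alg_closed_in_def)
  have M: "countable (M n) \<and> alg_closed_in (M n)" for n
  proof (induction n)
    case 0 then show ?case using cl[OF S] by (simp add: M_def)
  next
    case (Suc n)
    then show ?case using cl[of "insert (y (M n)) (M n)"] y[of "M n"] ac by (simp add: M_Suc)
  qed
  have step: "insert (y (M n)) (M n) \<subseteq> M (Suc n)" for n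
    using cl[of "insert (y (M n)) (M n)"] y[of "M n"] ac M[of n] by (simp add: M_Suc)
  have mono: "M m \<subseteq> M n" if "m \<le> n" for m n
    by (rule lift_Suc_mono_le[OF _ that]) (use step in blast)
  have S_sub: "S \<subseteq> M n" for n
    using cl[OF S] mono[of 0 n] by (auto simp: M_def)
  have move: "\<exists>n. \<exists>\<phi>\<in>ring_iso L L. (\<forall>x\<in>S. \<phi> x = x) \<and> \<phi> ` T \<subseteq> M n"
    if "finite T" "T \<subseteq> carrier L" for T
    using that
  proof (induction T rule: finite_induct)
    case empty
    have "id \<in> ring_iso L L" by (rule ring_iso_set_refl)
    then show ?case by (auto intro!: bexI[of _ id])
  next
    case (insert t T)
    then obtain n \<phi> where \<phi>: "\<phi> \<in> ring_iso L L" "\<forall>x\<in>S. \<phi> x = x" "\<phi> ` T \<subseteq> M n" by auto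
    have t: "\<phi> t \<in> carrier L" using \<phi>(1) insert.prems ring_iso_memE(1) by fastforce
    show ?case
    proof (cases "\<phi> t \<in> M n")
      case True
      then show ?thesis using \<phi> by blast
    next
      case False
      obtain \<psi> where \<psi>: "\<psi> \<in> ring_iso L L" "\<And>x. x \<in> M n \<Longrightarrow> \<psi> x = x" "\<psi> (\<phi> t) = y (M n)"
        using exists_automorphism_moving[of "M n" "\<phi> t" "y (M n)"] False t M[of n] y[of "M n"]
          \<open>uncountable (carrier L)\<close> by auto
      have "\<psi> \<circ> \<phi> \<in> ring_iso L L" using \<phi> \<psi> ring_iso_set_trans by blast
      moreover have "\<forall>x\<in>S. (\<psi> \<circ> \<phi>) x = x" using \<phi> \<psi> S_sub[of n] by auto
      moreover have "(\<psi> \<circ> \<phi>) ` insert t T \<subseteq> M (Suc n)"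
        using \<phi>(3) \<psi>(2,3) step[of n] by (auto simp: image_subset_iff)
      ultimately show ?thesis by blast
    qed
  qed
  show thesis
  proof (rule that[of "\<Union>n. M n"])
    show "countable (\<Union>n. M n)" using M by auto
    show "(\<Union>n. M n) \<subseteq> carrier L" using M ac by blast
    show "\<exists>\<phi>\<in>ring_iso L L. (\<forall>x\<in>S. \<phi> x = x) \<and> \<phi> ` T \<subseteq> (\<Union>n. M n)"
      if "finite T" "T \<subseteq> carrier L" for T
      using move[OF that] by blast
  qed
qed

end

section \<open>Matrix algebras\<close>

lemma (in abelian_monoid) finsum_swap:
  assumes "finite A" "finite B" "\<And>a b. a \<in> A \<Longrightarrow> b \<in> B \<Longrightarrow> f a b \<in> carrier G"
  shows "(\<Oplus>a\<in>A. \<Oplus>b\<in>B. f a b) = (\<Oplus>b\<in>B. \<Oplus>a\<in>A. f a b)"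
  using assms(1,3)
proof (induction A rule: finite_induct)
  case empty then show ?case by (simp add: finsum_zero)
next
  case (insert a A)
  have "(\<Oplus>b\<in>B. \<Oplus>a\<in>insert a A. f a b) = (\<Oplus>b\<in>B. f a b \<oplus> (\<Oplus>a\<in>A. f a b))"
    using insert by (intro finsum_cong') (auto simp: Pi_def intro!: finsum_closed)
  also have "\<dots> = (\<Oplus>b\<in>B. f a b) \<oplus> (\<Oplus>b\<in>B. \<Oplus>a\<in>A. f a b)"
    using insert by (intro finsum_addf) (auto simp: Pi_def intro!: finsum_closed)
  finally show ?case
    using insert by (simp add: Pi_def finsum_closed)
qed

lemma (in abelian_monoid) finsum_delta:
  assumes "finite A" "i \<in> A" "f i \<in> carrier G"
    "\<And>k. k \<in> A \<Longrightarrow> k \<noteq> i \<Longrightarrow> f k = \<zero>"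
  shows "(\<Oplus>k\<in>A. f k) = f i"
proof -
  have "(\<Oplus>k\<in>A. f k) = (\<Oplus>k\<in>A. if i = k then f i else \<zero>)"
    using assms by (intro finsum_cong') auto
  also have "\<dots> = f i"
    using add.finprod_singleton[OF assms(2,1), of "\<lambda>_. f i"] assms(3) by simp
  finally show ?thesis .
qed

text \<open>Stated for merely additive maps, since the inclusion of a corner into its ring does not preserve the
unit.\<close>

lemma additive_finsum:
  assumes "abelian_monoid A" "abelian_monoid B"
    "h \<in> carrier A \<rightarrow> carrier B" "h \<zero>\<^bsub>A\<^esub> = \<zero>\<^bsub>B\<^esub>"
    "\<And>x y. x \<in> carrier A \<Longrightarrow> y \<in> carrier A \<Longrightarrow> h (x \<oplus>\<^bsub>A\<^esub> y) = h x \<oplus>\<^bsub>B\<^esub> h y"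
    and "finite S" "f \<in> S \<rightarrow> carrier A"
  shows "h (finsum A f S) = finsum B (\<lambda>s. h (f s)) S"
proof -
  interpret A: abelian_monoid A by fact
  interpret B: abelian_monoid B by fact
  show ?thesis
    using assms(6,7)
  proof (induction S rule: finite_induct)
    case empty then show ?case using assms by simp
  next
    case (insert s S)
    then have "f \<in> S \<rightarrow> carrier A" "f s \<in> carrier A" by auto
    moreover have "(\<lambda>s. h (f s)) \<in> S \<rightarrow> carrier B" "h (f s) \<in> carrier B" using insert assms(3) by auto
    ultimately show ?case using insert assms(5) by simp
  qed
qed

lemma carrier_mat_alg: "carrier (mat_alg n B) = {..<n} \<times> {..<n} \<rightarrow>\<^sub>E carrier B"
  by (simp add: mat_alg_def Let_def)

lemma mat_alg_entry:
  "M \<in> carrier (mat_alg n B) \<Longrightarrow> i < n \<Longrightarrow> j < n \<Longrightarrow> M (i, j) \<in> carrier B"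
  by (auto simp: carrier_mat_alg PiE_iff)

lemma mat_alg_eqI:
  assumes "M \<in> extensional ({..<n} \<times> {..<n})" "N \<in> extensional ({..<n} \<times> {..<n})"
    "\<And>i j. i < n \<Longrightarrow> j < n \<Longrightarrow> M (i, j) = N (i, j)"
  shows "M = N"
  using assms by (intro extensionalityI[of M "{..<n} \<times> {..<n}"]) auto

lemma mat_alg_ops:
  "i < n \<Longrightarrow> j < n \<Longrightarrow> (M \<otimes>\<^bsub>mat_alg n B\<^esub> N) (i, j) = (\<Oplus>\<^bsub>B\<^esub>k\<in>{..<n}. M (i, k) \<otimes>\<^bsub>B\<^esub> N (k, j))"
  "i < n \<Longrightarrow> j < n \<Longrightarrow> (M \<oplus>\<^bsub>mat_alg n B\<^esub> N) (i, j) = M (i, j) \<oplus>\<^bsub>B\<^esub> N (i, j)"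
  "i < n \<Longrightarrow> j < n \<Longrightarrow> \<one>\<^bsub>mat_alg n B\<^esub> (i, j) = (if i = j then \<one>\<^bsub>B\<^esub> else \<zero>\<^bsub>B\<^esub>)"
  "i < n \<Longrightarrow> j < n \<Longrightarrow> \<zero>\<^bsub>mat_alg n B\<^esub> (i, j) = \<zero>\<^bsub>B\<^esub>"
  "i < n \<Longrightarrow> j < n \<Longrightarrow> (\<alpha> \<odot>\<^bsub>mat_alg n B\<^esub> M) (i, j) = \<alpha> \<odot>\<^bsub>B\<^esub> M (i, j)"
  by (simp_all add: mat_alg_def Let_def)

lemma mat_alg_extensional:
  "M \<otimes>\<^bsub>mat_alg n B\<^esub> N \<in> extensional ({..<n} \<times> {..<n})"
  "M \<oplus>\<^bsub>mat_alg n B\<^esub> N \<in> extensional ({..<n} \<times> {..<n})"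
  "\<one>\<^bsub>mat_alg n B\<^esub> \<in> extensional ({..<n} \<times> {..<n})"
  "\<zero>\<^bsub>mat_alg n B\<^esub> \<in> extensional ({..<n} \<times> {..<n})"
  "\<alpha> \<odot>\<^bsub>mat_alg n B\<^esub> M \<in> extensional ({..<n} \<times> {..<n})"
  "M \<in> carrier (mat_alg n B) \<Longrightarrow> M \<in> extensional ({..<n} \<times> {..<n})"
  by (simp_all add: mat_alg_def Let_def PiE_iff)

lemma mat_algI:
  assumes "M \<in> extensional ({..<n} \<times> {..<n})" "\<And>i j. i < n \<Longrightarrow> j < n \<Longrightarrow> M (i, j) \<in> carrier B"
  shows "M \<in> carrier (mat_alg n B)"
  using assms by (auto simp: carrier_mat_alg PiE_iff)

lemma assoc_algebra_mat_alg:
  assumes "assoc_algebra F B"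
  shows "assoc_algebra F (mat_alg n B)"
proof -
  interpret Br: ring B using assms by (simp add: assoc_algebra_def)
  interpret B: assoc_algebra F B by fact
  let ?M = "mat_alg n B"
  note entry [simp] = mat_alg_entry and ops [simp] = mat_alg_ops and ext [simp] = mat_alg_extensional
  have fc: "(\<lambda>k. M (i, k) \<otimes>\<^bsub>B\<^esub> N (k, j)) \<in> {..<n} \<rightarrow> carrier B"
    if "M \<in> carrier ?M" "N \<in> carrier ?M" "i < n" "j < n" for M N i j
    using that by auto
  have mult_closed: "M \<otimes>\<^bsub>?M\<^esub> N \<in> carrier ?M" if "M \<in> carrier ?M" "N \<in> carrier ?M" for M N
    using that fc[OF that] by (intro mat_algI) auto
  have add_closed: "M \<oplus>\<^bsub>?M\<^esub> N \<in> carrier ?M" if "M \<in> carrier ?M" "N \<in> carrier ?M" for M N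
    using that by (intro mat_algI) auto
  have one_closed: "\<one>\<^bsub>?M\<^esub> \<in> carrier ?M" by (intro mat_algI) auto
  have zero_closed: "\<zero>\<^bsub>?M\<^esub> \<in> carrier ?M" by (intro mat_algI) auto
  have smult_closed: "\<alpha> \<odot>\<^bsub>?M\<^esub> M \<in> carrier ?M" if "M \<in> carrier ?M" "\<alpha> \<in> carrier F" for M \<alpha>
    using that by (intro mat_algI) auto
  note closed [simp] = mult_closed add_closed one_closed zero_closed smult_closed
  have eqI: "M = N" if "M \<in> carrier ?M" "N \<in> carrier ?M"
    "\<And>i j. i < n \<Longrightarrow> j < n \<Longrightarrow> M (i, j) = N (i, j)" for M N
    by (rule mat_alg_eqI[where n = n]) (use that ext(6) in blast)+
  have assoc: "M \<otimes>\<^bsub>?M\<^esub> N \<otimes>\<^bsub>?M\<^esub> P = M \<otimes>\<^bsub>?M\<^esub> (N \<otimes>\<^bsub>?M\<^esub> P)"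
    if M: "M \<in> carrier ?M" and N: "N \<in> carrier ?M" and P: "P \<in> carrier ?M" for M N P
  proof (rule eqI)
    fix i j assume ij: "i < n" "j < n"
    have "(M \<otimes>\<^bsub>?M\<^esub> N \<otimes>\<^bsub>?M\<^esub> P) (i, j) =
        (\<Oplus>\<^bsub>B\<^esub>k\<in>{..<n}. (\<Oplus>\<^bsub>B\<^esub>l\<in>{..<n}. M (i, l) \<otimes>\<^bsub>B\<^esub> N (l, k)) \<otimes>\<^bsub>B\<^esub> P (k, j))"
      using ij M N P by (auto intro!: Br.finsum_cong')
    also have "\<dots> = (\<Oplus>\<^bsub>B\<^esub>k\<in>{..<n}. \<Oplus>\<^bsub>B\<^esub>l\<in>{..<n}. M (i, l) \<otimes>\<^bsub>B\<^esub> N (l, k) \<otimes>\<^bsub>B\<^esub> P (k, j))"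
      using ij M N P fc[OF M N] by (intro Br.finsum_cong' Br.finsum_ldistr) auto
    also have "\<dots> = (\<Oplus>\<^bsub>B\<^esub>l\<in>{..<n}. \<Oplus>\<^bsub>B\<^esub>k\<in>{..<n}. M (i, l) \<otimes>\<^bsub>B\<^esub> N (l, k) \<otimes>\<^bsub>B\<^esub> P (k, j))"
      using ij M N P by (intro Br.finsum_swap) auto
    also have "\<dots> = (\<Oplus>\<^bsub>B\<^esub>l\<in>{..<n}. \<Oplus>\<^bsub>B\<^esub>k\<in>{..<n}. M (i, l) \<otimes>\<^bsub>B\<^esub> (N (l, k) \<otimes>\<^bsub>B\<^esub> P (k, j)))"
      using ij M N P by (intro Br.finsum_cong' Br.finsum_closed) (auto simp: Br.m_assoc)
    also have "\<dots> = (\<Oplus>\<^bsub>B\<^esub>l\<in>{..<n}. M (i, l) \<otimes>\<^bsub>B\<^esub> (\<Oplus>\<^bsub>B\<^esub>k\<in>{..<n}. N (l, k) \<otimes>\<^bsub>B\<^esub> P (k, j)))"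
      using ij M N P fc[OF N P] by (intro Br.finsum_cong' Br.finsum_rdistr[symmetric]) auto
    also have "\<dots> = (M \<otimes>\<^bsub>?M\<^esub> (N \<otimes>\<^bsub>?M\<^esub> P)) (i, j)"
      using ij M N P by (auto intro!: Br.finsum_cong')
    finally show "(M \<otimes>\<^bsub>?M\<^esub> N \<otimes>\<^bsub>?M\<^esub> P) (i, j) = (M \<otimes>\<^bsub>?M\<^esub> (N \<otimes>\<^bsub>?M\<^esub> P)) (i, j)" .
  qed (use that in simp_all)
  have ldist: "(M \<oplus>\<^bsub>?M\<^esub> N) \<otimes>\<^bsub>?M\<^esub> P = M \<otimes>\<^bsub>?M\<^esub> P \<oplus>\<^bsub>?M\<^esub> N \<otimes>\<^bsub>?M\<^esub> P"
    if M: "M \<in> carrier ?M" and N: "N \<in> carrier ?M" and P: "P \<in> carrier ?M" for M N P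
  proof (rule eqI)
    fix i j assume ij: "i < n" "j < n"
    have "((M \<oplus>\<^bsub>?M\<^esub> N) \<otimes>\<^bsub>?M\<^esub> P) (i, j) =
        (\<Oplus>\<^bsub>B\<^esub>k\<in>{..<n}. M (i, k) \<otimes>\<^bsub>B\<^esub> P (k, j) \<oplus>\<^bsub>B\<^esub> N (i, k) \<otimes>\<^bsub>B\<^esub> P (k, j))"
      unfolding ops(1)[OF ij] by (rule Br.finsum_cong') (use ij M N P in \<open>auto simp: Br.l_distr\<close>)
    then show "((M \<oplus>\<^bsub>?M\<^esub> N) \<otimes>\<^bsub>?M\<^esub> P) (i, j) = (M \<otimes>\<^bsub>?M\<^esub> P \<oplus>\<^bsub>?M\<^esub> N \<otimes>\<^bsub>?M\<^esub> P) (i, j)"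
      using ij fc[OF M P ij] fc[OF N P ij] by (simp add: Br.finsum_addf)
  qed (use that in simp_all)
  have rdist: "P \<otimes>\<^bsub>?M\<^esub> (M \<oplus>\<^bsub>?M\<^esub> N) = P \<otimes>\<^bsub>?M\<^esub> M \<oplus>\<^bsub>?M\<^esub> P \<otimes>\<^bsub>?M\<^esub> N"
    if M: "M \<in> carrier ?M" and N: "N \<in> carrier ?M" and P: "P \<in> carrier ?M" for M N P
  proof (rule eqI)
    fix i j assume ij: "i < n" "j < n"
    have "(P \<otimes>\<^bsub>?M\<^esub> (M \<oplus>\<^bsub>?M\<^esub> N)) (i, j) =
        (\<Oplus>\<^bsub>B\<^esub>k\<in>{..<n}. P (i, k) \<otimes>\<^bsub>B\<^esub> M (k, j) \<oplus>\<^bsub>B\<^esub> P (i, k) \<otimes>\<^bsub>B\<^esub> N (k, j))"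
      unfolding ops(1)[OF ij] by (rule Br.finsum_cong') (use ij M N P in \<open>auto simp: Br.r_distr\<close>)
    then show "(P \<otimes>\<^bsub>?M\<^esub> (M \<oplus>\<^bsub>?M\<^esub> N)) (i, j) = (P \<otimes>\<^bsub>?M\<^esub> M \<oplus>\<^bsub>?M\<^esub> P \<otimes>\<^bsub>?M\<^esub> N) (i, j)"
      using ij fc[OF P M ij] fc[OF P N ij] by (simp add: Br.finsum_addf)
  qed (use that in simp_all)
  have lone: "\<one>\<^bsub>?M\<^esub> \<otimes>\<^bsub>?M\<^esub> M = M" if M: "M \<in> carrier ?M" for M
  proof (rule eqI)
    fix i j assume ij: "i < n" "j < n"
    have "(\<one>\<^bsub>?M\<^esub> \<otimes>\<^bsub>?M\<^esub> M) (i, j) = \<one>\<^bsub>?M\<^esub> (i, i) \<otimes>\<^bsub>B\<^esub> M (i, j)"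
      using ij M by (simp, subst Br.finsum_delta[where i = i]) auto
    then show "(\<one>\<^bsub>?M\<^esub> \<otimes>\<^bsub>?M\<^esub> M) (i, j) = M (i, j)" using ij M by simp
  qed (use that in simp_all)
  have rone: "M \<otimes>\<^bsub>?M\<^esub> \<one>\<^bsub>?M\<^esub> = M" if M: "M \<in> carrier ?M" for M
  proof (rule eqI)
    fix i j assume ij: "i < n" "j < n"
    have "(M \<otimes>\<^bsub>?M\<^esub> \<one>\<^bsub>?M\<^esub>) (i, j) = M (i, j) \<otimes>\<^bsub>B\<^esub> \<one>\<^bsub>?M\<^esub> (j, j)"
      using ij M by (simp, subst Br.finsum_delta[where i = j]) auto
    then show "(M \<otimes>\<^bsub>?M\<^esub> \<one>\<^bsub>?M\<^esub>) (i, j) = M (i, j)" using ij M by simp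
  qed (use that in simp_all)
  have neg: "\<exists>N\<in>carrier ?M. N \<oplus>\<^bsub>?M\<^esub> M = \<zero>\<^bsub>?M\<^esub>" if M: "M \<in> carrier ?M" for M
  proof
    let ?N = "\<lambda>p\<in>{..<n} \<times> {..<n}. \<ominus>\<^bsub>B\<^esub> M p"
    show N: "?N \<in> carrier ?M" using M by (intro mat_algI) auto
    show "?N \<oplus>\<^bsub>?M\<^esub> M = \<zero>\<^bsub>?M\<^esub>" using M N by (intro eqI) (auto simp: Br.l_neg)
  qed
  have "abelian_group ?M"
    by (intro abelian_groupI neg) (auto intro!: eqI simp: Br.a_ac)
  moreover have "monoid ?M" by (intro monoidI) (auto simp: assoc lone rone)
  ultimately have R: "ring ?M" using ldist rdist by (intro ringI) auto
  have "module F ?M"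
    by (intro moduleI B.R.is_cring ring.is_abelian_group[OF R])
      (auto intro!: eqI simp: B.smult_l_distr B.smult_r_distr B.smult_assoc1)
  moreover have "(\<alpha> \<odot>\<^bsub>?M\<^esub> M) \<otimes>\<^bsub>?M\<^esub> N = \<alpha> \<odot>\<^bsub>?M\<^esub> (M \<otimes>\<^bsub>?M\<^esub> N)"
    if "\<alpha> \<in> carrier F" "M \<in> carrier ?M" "N \<in> carrier ?M" for \<alpha> M N
  proof (rule eqI)
    fix i j assume ij: "i < n" "j < n"
    show "((\<alpha> \<odot>\<^bsub>?M\<^esub> M) \<otimes>\<^bsub>?M\<^esub> N) (i, j) = (\<alpha> \<odot>\<^bsub>?M\<^esub> (M \<otimes>\<^bsub>?M\<^esub> N)) (i, j)"
      using ij that fc[OF that(2,3) ij]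
      by (simp add: B.finsum_smult_ldistr) (auto intro!: Br.finsum_cong' simp: B.smult_mult_l)
  qed (use that in simp_all)
  moreover have "M \<otimes>\<^bsub>?M\<^esub> (\<alpha> \<odot>\<^bsub>?M\<^esub> N) = \<alpha> \<odot>\<^bsub>?M\<^esub> (M \<otimes>\<^bsub>?M\<^esub> N)"
    if "\<alpha> \<in> carrier F" "M \<in> carrier ?M" "N \<in> carrier ?M" for \<alpha> M N
  proof (rule eqI)
    fix i j assume ij: "i < n" "j < n"
    show "(M \<otimes>\<^bsub>?M\<^esub> (\<alpha> \<odot>\<^bsub>?M\<^esub> N)) (i, j) = (\<alpha> \<odot>\<^bsub>?M\<^esub> (M \<otimes>\<^bsub>?M\<^esub> N)) (i, j)"
      using ij that fc[OF that(2,3) ij]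
      by (simp add: B.finsum_smult_ldistr) (auto intro!: Br.finsum_cong' simp: B.smult_mult_r)
  qed (use that in simp_all)
  ultimately show ?thesis using R unfolding assoc_algebra_def assoc_algebra_axioms_def by simp
qed

section \<open>The algebra as a corner of matrices over the other algebra\<close>

lemma carrier_corner:
  assumes "ring R" "e \<in> carrier R" "e \<otimes>\<^bsub>R\<^esub> e = e"
  shows "z \<in> carrier (corner R e) \<longleftrightarrow> z \<in> carrier R \<and> e \<otimes>\<^bsub>R\<^esub> z = z \<and> z \<otimes>\<^bsub>R\<^esub> e = z"
proof -
  interpret R: ring R by fact
  have "e \<otimes>\<^bsub>R\<^esub> z = z \<and> z \<otimes>\<^bsub>R\<^esub> e = z \<and> z \<in> carrier R" if "z = e \<otimes>\<^bsub>R\<^esub> x \<otimes>\<^bsub>R\<^esub> e" "x \<in> carrier R" for x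
    using that assms(2,3) by (metis R.m_assoc R.m_closed)
  then show ?thesis unfolding corner_def by (simp, metis)
qed

lemma corner_simps [simp]:
  "x \<otimes>\<^bsub>corner R e\<^esub> y = x \<otimes>\<^bsub>R\<^esub> y" "x \<oplus>\<^bsub>corner R e\<^esub> y = x \<oplus>\<^bsub>R\<^esub> y"
  "\<one>\<^bsub>corner R e\<^esub> = e" "\<zero>\<^bsub>corner R e\<^esub> = \<zero>\<^bsub>R\<^esub>" "\<alpha> \<odot>\<^bsub>corner R e\<^esub> x = \<alpha> \<odot>\<^bsub>R\<^esub> x"
  by (simp_all add: corner_def)

lemma alg_isomorphicI:
  assumes "bij_betw h (carrier A) (carrier B)"
    "\<And>x y. x \<in> carrier A \<Longrightarrow> y \<in> carrier A \<Longrightarrow> h (x \<otimes>\<^bsub>A\<^esub> y) = h x \<otimes>\<^bsub>B\<^esub> h y"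
    "\<And>x y. x \<in> carrier A \<Longrightarrow> y \<in> carrier A \<Longrightarrow> h (x \<oplus>\<^bsub>A\<^esub> y) = h x \<oplus>\<^bsub>B\<^esub> h y"
    "h \<one>\<^bsub>A\<^esub> = \<one>\<^bsub>B\<^esub>"
    "\<And>\<alpha> x. \<alpha> \<in> carrier F \<Longrightarrow> x \<in> carrier A \<Longrightarrow> h (\<alpha> \<odot>\<^bsub>A\<^esub> x) = \<alpha> \<odot>\<^bsub>B\<^esub> h x"
  shows "alg_isomorphic F A B"
proof -
  have "h \<in> alg_iso F A B"
    using assms by (auto simp: alg_iso_def ring_iso_def ring_hom_def bij_betw_apply)
  then show ?thesis by (auto simp: alg_isomorphic_def)
qed

text \<open>The elements of the additive subgroup generated by the products \<open>x e y\<close> are finite sums of such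
products, as the sign of an inverse can be absorbed into \<open>x\<close>.\<close>

lemma full_idempotent_partition_of_unity:
  assumes R: "ring R" and e: "full_idempotent R e"
  obtains m x y where "x \<in> {..<m::nat} \<rightarrow> carrier R" "y \<in> {..<m} \<rightarrow> carrier R"
    "\<one>\<^bsub>R\<^esub> = (\<Oplus>\<^bsub>R\<^esub>i\<in>{..<m}. x i \<otimes>\<^bsub>R\<^esub> e \<otimes>\<^bsub>R\<^esub> y i)"
proof -
  interpret R: ring R by fact
  let ?P = "{x \<otimes>\<^bsub>R\<^esub> e \<otimes>\<^bsub>R\<^esub> y | x y. x \<in> carrier R \<and> y \<in> carrier R}"
  let ?sum = "\<lambda>z m x y. x \<in> {..<m::nat} \<rightarrow> carrier R \<and> y \<in> {..<m} \<rightarrow> carrier R \<and>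
    z = (\<Oplus>\<^bsub>R\<^esub>i\<in>{..<m}. x i \<otimes>\<^bsub>R\<^esub> e \<otimes>\<^bsub>R\<^esub> y i)"
  have eR: "e \<in> carrier R" using e by (simp add: full_idempotent_def)
  have single: "\<exists>m x y. ?sum (a \<otimes>\<^bsub>R\<^esub> e \<otimes>\<^bsub>R\<^esub> b) m x y" if "a \<in> carrier R" "b \<in> carrier R" for a b
    using that eR by (intro exI[of _ 1] exI[of _ "\<lambda>_. a"] exI[of _ "\<lambda>_. b"]) (simp add: lessThan_Suc)
  have "\<exists>m x y. ?sum z m x y" if "z \<in> generate (add_monoid R) ?P" for z
    using that
  proof (induction rule: generate.induct)
    case one
    show ?case by (intro exI[of _ 0]) simp
  next
    case (incl h)
    then show ?case using single by blast
  next
    case (inv h)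
    then obtain a b where ab: "h = a \<otimes>\<^bsub>R\<^esub> e \<otimes>\<^bsub>R\<^esub> b" "a \<in> carrier R" "b \<in> carrier R" by blast
    have "inv\<^bsub>add_monoid R\<^esub> h = \<ominus>\<^bsub>R\<^esub> h" by (simp add: a_inv_def)
    also have "\<dots> = (\<ominus>\<^bsub>R\<^esub> a) \<otimes>\<^bsub>R\<^esub> e \<otimes>\<^bsub>R\<^esub> b" using ab eR by (simp add: R.l_minus)
    finally show ?case using single[of "\<ominus>\<^bsub>R\<^esub> a" b] ab by simp
  next
    case (eng h1 h2)
    then obtain m x y n x' y' where *: "?sum h1 m x y" "?sum h2 n x' y'" by blast
    let ?x = "\<lambda>i. if i < m then x i else x' (i - m)" and ?y = "\<lambda>i. if i < m then y i else y' (i - m)"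
    let ?t = "\<lambda>i. ?x i \<otimes>\<^bsub>R\<^esub> e \<otimes>\<^bsub>R\<^esub> ?y i"
    have m: "x i \<in> carrier R" "y i \<in> carrier R" if "i < m" for i using * that by auto
    have n: "x' i \<in> carrier R" "y' i \<in> carrier R" if "i < n" for i using * that by auto
    have c: "?x \<in> {..<m + n} \<rightarrow> carrier R" "?y \<in> {..<m + n} \<rightarrow> carrier R" using * by (auto simp: Pi_def)
    have "i \<in> (\<lambda>i. i + m) ` {..<n}" if "m \<le> i" "i < m + n" for i
      using that by (intro image_eqI[of _ _ "i - m"]) auto
    then have split: "{..<m + n} = {..<m} \<union> (\<lambda>i. i + m) ` {..<n}"
      by (auto simp: not_less[symmetric])
    have "(\<Oplus>\<^bsub>R\<^esub>i\<in>{..<m + n}. ?t i) = (\<Oplus>\<^bsub>R\<^esub>i\<in>{..<m}. ?t i) \<oplus>\<^bsub>R\<^esub> (\<Oplus>\<^bsub>R\<^esub>i\<in>(\<lambda>i. i + m) ` {..<n}. ?t i)"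
      unfolding split using m n eR by (intro R.finsum_Un_disjoint) auto
    also have "(\<Oplus>\<^bsub>R\<^esub>i\<in>{..<m}. ?t i) = h1"
      using * m eR by (auto intro!: R.finsum_cong')
    also have "(\<Oplus>\<^bsub>R\<^esub>i\<in>(\<lambda>i. i + m) ` {..<n}. ?t i) = (\<Oplus>\<^bsub>R\<^esub>i\<in>{..<n}. ?t (i + m))"
      using n eR by (intro R.finsum_reindex) (auto simp: inj_on_def)
    also have "\<dots> = h2"
      using * n eR by (auto intro!: R.finsum_cong')
    finally have "?sum (h1 \<oplus>\<^bsub>R\<^esub> h2) (m + n) ?x ?y" using c by simp
    then show ?case unfolding monoid.simps by blast
  qed
  moreover have "\<one>\<^bsub>R\<^esub> \<in> generate (add_monoid R) ?P"
    using e R.one_closed by (simp add: full_idempotent_def)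
  ultimately obtain m x y where "?sum \<one>\<^bsub>R\<^esub> m x y" by blast
  then show thesis using that[of x m y] by blast
qed

text \<open>The maps \<open>u \<mapsto> (y\<^sub>i u x\<^sub>j)\<close> and \<open>P \<mapsto> \<Sum> x\<^sub>i P\<^sub>i\<^sub>j y\<^sub>j\<close> are mutually inverse between \<open>f R f\<close> and the corner at
\<open>E = (y\<^sub>i x\<^sub>j)\<close>, where \<open>A\<close> is identified with \<open>e R e\<close> along \<open>h\<close>. Everything follows from
\<open>\<Sum> x\<^sub>i y\<^sub>i = f\<close>; for instance the matrices of \<open>u\<close> and \<open>v\<close> multiply to the matrix of \<open>u f v\<close>.\<close>

lemma corner_isomorphic_matrix_corner:
  assumes A: "assoc_algebra F A" and R: "assoc_algebra F R"
    and e: "e \<in> carrier R" "e \<otimes>\<^bsub>R\<^esub> e = e" and f: "f \<in> carrier R" "f \<otimes>\<^bsub>R\<^esub> f = f"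
    and h: "h \<in> alg_iso F A (corner R e)"
    and x: "\<And>i. i < m \<Longrightarrow> x i \<in> carrier R" "\<And>i. i < m \<Longrightarrow> f \<otimes>\<^bsub>R\<^esub> x i = x i" "\<And>i. i < m \<Longrightarrow> x i \<otimes>\<^bsub>R\<^esub> e = x i"
    and y: "\<And>i. i < m \<Longrightarrow> y i \<in> carrier R" "\<And>i. i < m \<Longrightarrow> e \<otimes>\<^bsub>R\<^esub> y i = y i" "\<And>i. i < m \<Longrightarrow> y i \<otimes>\<^bsub>R\<^esub> f = y i"
    and sum: "(\<Oplus>\<^bsub>R\<^esub>i\<in>{..<m}. x i \<otimes>\<^bsub>R\<^esub> y i) = f"
  shows "\<exists>E\<in>carrier (mat_alg m A). alg_isomorphic F (corner R f) (corner (mat_alg m A) E)"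
proof -
  interpret Ar: ring A using A by (simp add: assoc_algebra_def)
  interpret A: assoc_algebra F A by fact
  interpret Rr: ring R using R by (simp add: assoc_algebra_def)
  interpret R: assoc_algebra F R by fact
  interpret Mr: ring "mat_alg m A" using assoc_algebra_mat_alg[OF A] by (simp add: assoc_algebra_def)
  let ?M = "mat_alg m A"
  note ce = carrier_corner[OF Rr.ring_axioms e] and cf = carrier_corner[OF Rr.ring_axioms f]
  note entry [simp] = mat_alg_entry[where n = m] and ops [simp] = mat_alg_ops and ext [simp] = mat_alg_extensional
  have h_bij: "bij_betw h (carrier A) (carrier (corner R e))"
    and h_mult: "\<And>a b. a \<in> carrier A \<Longrightarrow> b \<in> carrier A \<Longrightarrow> h (a \<otimes>\<^bsub>A\<^esub> b) = h a \<otimes>\<^bsub>R\<^esub> h b"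
    and h_add: "\<And>a b. a \<in> carrier A \<Longrightarrow> b \<in> carrier A \<Longrightarrow> h (a \<oplus>\<^bsub>A\<^esub> b) = h a \<oplus>\<^bsub>R\<^esub> h b"
    and h_smult: "\<And>\<alpha> a. \<alpha> \<in> carrier F \<Longrightarrow> a \<in> carrier A \<Longrightarrow> h (\<alpha> \<odot>\<^bsub>A\<^esub> a) = \<alpha> \<odot>\<^bsub>R\<^esub> h a"
    using h by (auto simp: alg_iso_def ring_iso_def ring_hom_def)
  have hc: "h a \<in> carrier R" "e \<otimes>\<^bsub>R\<^esub> h a = h a" "h a \<otimes>\<^bsub>R\<^esub> e = h a" if "a \<in> carrier A" for a
    using that ce h_bij by (auto dest: bij_betwE)
  have h_zero: "h \<zero>\<^bsub>A\<^esub> = \<zero>\<^bsub>R\<^esub>"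
    using h_add[of "\<zero>\<^bsub>A\<^esub>" "\<zero>\<^bsub>A\<^esub>"] hc(1)[of "\<zero>\<^bsub>A\<^esub>"] by (simp add: Rr.add.r_cancel_one')
  define g where "g = inv_into (carrier A) h"
  have g: "g z \<in> carrier A" "h (g z) = z" if "z \<in> carrier R" "e \<otimes>\<^bsub>R\<^esub> z = z" "z \<otimes>\<^bsub>R\<^esub> e = z" for z
  proof -
    have "z \<in> h ` carrier A" using that ce h_bij by (simp add: bij_betw_def)
    then show "g z \<in> carrier A" "h (g z) = z"
      by (auto simp: g_def inv_into_into f_inv_into_f)
  qed
  have h_inj: "a = b" if "h a = h b" "a \<in> carrier A" "b \<in> carrier A" for a b
    using that h_bij by (auto simp: bij_betw_def inj_on_def)
  have h_prod: "h ((P \<otimes>\<^bsub>?M\<^esub> Q) (i, j)) = (\<Oplus>\<^bsub>R\<^esub>k\<in>{..<m}. h (P (i, k)) \<otimes>\<^bsub>R\<^esub> h (Q (k, j)))"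
    if "P \<in> carrier ?M" "Q \<in> carrier ?M" "i < m" "j < m" for P Q i j
  proof -
    have "h ((P \<otimes>\<^bsub>?M\<^esub> Q) (i, j)) = (\<Oplus>\<^bsub>R\<^esub>k\<in>{..<m}. h (P (i, k) \<otimes>\<^bsub>A\<^esub> Q (k, j)))"
      unfolding ops(1)[OF that(3,4)]
      by (rule additive_finsum[OF Ar.abelian_monoid_axioms Rr.abelian_monoid_axioms])
        (use that hc h_add h_zero in auto)
    also have "\<dots> = (\<Oplus>\<^bsub>R\<^esub>k\<in>{..<m}. h (P (i, k)) \<otimes>\<^bsub>R\<^esub> h (Q (k, j)))"
      using that hc h_mult by (intro Rr.finsum_cong') auto
    finally show ?thesis .
  qed
  \<comment> \<open>the matrix \<open>(y\<^sub>i u x\<^sub>j)\<close>, with its entries pulled back from \<open>e R e\<close> to \<open>A\<close>\<close>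
  define N where "N u = (\<lambda>(i, j)\<in>{..<m} \<times> {..<m}. g (y i \<otimes>\<^bsub>R\<^esub> u \<otimes>\<^bsub>R\<^esub> x j))" for u
  have yux: "y i \<otimes>\<^bsub>R\<^esub> u \<otimes>\<^bsub>R\<^esub> x j \<in> carrier R"
    "e \<otimes>\<^bsub>R\<^esub> (y i \<otimes>\<^bsub>R\<^esub> u \<otimes>\<^bsub>R\<^esub> x j) = y i \<otimes>\<^bsub>R\<^esub> u \<otimes>\<^bsub>R\<^esub> x j"
    "(y i \<otimes>\<^bsub>R\<^esub> u \<otimes>\<^bsub>R\<^esub> x j) \<otimes>\<^bsub>R\<^esub> e = y i \<otimes>\<^bsub>R\<^esub> u \<otimes>\<^bsub>R\<^esub> x j"
    if "u \<in> carrier R" "i < m" "j < m" for u i j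
  proof -
    show "y i \<otimes>\<^bsub>R\<^esub> u \<otimes>\<^bsub>R\<^esub> x j \<in> carrier R" using that x y by simp
    show "e \<otimes>\<^bsub>R\<^esub> (y i \<otimes>\<^bsub>R\<^esub> u \<otimes>\<^bsub>R\<^esub> x j) = y i \<otimes>\<^bsub>R\<^esub> u \<otimes>\<^bsub>R\<^esub> x j"
      using that x(1) y(1,2) e by (simp add: Rr.m_assoc[symmetric])
    show "(y i \<otimes>\<^bsub>R\<^esub> u \<otimes>\<^bsub>R\<^esub> x j) \<otimes>\<^bsub>R\<^esub> e = y i \<otimes>\<^bsub>R\<^esub> u \<otimes>\<^bsub>R\<^esub> x j"
      using that x(1,3) y(1) e by (simp add: Rr.m_assoc)
  qed
  have N_closed: "N u \<in> carrier ?M" if "u \<in> carrier R" for u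
    using that g(1)[OF yux] by (intro mat_algI) (auto simp: N_def)
  have hN: "h (N u (i, j)) = y i \<otimes>\<^bsub>R\<^esub> u \<otimes>\<^bsub>R\<^esub> x j" if "u \<in> carrier R" "i < m" "j < m" for u i j
    using that g(2)[OF yux[OF that]] by (simp add: N_def)
  have M_eqI: "P = Q" if "P \<in> carrier ?M" "Q \<in> carrier ?M"
    "\<And>i j. i < m \<Longrightarrow> j < m \<Longrightarrow> h (P (i, j)) = h (Q (i, j))" for P Q
  proof (rule mat_alg_eqI[OF ext(6)[OF that(1)] ext(6)[OF that(2)]])
    fix i j assume ij: "i < m" "j < m"
    show "P (i, j) = Q (i, j)"
      by (rule h_inj[OF that(3)[OF ij] entry[OF that(1) ij] entry[OF that(2) ij]])
  qed
  have N_mult: "N u \<otimes>\<^bsub>?M\<^esub> N v = N (u \<otimes>\<^bsub>R\<^esub> f \<otimes>\<^bsub>R\<^esub> v)" if u: "u \<in> carrier R" and v: "v \<in> carrier R" for u v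
  proof (rule M_eqI)
    fix i j assume ij: "i < m" "j < m"
    have "h ((N u \<otimes>\<^bsub>?M\<^esub> N v) (i, j)) =
        (\<Oplus>\<^bsub>R\<^esub>k\<in>{..<m}. (y i \<otimes>\<^bsub>R\<^esub> u) \<otimes>\<^bsub>R\<^esub> (x k \<otimes>\<^bsub>R\<^esub> y k) \<otimes>\<^bsub>R\<^esub> (v \<otimes>\<^bsub>R\<^esub> x j))"
      unfolding h_prod[OF N_closed[OF u] N_closed[OF v] ij]
      using u v ij x(1) y(1) hN by (intro Rr.finsum_cong') (auto simp: Rr.m_assoc)
    also have "\<dots> = (y i \<otimes>\<^bsub>R\<^esub> u) \<otimes>\<^bsub>R\<^esub> f \<otimes>\<^bsub>R\<^esub> (v \<otimes>\<^bsub>R\<^esub> x j)"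
      using u v ij x(1) y(1)
      by (simp add: sum[symmetric] Rr.finsum_ldistr Rr.finsum_rdistr Pi_def)
    also have "\<dots> = h (N (u \<otimes>\<^bsub>R\<^esub> f \<otimes>\<^bsub>R\<^esub> v) (i, j))"
      using u v ij x(1) y(1) f(1) hN by (simp add: Rr.m_assoc)
    finally show "h ((N u \<otimes>\<^bsub>?M\<^esub> N v) (i, j)) = h (N (u \<otimes>\<^bsub>R\<^esub> f \<otimes>\<^bsub>R\<^esub> v) (i, j))" .
  qed (use u v f(1) N_closed in simp_all)
  define E where "E = N f"
  have E: "E \<in> carrier ?M" "E \<otimes>\<^bsub>?M\<^esub> E = E" using N_closed N_mult f by (simp_all add: E_def)
  note cE = carrier_corner[OF Mr.ring_axioms E]
  have fixed: "b \<in> carrier R" "f \<otimes>\<^bsub>R\<^esub> b = b" "b \<otimes>\<^bsub>R\<^esub> f = b" if "b \<in> carrier (corner R f)" for b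
    using that cf by simp_all
  have N_corner: "N b \<in> carrier (corner ?M E)" if "b \<in> carrier (corner R f)" for b
    unfolding cE using fixed[OF that] N_mult f N_closed by (simp add: E_def)
  \<comment> \<open>the inverse map \<open>P \<mapsto> \<Sum> x\<^sub>i P\<^sub>i\<^sub>j y\<^sub>j\<close>\<close>
  define G where "G P = (\<Oplus>\<^bsub>R\<^esub>i\<in>{..<m}. x i \<otimes>\<^bsub>R\<^esub> (\<Oplus>\<^bsub>R\<^esub>j\<in>{..<m}. h (P (i, j)) \<otimes>\<^bsub>R\<^esub> y j))" for P
  have inner: "(\<Oplus>\<^bsub>R\<^esub>j\<in>{..<m}. h (P (i, j)) \<otimes>\<^bsub>R\<^esub> y j) \<in> carrier R" if "P \<in> carrier ?M" "i < m" for P i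
    using that hc(1) y(1) by (intro Rr.finsum_closed) auto
  have G_closed: "G P \<in> carrier (corner R f)" if P: "P \<in> carrier ?M" for P
  proof -
    have c: "G P \<in> carrier R"
      unfolding G_def using inner[OF P] x(1) by (intro Rr.finsum_closed) auto
    have "f \<otimes>\<^bsub>R\<^esub> G P = (\<Oplus>\<^bsub>R\<^esub>i\<in>{..<m}. f \<otimes>\<^bsub>R\<^esub> (x i \<otimes>\<^bsub>R\<^esub> (\<Oplus>\<^bsub>R\<^esub>j\<in>{..<m}. h (P (i, j)) \<otimes>\<^bsub>R\<^esub> y j)))"
      unfolding G_def using inner[OF P] x(1) f(1) by (intro Rr.finsum_rdistr) auto
    also have "\<dots> = G P"
      unfolding G_def using inner[OF P] x(1,2) f(1)
      by (intro Rr.finsum_cong') (auto simp: Rr.m_assoc[symmetric])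
    finally have l: "f \<otimes>\<^bsub>R\<^esub> G P = G P" .
    have in_f: "(\<Oplus>\<^bsub>R\<^esub>j\<in>{..<m}. h (P (i, j)) \<otimes>\<^bsub>R\<^esub> y j) \<otimes>\<^bsub>R\<^esub> f = (\<Oplus>\<^bsub>R\<^esub>j\<in>{..<m}. h (P (i, j)) \<otimes>\<^bsub>R\<^esub> y j)"
      if i: "i < m" for i
    proof -
      have "(\<Oplus>\<^bsub>R\<^esub>j\<in>{..<m}. h (P (i, j)) \<otimes>\<^bsub>R\<^esub> y j) \<otimes>\<^bsub>R\<^esub> f = (\<Oplus>\<^bsub>R\<^esub>j\<in>{..<m}. h (P (i, j)) \<otimes>\<^bsub>R\<^esub> y j \<otimes>\<^bsub>R\<^esub> f)"
        using P i hc(1) y(1) f(1) by (intro Rr.finsum_ldistr) auto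
      also have "\<dots> = (\<Oplus>\<^bsub>R\<^esub>j\<in>{..<m}. h (P (i, j)) \<otimes>\<^bsub>R\<^esub> y j)"
        using P i hc(1) y(1,3) f(1) by (intro Rr.finsum_cong') (auto simp: Rr.m_assoc)
      finally show ?thesis .
    qed
    have "G P \<otimes>\<^bsub>R\<^esub> f = (\<Oplus>\<^bsub>R\<^esub>i\<in>{..<m}. x i \<otimes>\<^bsub>R\<^esub> (\<Oplus>\<^bsub>R\<^esub>j\<in>{..<m}. h (P (i, j)) \<otimes>\<^bsub>R\<^esub> y j) \<otimes>\<^bsub>R\<^esub> f)"
      unfolding G_def using inner[OF P] x(1) f(1) by (intro Rr.finsum_ldistr) auto
    also have "\<dots> = G P"
      unfolding G_def using inner[OF P] x(1) f(1) in_f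
      by (intro Rr.finsum_cong') (auto simp: Rr.m_assoc)
    finally show ?thesis using c l cf by simp
  qed
  have GN: "G (N b) = b" if b: "b \<in> carrier (corner R f)" for b
  proof -
    note b' = fixed[OF b]
    have in_N: "(\<Oplus>\<^bsub>R\<^esub>j\<in>{..<m}. h (N b (i, j)) \<otimes>\<^bsub>R\<^esub> y j) = y i \<otimes>\<^bsub>R\<^esub> b" if i: "i < m" for i
    proof -
      have "(\<Oplus>\<^bsub>R\<^esub>j\<in>{..<m}. h (N b (i, j)) \<otimes>\<^bsub>R\<^esub> y j) = (\<Oplus>\<^bsub>R\<^esub>j\<in>{..<m}. (y i \<otimes>\<^bsub>R\<^esub> b) \<otimes>\<^bsub>R\<^esub> (x j \<otimes>\<^bsub>R\<^esub> y j))"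
        using i x(1) y(1) b'(1) hN by (intro Rr.finsum_cong') (auto simp: Rr.m_assoc)
      also have "\<dots> = (y i \<otimes>\<^bsub>R\<^esub> b) \<otimes>\<^bsub>R\<^esub> f"
        using i x(1) y(1) b'(1) by (simp add: sum[symmetric] Rr.finsum_rdistr Pi_def)
      finally show ?thesis using i y(1) b' f(1) by (simp add: Rr.m_assoc)
    qed
    have "G (N b) = (\<Oplus>\<^bsub>R\<^esub>i\<in>{..<m}. (x i \<otimes>\<^bsub>R\<^esub> y i) \<otimes>\<^bsub>R\<^esub> b)"
      unfolding G_def using in_N x(1) y(1) b'(1) by (intro Rr.finsum_cong') (auto simp: Rr.m_assoc)
    also have "\<dots> = f \<otimes>\<^bsub>R\<^esub> b"
      using x(1) y(1) b'(1) by (simp add: sum[symmetric] Rr.finsum_ldistr Pi_def)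
    finally show ?thesis using b'(2) by simp
  qed
  have NG: "N (G P) = P" if P: "P \<in> carrier (corner ?M E)" for P
  proof -
    have P': "P \<in> carrier ?M" "E \<otimes>\<^bsub>?M\<^esub> P = P" "P \<otimes>\<^bsub>?M\<^esub> E = P" using P cE by simp_all
    have hE: "h (E (i, j)) = y i \<otimes>\<^bsub>R\<^esub> x j" if "i < m" "j < m" for i j
      using hN[OF f(1) that] y(3) x(1) that by (simp add: E_def)
    have GR: "G P \<in> carrier R" using fixed G_closed[OF P'(1)] by blast
    have EP: "y i \<otimes>\<^bsub>R\<^esub> G P = (\<Oplus>\<^bsub>R\<^esub>k\<in>{..<m}. h (P (i, k)) \<otimes>\<^bsub>R\<^esub> y k)" if i: "i < m" for i
    proof -
      have "y i \<otimes>\<^bsub>R\<^esub> G P = (\<Oplus>\<^bsub>R\<^esub>k\<in>{..<m}. y i \<otimes>\<^bsub>R\<^esub> (x k \<otimes>\<^bsub>R\<^esub> (\<Oplus>\<^bsub>R\<^esub>j\<in>{..<m}. h (P (k, j)) \<otimes>\<^bsub>R\<^esub> y j)))"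
        unfolding G_def using inner[OF P'(1)] x(1) y(1) i by (intro Rr.finsum_rdistr) auto
      also have "\<dots> = (\<Oplus>\<^bsub>R\<^esub>k\<in>{..<m}. \<Oplus>\<^bsub>R\<^esub>j\<in>{..<m}. h (E (i, k)) \<otimes>\<^bsub>R\<^esub> h (P (k, j)) \<otimes>\<^bsub>R\<^esub> y j)"
      proof (rule Rr.finsum_cong')
        fix k assume "k \<in> {..<m}"
        then have k: "k < m" by simp
        have "y i \<otimes>\<^bsub>R\<^esub> (x k \<otimes>\<^bsub>R\<^esub> (\<Oplus>\<^bsub>R\<^esub>j\<in>{..<m}. h (P (k, j)) \<otimes>\<^bsub>R\<^esub> y j)) =
            (y i \<otimes>\<^bsub>R\<^esub> x k) \<otimes>\<^bsub>R\<^esub> (\<Oplus>\<^bsub>R\<^esub>j\<in>{..<m}. h (P (k, j)) \<otimes>\<^bsub>R\<^esub> y j)"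
          using inner[OF P'(1) k] x(1) y(1) i k by (simp add: Rr.m_assoc)
        also have "\<dots> = (\<Oplus>\<^bsub>R\<^esub>j\<in>{..<m}. (y i \<otimes>\<^bsub>R\<^esub> x k) \<otimes>\<^bsub>R\<^esub> (h (P (k, j)) \<otimes>\<^bsub>R\<^esub> y j))"
          using P'(1) x(1) y(1) i k hc(1) by (intro Rr.finsum_rdistr) auto
        also have "\<dots> = (\<Oplus>\<^bsub>R\<^esub>j\<in>{..<m}. h (E (i, k)) \<otimes>\<^bsub>R\<^esub> h (P (k, j)) \<otimes>\<^bsub>R\<^esub> y j)"
          using P'(1) x(1) y(1) i k hc(1) hE by (intro Rr.finsum_cong') (auto simp: Rr.m_assoc)
        finally show "y i \<otimes>\<^bsub>R\<^esub> (x k \<otimes>\<^bsub>R\<^esub> (\<Oplus>\<^bsub>R\<^esub>j\<in>{..<m}. h (P (k, j)) \<otimes>\<^bsub>R\<^esub> y j)) =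
          (\<Oplus>\<^bsub>R\<^esub>j\<in>{..<m}. h (E (i, k)) \<otimes>\<^bsub>R\<^esub> h (P (k, j)) \<otimes>\<^bsub>R\<^esub> y j)" .
      qed (use P'(1) E(1) i y(1) hc(1) in \<open>auto intro!: Rr.finsum_closed\<close>)
      also have "\<dots> = (\<Oplus>\<^bsub>R\<^esub>j\<in>{..<m}. \<Oplus>\<^bsub>R\<^esub>k\<in>{..<m}. h (E (i, k)) \<otimes>\<^bsub>R\<^esub> h (P (k, j)) \<otimes>\<^bsub>R\<^esub> y j)"
        using P'(1) E(1) i y(1) hc(1) by (intro Rr.finsum_swap) auto
      also have "\<dots> = (\<Oplus>\<^bsub>R\<^esub>j\<in>{..<m}. h (P (i, j)) \<otimes>\<^bsub>R\<^esub> y j)"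
      proof (rule Rr.finsum_cong')
        fix j assume "j \<in> {..<m}"
        then have j: "j < m" by simp
        have "(\<Oplus>\<^bsub>R\<^esub>k\<in>{..<m}. h (E (i, k)) \<otimes>\<^bsub>R\<^esub> h (P (k, j)) \<otimes>\<^bsub>R\<^esub> y j) =
          (\<Oplus>\<^bsub>R\<^esub>k\<in>{..<m}. h (E (i, k)) \<otimes>\<^bsub>R\<^esub> h (P (k, j))) \<otimes>\<^bsub>R\<^esub> y j"
          using P'(1) E(1) i j y(1) hc(1) by (intro Rr.finsum_ldistr[symmetric]) auto
        also have "\<dots> = h (P (i, j)) \<otimes>\<^bsub>R\<^esub> y j"
          using h_prod[OF E(1) P'(1) i j] P'(2) by simp
        finally show "(\<Oplus>\<^bsub>R\<^esub>k\<in>{..<m}. h (E (i, k)) \<otimes>\<^bsub>R\<^esub> h (P (k, j)) \<otimes>\<^bsub>R\<^esub> y j) = h (P (i, j)) \<otimes>\<^bsub>R\<^esub> y j" .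
      qed (use P'(1) i y(1) hc(1) in auto)
      finally show ?thesis .
    qed
    show ?thesis
    proof (rule M_eqI)
      fix i j assume ij: "i < m" "j < m"
      have "h (N (G P) (i, j)) = y i \<otimes>\<^bsub>R\<^esub> G P \<otimes>\<^bsub>R\<^esub> x j" using hN[OF GR ij] .
      also have "\<dots> = (\<Oplus>\<^bsub>R\<^esub>k\<in>{..<m}. h (P (i, k)) \<otimes>\<^bsub>R\<^esub> y k \<otimes>\<^bsub>R\<^esub> x j)"
        unfolding EP[OF ij(1)] using P'(1) ij y(1) x(1) hc(1) by (intro Rr.finsum_ldistr) auto
      also have "\<dots> = (\<Oplus>\<^bsub>R\<^esub>k\<in>{..<m}. h (P (i, k)) \<otimes>\<^bsub>R\<^esub> h (E (k, j)))"
        using P'(1) ij y(1) x(1) hc(1) hE by (intro Rr.finsum_cong') (auto simp: Rr.m_assoc)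
      also have "\<dots> = h (P (i, j))" using h_prod[OF P'(1) E(1) ij] P'(3) by simp
      finally show "h (N (G P) (i, j)) = h (P (i, j))" .
    qed (use N_closed GR P' in simp_all)
  qed
  have "alg_isomorphic F (corner R f) (corner ?M E)"
  proof (rule alg_isomorphicI[where h = N])
    show "bij_betw N (carrier (corner R f)) (carrier (corner ?M E))"
      by (rule bij_betwI[where g = G]) (use N_corner G_closed GN NG cE in auto)
    fix a b assume a: "a \<in> carrier (corner R f)" and b: "b \<in> carrier (corner R f)"
    note a' = fixed[OF a] and b' = fixed[OF b]
    show "N (a \<otimes>\<^bsub>corner R f\<^esub> b) = N a \<otimes>\<^bsub>corner ?M E\<^esub> N b"
      using N_mult[OF a'(1) b'(1)] a' b' by simp
    show "N (a \<oplus>\<^bsub>corner R f\<^esub> b) = N a \<oplus>\<^bsub>corner ?M E\<^esub> N b"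
    proof (simp, rule M_eqI)
      fix i j assume ij: "i < m" "j < m"
      show "h (N (a \<oplus>\<^bsub>R\<^esub> b) (i, j)) = h ((N a \<oplus>\<^bsub>?M\<^esub> N b) (i, j))"
        using ij a'(1) b'(1) x(1) y(1) by (simp add: h_add N_closed hN Rr.l_distr Rr.r_distr)
    qed (use a' b' N_closed in simp_all)
  next
    show "N \<one>\<^bsub>corner R f\<^esub> = \<one>\<^bsub>corner ?M E\<^esub>" by (simp add: E_def)
    fix \<alpha> b assume \<alpha>: "\<alpha> \<in> carrier F" and b: "b \<in> carrier (corner R f)"
    note b' = fixed[OF b]
    have Nb: "\<alpha> \<odot>\<^bsub>?M\<^esub> N b \<in> carrier ?M"
      using assoc_algebra_mat_alg[OF A, of m] N_closed[OF b'(1)] \<alpha>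
      by (auto simp: assoc_algebra_def intro: module.smult_closed)
    show "N (\<alpha> \<odot>\<^bsub>corner R f\<^esub> b) = \<alpha> \<odot>\<^bsub>corner ?M E\<^esub> N b"
    proof (simp, rule M_eqI)
      fix i j assume ij: "i < m" "j < m"
      show "h (N (\<alpha> \<odot>\<^bsub>R\<^esub> b) (i, j)) = h ((\<alpha> \<odot>\<^bsub>?M\<^esub> N b) (i, j))"
        using ij \<alpha> b'(1) x(1) y(1) by (simp add: h_smult N_closed hN R.smult_mult_l R.smult_mult_r)
    qed (use b' \<alpha> N_closed Nb in simp_all)
  qed
  then show ?thesis using E(1) by blast
qed

text \<open>The witness is the matrix unit in the upper left corner.\<close>

lemma isomorphic_matrix_unit_corner:
  assumes B: "assoc_algebra F B" and n: "n \<ge> 1"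
  obtains f where "f \<in> carrier (mat_alg n B)" "f \<otimes>\<^bsub>mat_alg n B\<^esub> f = f"
    "alg_isomorphic F B (corner (mat_alg n B) f)"
proof -
  interpret Br: ring B using B by (simp add: assoc_algebra_def)
  interpret B: assoc_algebra F B by fact
  let ?M = "mat_alg n B"
  interpret Mr: ring ?M using assoc_algebra_mat_alg[OF B] by (simp add: assoc_algebra_def)
  note entry [simp] = mat_alg_entry[where n = n] and ops [simp] = mat_alg_ops and ext [simp] = mat_alg_extensional
  define s where "s b = (\<lambda>(i, j)\<in>{..<n} \<times> {..<n}. if i = 0 \<and> j = 0 then b else \<zero>\<^bsub>B\<^esub>)" for b
  have s: "s b \<in> carrier ?M" if "b \<in> carrier B" for b
    using that by (intro mat_algI) (auto simp: s_def)
  have sl: "(s b \<otimes>\<^bsub>?M\<^esub> P) (i, j) = (if i = 0 then b \<otimes>\<^bsub>B\<^esub> P (0, j) else \<zero>\<^bsub>B\<^esub>)"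
    if "b \<in> carrier B" "P \<in> carrier ?M" "i < n" "j < n" for b P i j
    using that n unfolding ops(1)[OF that(3,4)]
    by (subst Br.finsum_delta[where i = 0]) (auto simp: s_def)
  have sr: "(P \<otimes>\<^bsub>?M\<^esub> s b) (i, j) = (if j = 0 then P (i, 0) \<otimes>\<^bsub>B\<^esub> b else \<zero>\<^bsub>B\<^esub>)"
    if "b \<in> carrier B" "P \<in> carrier ?M" "i < n" "j < n" for b P i j
    using that n unfolding ops(1)[OF that(3,4)]
    by (subst Br.finsum_delta[where i = 0]) (auto simp: s_def)
  have eqI: "P = Q" if "P \<in> carrier ?M" "Q \<in> carrier ?M"
    "\<And>i j. i < n \<Longrightarrow> j < n \<Longrightarrow> P (i, j) = Q (i, j)" for P Q
    using that by (intro mat_alg_eqI[OF ext(6) ext(6)]) simp_all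
  have sij: "s b (i, j) = (if i = 0 \<and> j = 0 then b else \<zero>\<^bsub>B\<^esub>)" if "i < n" "j < n" for b i j
    using that by (simp add: s_def)
  have smult: "s a \<otimes>\<^bsub>?M\<^esub> s b = s (a \<otimes>\<^bsub>B\<^esub> b)" if "a \<in> carrier B" "b \<in> carrier B" for a b
    by (rule eqI) (use that s n in \<open>auto simp: sl sij simp del: ops\<close>)
  let ?f = "s \<one>\<^bsub>B\<^esub>"
  have f: "?f \<in> carrier ?M" "?f \<otimes>\<^bsub>?M\<^esub> ?f = ?f" using s smult by simp_all
  note cf = carrier_corner[OF Mr.ring_axioms f]
  have sc: "s b \<in> carrier (corner ?M ?f)" if "b \<in> carrier B" for b
    using that s smult by (simp add: cf)
  have surj: "P = s (P (0, 0))" if "P \<in> carrier (corner ?M ?f)" for P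
  proof (rule eqI)
    have P: "P \<in> carrier ?M" "?f \<otimes>\<^bsub>?M\<^esub> P = P" "P \<otimes>\<^bsub>?M\<^esub> ?f = P" using that cf by simp_all
    show "P \<in> carrier ?M" "s (P (0, 0)) \<in> carrier ?M" using P n s by simp_all
    fix i j assume ij: "i < n" "j < n"
    show "P (i, j) = s (P (0, 0)) (i, j)"
      using sl[OF Br.one_closed P(1) ij] sr[OF Br.one_closed P(1) ij] P sij[OF ij] by auto
  qed
  have "alg_isomorphic F B (corner ?M ?f)"
  proof (rule alg_isomorphicI[where h = s])
    show "bij_betw s (carrier B) (carrier (corner ?M ?f))"
    proof (rule bij_betwI[where g = "\<lambda>P. P (0, 0)"])
      show "s \<in> carrier B \<rightarrow> carrier (corner ?M ?f)" using sc by blast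
      show "(\<lambda>P. P (0, 0)) \<in> carrier (corner ?M ?f) \<rightarrow> carrier B" using n by (auto simp: cf)
      show "s b (0, 0) = b" for b using n by (simp add: sij)
      show "s (P (0, 0)) = P" if "P \<in> carrier (corner ?M ?f)" for P using surj[OF that] by simp
    qed
    show "s (a \<otimes>\<^bsub>B\<^esub> b) = s a \<otimes>\<^bsub>corner ?M ?f\<^esub> s b" if "a \<in> carrier B" "b \<in> carrier B" for a b
      using smult that by simp
    show "s (a \<oplus>\<^bsub>B\<^esub> b) = s a \<oplus>\<^bsub>corner ?M ?f\<^esub> s b" if "a \<in> carrier B" "b \<in> carrier B" for a b
      using that s by (auto simp: sij intro!: eqI)
    show "s (\<alpha> \<odot>\<^bsub>B\<^esub> b) = \<alpha> \<odot>\<^bsub>corner ?M ?f\<^esub> s b" if "\<alpha> \<in> carrier F" "b \<in> carrier B" for \<alpha> b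
      using that by (auto simp: sij s_def intro!: mat_alg_eqI)
  qed simp
  then show thesis using that f by blast
qed

text \<open>The part of the symmetry of Morita equivalence that describes \<open>B\<close> in terms of \<open>A\<close>. With \<open>f\<close> the matrix unit that cuts out \<open>B\<close>,
multiplying the partition of unity \<open>1 = \<Sum> x\<^sub>i e y\<^sub>i\<close> by \<open>f\<close> from both sides gives \<open>f = \<Sum> (f x\<^sub>i e) (e y\<^sub>i f)\<close>.\<close>

lemma linearly_morita_equivalent_imp_matrix_corner:
  assumes A: "assoc_algebra F A" and B: "assoc_algebra F B"
    and morita: "linearly_morita_equivalent F A B"
  obtains m E where "E \<in> carrier (mat_alg m A)" "alg_isomorphic F B (corner (mat_alg m A) E)"
proof -
  obtain n e where n: "n \<ge> 1" and e: "full_idempotent (mat_alg n B) e"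
    and iso: "alg_isomorphic F A (corner (mat_alg n B) e)"
    using morita by (auto simp: linearly_morita_equivalent_def)
  let ?R = "mat_alg n B"
  have R: "assoc_algebra F ?R" using assoc_algebra_mat_alg[OF B] .
  interpret R: ring ?R using R by (simp add: assoc_algebra_def)
  have e': "e \<in> carrier ?R" "e \<otimes>\<^bsub>?R\<^esub> e = e" using e by (simp_all add: full_idempotent_def)
  obtain h where h: "h \<in> alg_iso F A (corner ?R e)" using iso by (auto simp: alg_isomorphic_def)
  obtain f where f: "f \<in> carrier ?R" "f \<otimes>\<^bsub>?R\<^esub> f = f" "alg_isomorphic F B (corner ?R f)"
    using isomorphic_matrix_unit_corner[OF B n] .
  obtain m x y where xy: "x \<in> {..<m::nat} \<rightarrow> carrier ?R" "y \<in> {..<m} \<rightarrow> carrier ?R"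
    "\<one>\<^bsub>?R\<^esub> = (\<Oplus>\<^bsub>?R\<^esub>i\<in>{..<m}. x i \<otimes>\<^bsub>?R\<^esub> e \<otimes>\<^bsub>?R\<^esub> y i)"
    using full_idempotent_partition_of_unity[OF R.ring_axioms e] .
  define x' y' where "x' i = f \<otimes>\<^bsub>?R\<^esub> x i \<otimes>\<^bsub>?R\<^esub> e" and "y' i = e \<otimes>\<^bsub>?R\<^esub> y i \<otimes>\<^bsub>?R\<^esub> f" for i
  have c: "x i \<in> carrier ?R" "y i \<in> carrier ?R" if "i < m" for i using xy that by auto
  have ee: "e \<otimes>\<^bsub>?R\<^esub> (e \<otimes>\<^bsub>?R\<^esub> z) = e \<otimes>\<^bsub>?R\<^esub> z" and ff: "f \<otimes>\<^bsub>?R\<^esub> (f \<otimes>\<^bsub>?R\<^esub> z) = f \<otimes>\<^bsub>?R\<^esub> z"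
    if "z \<in> carrier ?R" for z
    using that e' f by (simp_all add: R.m_assoc[symmetric])
  have "(\<Oplus>\<^bsub>?R\<^esub>i\<in>{..<m}. x' i \<otimes>\<^bsub>?R\<^esub> y' i) = (\<Oplus>\<^bsub>?R\<^esub>i\<in>{..<m}. f \<otimes>\<^bsub>?R\<^esub> (x i \<otimes>\<^bsub>?R\<^esub> e \<otimes>\<^bsub>?R\<^esub> y i) \<otimes>\<^bsub>?R\<^esub> f)"
    using c e' f ee by (intro R.finsum_cong') (auto simp: x'_def y'_def R.m_assoc)
  also have "\<dots> = f \<otimes>\<^bsub>?R\<^esub> \<one>\<^bsub>?R\<^esub> \<otimes>\<^bsub>?R\<^esub> f"
    unfolding xy(3) using c e' f by (simp add: R.finsum_ldistr R.finsum_rdistr Pi_def)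
  also have "\<dots> = f" using f by simp
  finally have sum: "(\<Oplus>\<^bsub>?R\<^esub>i\<in>{..<m}. x' i \<otimes>\<^bsub>?R\<^esub> y' i) = f" .
  have "\<exists>E\<in>carrier (mat_alg m A). alg_isomorphic F (corner ?R f) (corner (mat_alg m A) E)"
    by (rule corner_isomorphic_matrix_corner[OF A R e' f(1,2) h _ _ _ _ _ _ sum])
      (use c e' f ee ff in \<open>simp_all add: x'_def y'_def R.m_assoc\<close>)
  then show thesis using that f(3) alg_isomorphic_trans by blast
qed

section \<open>The free algebra is a ring\<close>

text \<open>The product of the free algebra, for families of coefficients of arbitrary support.\<close>

definition conv :: "('f, 'm) ring_scheme \<Rightarrow> (nat list \<Rightarrow> 'f) \<Rightarrow> (nat list \<Rightarrow> 'f) \<Rightarrow> nat list \<Rightarrow> 'f" where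
  "conv F p q w = (\<Oplus>\<^bsub>F\<^esub>k\<in>{..length w}. p (take k w) \<otimes>\<^bsub>F\<^esub> q (drop k w))"

definition monomial :: "('f, 'm) ring_scheme \<Rightarrow> 'f \<Rightarrow> nat list \<Rightarrow> nat list \<Rightarrow> 'f" where
  "monomial F \<alpha> u = (\<lambda>w. if w = u then \<alpha> else \<zero>\<^bsub>F\<^esub>)"

context cring begin

lemma conv_closed:
  assumes "range p \<subseteq> carrier R" "range q \<subseteq> carrier R"
  shows "conv R p q w \<in> carrier R"
proof -
  note c = assms[THEN subsetD, OF rangeI]
  show ?thesis unfolding conv_def using c by (intro finsum_closed) auto
qed

lemma conv_Nil: "range p \<subseteq> carrier R \<Longrightarrow> range q \<subseteq> carrier R \<Longrightarrow> conv R p q [] = p [] \<otimes> q []"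
  by (simp add: conv_def image_subset_iff)

text \<open>With \<open>\<partial>\<^sub>x p = (\<lambda>v. p (x # v))\<close> this is the Leibniz-like rule \<open>\<partial>\<^sub>x (p q) = p\<^sub>0 \<partial>\<^sub>x q + (\<partial>\<^sub>x p) q\<close>, where \<open>p\<^sub>0\<close> is
the constant term of \<open>p\<close>. It reduces statements about products to inductions on words.\<close>

lemma conv_Cons:
  assumes "range p \<subseteq> carrier R" "range q \<subseteq> carrier R"
  shows "conv R p q (x # w) = p [] \<otimes> q (x # w) \<oplus> conv R (\<lambda>v. p (x # v)) q w"
proof -
  note c = rangeI[THEN subsetD[OF assms(1)]] rangeI[THEN subsetD[OF assms(2)]]
  have "conv R p q (x # w) = (\<Oplus>k\<in>{..length w}. p (x # take k w) \<otimes> q (drop k w)) \<oplus> p [] \<otimes> q (x # w)"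
    unfolding conv_def using c by (simp add: finsum_Suc2 Pi_def del: finsum_Suc)
  then show ?thesis using c by (simp add: conv_def a_comm finsum_closed Pi_def)
qed

lemma conv_add_left:
  assumes "range p \<subseteq> carrier R" "range q \<subseteq> carrier R" "range r \<subseteq> carrier R"
  shows "conv R (\<lambda>w. p w \<oplus> q w) r w = conv R p r w \<oplus> conv R q r w"
proof -
  note c = assms[THEN subsetD, OF rangeI]
  show ?thesis
    unfolding conv_def using c by (subst finsum_addf[symmetric]) (auto intro!: finsum_cong' simp: l_distr)
qed

lemma conv_add_right:
  assumes "range p \<subseteq> carrier R" "range q \<subseteq> carrier R" "range r \<subseteq> carrier R"
  shows "conv R r (\<lambda>w. p w \<oplus> q w) w = conv R r p w \<oplus> conv R r q w"
proof -
  note c = assms[THEN subsetD, OF rangeI]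
  show ?thesis
    unfolding conv_def using c by (subst finsum_addf[symmetric]) (auto intro!: finsum_cong' simp: r_distr)
qed

lemma conv_smult_left:
  assumes "range p \<subseteq> carrier R" "range q \<subseteq> carrier R" "\<alpha> \<in> carrier R"
  shows "conv R (\<lambda>w. \<alpha> \<otimes> p w) q w = \<alpha> \<otimes> conv R p q w"
proof -
  note c = assms(1,2)[THEN subsetD, OF rangeI] assms(3)
  show ?thesis
    unfolding conv_def using c by (subst finsum_rdistr) (auto intro!: finsum_cong' simp: m_assoc)
qed

lemma conv_zero_left: "range p \<subseteq> carrier R \<Longrightarrow> conv R (\<lambda>w. \<zero>) p w = \<zero>"
  using conv_smult_left[of p p \<zero> w] conv_closed[of p p w] by (simp add: image_subset_iff)

lemma conv_assoc:
  assumes "range p \<subseteq> carrier R" "range q \<subseteq> carrier R" "range r \<subseteq> carrier R"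
  shows "conv R (conv R p q) r w = conv R p (conv R q r) w"
  using assms
proof (induction w arbitrary: p q r)
  case Nil
  note c = Nil[THEN subsetD, OF rangeI]
  have "range (conv R p q) \<subseteq> carrier R" "range (conv R q r) \<subseteq> carrier R"
    using conv_closed Nil by blast+
  then show ?case using Nil c by (simp add: conv_Nil m_assoc)
next
  case (Cons x w)
  note c = Cons.prems[THEN subsetD, OF rangeI]
  let ?p = "\<lambda>v. p (x # v)" and ?q = "\<lambda>v. q (x # v)"
  have ran: "range ?p \<subseteq> carrier R" "range ?q \<subseteq> carrier R"
    "range (conv R p q) \<subseteq> carrier R" "range (conv R q r) \<subseteq> carrier R" "range (conv R ?p q) \<subseteq> carrier R"
    "range (\<lambda>v. p [] \<otimes> ?q v) \<subseteq> carrier R"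
    using conv_closed c Cons.prems by (blast, blast, blast, blast, auto simp: image_subset_iff)
  have cl: "conv R ?q r w \<in> carrier R" "conv R ?p (conv R q r) w \<in> carrier R"
    using conv_closed ran Cons.prems by blast+
  have "conv R (conv R p q) r (x # w)
      = conv R p q [] \<otimes> r (x # w) \<oplus> conv R (\<lambda>v. conv R p q (x # v)) r w"
    using ran Cons.prems by (intro conv_Cons)
  also have "(\<lambda>v. conv R p q (x # v)) = (\<lambda>v. p [] \<otimes> ?q v \<oplus> conv R ?p q v)"
    using Cons.prems by (simp add: conv_Cons)
  also have "conv R \<dots> r w = p [] \<otimes> conv R ?q r w \<oplus> conv R ?p (conv R q r) w"
    using ran c Cons.prems Cons.IH[OF ran(1) Cons.prems(2,3)]
    by (simp add: conv_add_left conv_smult_left)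
  also have "conv R p q [] \<otimes> r (x # w) \<oplus> \<dots>
      = p [] \<otimes> (q [] \<otimes> r (x # w) \<oplus> conv R ?q r w) \<oplus> conv R ?p (conv R q r) w"
    using c cl Cons.prems by (simp add: conv_Nil r_distr m_assoc a_assoc)
  also have "\<dots> = conv R p (conv R q r) (x # w)"
    using ran Cons.prems by (simp add: conv_Cons)
  finally show ?case .
qed


lemma range_monomial: "\<alpha> \<in> carrier R \<Longrightarrow> range (monomial R \<alpha> u) \<subseteq> carrier R"
  by (auto simp: monomial_def)

lemma conv_monomial_append:
  assumes "range q \<subseteq> carrier R" "\<alpha> \<in> carrier R"
  shows "conv R (monomial R \<alpha> u) q (u @ v) = \<alpha> \<otimes> q v"
proof (induction u)
  case Nil
  note c = assms(1)[THEN subsetD, OF rangeI] assms(2)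
  show ?case
  proof (cases v)
    case Nil then show ?thesis using assms by (simp add: conv_Nil range_monomial) (simp add: monomial_def)
  next
    case (Cons x w)
    have "(\<lambda>v. monomial R \<alpha> [] (x # v)) = (\<lambda>v. \<zero>)" by (simp add: monomial_def)
    then show ?thesis
      using Cons assms c by (simp add: conv_Cons range_monomial conv_zero_left) (simp add: monomial_def)
  qed
next
  case (Cons x u)
  note c = assms(1)[THEN subsetD, OF rangeI] assms(2)
  have "(\<lambda>v. monomial R \<alpha> (x # u) (x # v)) = monomial R \<alpha> u" by (auto simp: monomial_def)
  moreover have "monomial R \<alpha> (x # u) [] = \<zero>" by (simp add: monomial_def)
  ultimately show ?case using Cons assms c by (simp add: conv_Cons range_monomial)
qed

lemma conv_monomial_other:
  assumes "range q \<subseteq> carrier R" "\<alpha> \<in> carrier R" "\<And>v. w \<noteq> u @ v"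
  shows "conv R (monomial R \<alpha> u) q w = \<zero>"
  using assms(3)
proof (induction u arbitrary: w)
  case Nil from Nil[of w] show ?case by simp
next
  case (Cons x u)
  note c = assms(1)[THEN subsetD, OF rangeI] assms(2)
  have m: "monomial R \<alpha> (x # u) [] = \<zero>" by (simp add: monomial_def)
  show ?case
  proof (cases w)
    case Nil then show ?thesis using assms c m by (simp add: conv_Nil range_monomial)
  next
    case w: (Cons y w')
    have "conv R (monomial R \<alpha> (x # u)) q w = conv R (\<lambda>v. monomial R \<alpha> (x # u) (y # v)) q w'"
      using w assms c m conv_closed[of "\<lambda>v. monomial R \<alpha> (x # u) (y # v)" q w'] range_monomial[OF assms(2), of "x # u"]
      by (simp add: conv_Cons range_monomial image_subset_iff)
    also have "(\<lambda>v. monomial R \<alpha> (x # u) (y # v)) = (if y = x then monomial R \<alpha> u else (\<lambda>v. \<zero>))"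
      by (auto simp: monomial_def)
    also have "conv R \<dots> q w' = \<zero>"
      using Cons.IH[of w'] Cons.prems w assms(1) by (auto simp: conv_zero_left)
    finally show ?thesis .
  qed
qed

lemma conv_one_left:
  assumes "range q \<subseteq> carrier R" shows "conv R (monomial R \<one> []) q w = q w"
  using conv_monomial_append[OF assms one_closed, of "[]" w] assms by (simp add: image_subset_iff)

lemma conv_one_right:
  assumes "range p \<subseteq> carrier R" shows "conv R p (monomial R \<one> []) w = p w"
  using assms
proof (induction w arbitrary: p)
  case Nil
  note c = Nil[THEN subsetD, OF rangeI]
  show ?case using Nil c by (simp add: conv_Nil range_monomial) (simp add: monomial_def)
next
  case (Cons x w)
  note c = Cons.prems[THEN subsetD, OF rangeI]
  have r: "range (\<lambda>v. p (x # v)) \<subseteq> carrier R" using c by auto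
  show ?case using Cons.prems Cons.IH[OF r] c
    by (simp add: conv_Cons range_monomial) (simp add: monomial_def)
qed

lemma conv_nonzeroD:
  assumes "range p \<subseteq> carrier R" "range q \<subseteq> carrier R" "conv R p q w \<noteq> \<zero>"
  obtains u v where "w = u @ v" "p u \<noteq> \<zero>" "q v \<noteq> \<zero>"
proof -
  note c = assms(1,2)[THEN subsetD, OF rangeI]
  have "\<exists>k\<in>{..length w}. p (take k w) \<otimes> q (drop k w) \<noteq> \<zero>"
  proof (rule ccontr)
    assume "\<not> ?thesis"
    then have "conv R p q w = (\<Oplus>k\<in>{..length w}. \<zero>)"
      unfolding conv_def by (intro finsum_cong') auto
    then show False using assms(3) by simp
  qed
  then obtain k where k: "p (take k w) \<otimes> q (drop k w) \<noteq> \<zero>" by blast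
  then have "p (take k w) \<noteq> \<zero>" "q (drop k w) \<noteq> \<zero>" using c by auto
  then show thesis using that[of "take k w" "drop k w"] by simp
qed

end

lemma free_alg_simps:
  "p \<in> carrier (free_alg F m) \<longleftrightarrow> range p \<subseteq> carrier F \<and> finite {w. p w \<noteq> \<zero>\<^bsub>F\<^esub>} \<and>
     (\<forall>w. p w \<noteq> \<zero>\<^bsub>F\<^esub> \<longrightarrow> set w \<subseteq> {..<m})"
  "p \<otimes>\<^bsub>free_alg F m\<^esub> q = conv F p q"
  "\<one>\<^bsub>free_alg F m\<^esub> = monomial F \<one>\<^bsub>F\<^esub> []"
  "\<zero>\<^bsub>free_alg F m\<^esub> = (\<lambda>w. \<zero>\<^bsub>F\<^esub>)"
  "p \<oplus>\<^bsub>free_alg F m\<^esub> q = (\<lambda>w. p w \<oplus>\<^bsub>F\<^esub> q w)"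
  "\<alpha> \<odot>\<^bsub>free_alg F m\<^esub> p = (\<lambda>w. \<alpha> \<otimes>\<^bsub>F\<^esub> p w)"
  by (auto simp: free_alg_def conv_def monomial_def)

lemma ring_free_alg:
  assumes "cring F" shows "ring (free_alg F m)"
proof -
  interpret cring F by fact
  let ?A = "free_alg F m"
  have ran: "range p \<subseteq> carrier F" if "p \<in> carrier ?A" for p using that by (simp add: free_alg_simps)
  have fin: "finite {w. p w \<noteq> \<zero>\<^bsub>F\<^esub>}" if "p \<in> carrier ?A" for p using that by (simp add: free_alg_simps)
  have words: "set w \<subseteq> {..<m}" if "p \<in> carrier ?A" "p w \<noteq> \<zero>\<^bsub>F\<^esub>" for p w
    using that by (simp add: free_alg_simps)
  have val [simp]: "p w \<in> carrier F" if "p \<in> carrier ?A" for p w using ran[OF that] by blast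
  have add_closed: "(\<lambda>w. p w \<oplus>\<^bsub>F\<^esub> q w) \<in> carrier ?A" if "p \<in> carrier ?A" "q \<in> carrier ?A" for p q
  proof -
    have "finite ({w. p w \<noteq> \<zero>\<^bsub>F\<^esub>} \<union> {w. q w \<noteq> \<zero>\<^bsub>F\<^esub>})" using fin that by simp
    then have "finite {w. p w \<oplus>\<^bsub>F\<^esub> q w \<noteq> \<zero>\<^bsub>F\<^esub>}" by (rule rev_finite_subset) auto
    moreover have "set w \<subseteq> {..<m}" if "p w \<oplus>\<^bsub>F\<^esub> q w \<noteq> \<zero>\<^bsub>F\<^esub>" for w
      using that words[of p w] words[of q w] \<open>p \<in> carrier ?A\<close> \<open>q \<in> carrier ?A\<close> by fastforce
    ultimately show ?thesis using that unfolding free_alg_simps(1)[of "\<lambda>w. p w \<oplus>\<^bsub>F\<^esub> q w"] by auto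
  qed
  have conv_closed: "conv F p q \<in> carrier ?A" if p: "p \<in> carrier ?A" and q: "q \<in> carrier ?A" for p q
  proof -
    have "{w. conv F p q w \<noteq> \<zero>\<^bsub>F\<^esub>} \<subseteq> (\<lambda>(u, v). u @ v) ` ({w. p w \<noteq> \<zero>\<^bsub>F\<^esub>} \<times> {w. q w \<noteq> \<zero>\<^bsub>F\<^esub>})"
    proof
      fix w assume "w \<in> {w. conv F p q w \<noteq> \<zero>\<^bsub>F\<^esub>}"
      then obtain u v where "w = u @ v" "p u \<noteq> \<zero>\<^bsub>F\<^esub>" "q v \<noteq> \<zero>\<^bsub>F\<^esub>"
        using conv_nonzeroD[OF ran[OF p] ran[OF q]] by blast
      then show "w \<in> (\<lambda>(u, v). u @ v) ` ({w. p w \<noteq> \<zero>\<^bsub>F\<^esub>} \<times> {w. q w \<noteq> \<zero>\<^bsub>F\<^esub>})" by force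
    qed
    then have "finite {w. conv F p q w \<noteq> \<zero>\<^bsub>F\<^esub>}"
      by (rule finite_subset) (use fin p q in simp)
    moreover have "set w \<subseteq> {..<m}" if "conv F p q w \<noteq> \<zero>\<^bsub>F\<^esub>" for w
    proof -
      obtain u v where "w = u @ v" "p u \<noteq> \<zero>\<^bsub>F\<^esub>" "q v \<noteq> \<zero>\<^bsub>F\<^esub>"
        using conv_nonzeroD[OF ran[OF p] ran[OF q] \<open>conv F p q w \<noteq> \<zero>\<^bsub>F\<^esub>\<close>] .
      then show ?thesis using words[OF p] words[OF q] by simp
    qed
    ultimately show ?thesis
      using conv_closed ran[OF p] ran[OF q] unfolding free_alg_simps(1)[of "conv F p q"] by blast
  qed
  have "{w. monomial F \<one>\<^bsub>F\<^esub> [] w \<noteq> \<zero>\<^bsub>F\<^esub>} \<subseteq> {[]}" by (auto simp: monomial_def)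
  then have one_closed: "monomial F \<one>\<^bsub>F\<^esub> [] \<in> carrier ?A"
    unfolding free_alg_simps(1) using range_monomial[OF one_closed, of "[]"] finite_subset
    by (auto simp: monomial_def)
  have zero_closed: "(\<lambda>w. \<zero>\<^bsub>F\<^esub>) \<in> carrier ?A" by (auto simp: free_alg_simps)
  have neg: "\<exists>q\<in>carrier ?A. q \<oplus>\<^bsub>?A\<^esub> p = \<zero>\<^bsub>?A\<^esub>" if "p \<in> carrier ?A" for p
  proof
    have "\<ominus>\<^bsub>F\<^esub> x = \<zero>\<^bsub>F\<^esub> \<longleftrightarrow> x = \<zero>\<^bsub>F\<^esub>" if "x \<in> carrier F" for x
      using that minus_minus minus_zero by metis
    then have "{w. \<ominus>\<^bsub>F\<^esub> p w \<noteq> \<zero>\<^bsub>F\<^esub>} = {w. p w \<noteq> \<zero>\<^bsub>F\<^esub>}" using that by simp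
    then show "(\<lambda>w. \<ominus>\<^bsub>F\<^esub> p w) \<in> carrier ?A" using that unfolding free_alg_simps by auto
    show "(\<lambda>w. \<ominus>\<^bsub>F\<^esub> p w) \<oplus>\<^bsub>?A\<^esub> p = \<zero>\<^bsub>?A\<^esub>" using that by (simp add: free_alg_simps(4,5) l_neg)
  qed
  have "abelian_group ?A"
    by (intro abelian_groupI neg)
      (use add_closed zero_closed in \<open>auto simp: free_alg_simps(4,5) a_ac\<close>)
  moreover have "monoid ?A"
    by (intro monoidI)
      (use conv_closed one_closed ran in \<open>auto simp: free_alg_simps(2,3) conv_assoc conv_one_left conv_one_right\<close>)
  ultimately show ?thesis
    by (intro ringI) (use ran in \<open>auto simp: free_alg_simps(2,5) conv_add_left conv_add_right\<close>)
qed

lemma smult_free_alg_closed: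
  assumes "cring F" "p \<in> carrier (free_alg F m)" "\<alpha> \<in> carrier F"
  shows "(\<lambda>w. \<alpha> \<otimes>\<^bsub>F\<^esub> p w) \<in> carrier (free_alg F m)"
proof -
  interpret cring F by fact
  have p: "p w \<in> carrier F" for w using assms(2) unfolding free_alg_simps by blast
  have nz: "p w \<noteq> \<zero>\<^bsub>F\<^esub>" if "\<alpha> \<otimes>\<^bsub>F\<^esub> p w \<noteq> \<zero>\<^bsub>F\<^esub>" for w using that assms(3) by auto
  have "finite {w. p w \<noteq> \<zero>\<^bsub>F\<^esub>}" using assms(2) by (simp add: free_alg_simps)
  then have "finite {w. \<alpha> \<otimes>\<^bsub>F\<^esub> p w \<noteq> \<zero>\<^bsub>F\<^esub>}" by (rule rev_finite_subset) (use nz in blast)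
  then show ?thesis using assms(2,3) nz p unfolding free_alg_simps by blast
qed

section \<open>Field automorphisms acting on a presented algebra\<close>

locale generated_algebra = assoc_algebra F A for F :: "'f ring" and A :: "('f, 'a) module" +
  fixes m :: nat and a :: "nat \<Rightarrow> 'a"
  assumes generators: "a \<in> {..<m} \<rightarrow> carrier A"
begin

sublocale free: ring "free_alg F m" using R.is_cring by (rule ring_free_alg)

abbreviation W :: "nat list \<Rightarrow> 'a" where "W \<equiv> eval_word A a"
abbreviation ev :: "(nat list \<Rightarrow> 'f) \<Rightarrow> 'a" where "ev \<equiv> eval_free F A a"

lemma word_closed: "set w \<subseteq> {..<m} \<Longrightarrow> W w \<in> carrier A"
  using generators by (induction w) (auto simp: eval_word_def)

lemma word_append: "set u \<subseteq> {..<m} \<Longrightarrow> set v \<subseteq> {..<m} \<Longrightarrow> W (u @ v) = W u \<otimes>\<^bsub>A\<^esub> W v"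
proof (induction u)
  case Nil
  then show ?case using word_closed[of v] by (simp add: eval_word_def)
next
  case (Cons x u)
  then have "a x \<in> carrier A" using generators by auto
  moreover have "W (x # w) = a x \<otimes>\<^bsub>A\<^esub> W w" for w by (simp add: eval_word_def)
  ultimately show ?case using Cons word_closed[of u] word_closed[of v] by (simp add: m_assoc)
qed

lemma free_coeff: "p \<in> carrier (free_alg F m) \<Longrightarrow> p w \<in> carrier F"
  unfolding free_alg_simps by blast

lemma free_range: "p \<in> carrier (free_alg F m) \<Longrightarrow> range p \<subseteq> carrier F"
  unfolding free_alg_simps by blast

lemma free_support: "p \<in> carrier (free_alg F m) \<Longrightarrow> finite {w. p w \<noteq> \<zero>\<^bsub>F\<^esub>}"
  unfolding free_alg_simps by blast

lemma free_word: "p \<in> carrier (free_alg F m) \<Longrightarrow> p w \<noteq> \<zero>\<^bsub>F\<^esub> \<Longrightarrow> set w \<subseteq> {..<m}"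
  unfolding free_alg_simps by blast

lemma ev_eq_sum:
  assumes p: "p \<in> carrier (free_alg F m)" and S: "finite S" "{w. p w \<noteq> \<zero>\<^bsub>F\<^esub>} \<subseteq> S" "\<And>w. w \<in> S \<Longrightarrow> set w \<subseteq> {..<m}"
  shows "ev p = (\<Oplus>\<^bsub>A\<^esub>w\<in>S. p w \<odot>\<^bsub>A\<^esub> W w)"
  unfolding eval_free_def
  by (rule M.add.finprod_mono_neutral_cong_left[OF S(1,2)])
    (use S(3) free_coeff[OF p] word_closed in auto)

lemma ev_closed: "p \<in> carrier (free_alg F m) \<Longrightarrow> ev p \<in> carrier A"
  unfolding eval_free_def using free_coeff free_word word_closed by (intro M.finsum_closed) auto

lemma ev_add:
  assumes p: "p \<in> carrier (free_alg F m)" and q: "q \<in> carrier (free_alg F m)"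
  shows "ev (p \<oplus>\<^bsub>free_alg F m\<^esub> q) = ev p \<oplus>\<^bsub>A\<^esub> ev q"
proof -
  let ?S = "{w. p w \<noteq> \<zero>\<^bsub>F\<^esub>} \<union> {w. q w \<noteq> \<zero>\<^bsub>F\<^esub>}"
  let ?r = "p \<oplus>\<^bsub>free_alg F m\<^esub> q"
  have r: "?r \<in> carrier (free_alg F m)" using p q by simp
  have rw: "?r w = p w \<oplus>\<^bsub>F\<^esub> q w" for w by (simp add: free_alg_simps(5))
  have S: "finite ?S" "\<And>w. w \<in> ?S \<Longrightarrow> set w \<subseteq> {..<m}" using p q free_support free_word by auto
  have "ev ?r = (\<Oplus>\<^bsub>A\<^esub>w\<in>?S. ?r w \<odot>\<^bsub>A\<^esub> W w)"
    by (rule ev_eq_sum[OF r S(1) _ S(2)]) (auto simp: rw)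
  also have "\<dots> = (\<Oplus>\<^bsub>A\<^esub>w\<in>?S. p w \<odot>\<^bsub>A\<^esub> W w \<oplus>\<^bsub>A\<^esub> q w \<odot>\<^bsub>A\<^esub> W w)"
    using free_coeff[OF p] free_coeff[OF q] S word_closed
    by (intro M.finsum_cong') (auto simp: rw smult_l_distr)
  also have "\<dots> = (\<Oplus>\<^bsub>A\<^esub>w\<in>?S. p w \<odot>\<^bsub>A\<^esub> W w) \<oplus>\<^bsub>A\<^esub> (\<Oplus>\<^bsub>A\<^esub>w\<in>?S. q w \<odot>\<^bsub>A\<^esub> W w)"
    using free_coeff[OF p] free_coeff[OF q] S word_closed
    by (intro M.finsum_addf) auto
  also have "\<dots> = ev p \<oplus>\<^bsub>A\<^esub> ev q"
    using ev_eq_sum[OF p S(1) _ S(2)] ev_eq_sum[OF q S(1) _ S(2)] by simp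
  finally show ?thesis .
qed

lemma ev_smult:
  assumes p: "p \<in> carrier (free_alg F m)" and \<alpha>: "\<alpha> \<in> carrier F"
  shows "ev (\<lambda>w. \<alpha> \<otimes>\<^bsub>F\<^esub> p w) = \<alpha> \<odot>\<^bsub>A\<^esub> ev p"
proof -
  let ?S = "{w. p w \<noteq> \<zero>\<^bsub>F\<^esub>}"
  have S: "finite ?S" "\<And>w. w \<in> ?S \<Longrightarrow> set w \<subseteq> {..<m}" using p free_support free_word by auto
  have "ev (\<lambda>w. \<alpha> \<otimes>\<^bsub>F\<^esub> p w) = (\<Oplus>\<^bsub>A\<^esub>w\<in>?S. (\<alpha> \<otimes>\<^bsub>F\<^esub> p w) \<odot>\<^bsub>A\<^esub> W w)"
    by (rule ev_eq_sum[OF smult_free_alg_closed[OF R.is_cring p \<alpha>] S(1) _ S(2)]) (use \<alpha> in auto)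
  also have "\<dots> = (\<Oplus>\<^bsub>A\<^esub>w\<in>?S. \<alpha> \<odot>\<^bsub>A\<^esub> (p w \<odot>\<^bsub>A\<^esub> W w))"
    using \<alpha> free_coeff[OF p] S word_closed by (intro M.finsum_cong') (auto simp: smult_assoc1)
  also have "\<dots> = \<alpha> \<odot>\<^bsub>A\<^esub> ev p"
    unfolding eval_free_def
    using \<alpha> free_coeff[OF p] S word_closed by (intro finsum_smult_ldistr[symmetric]) auto
  finally show ?thesis .
qed

lemma monomial_closed:
  assumes "\<alpha> \<in> carrier F" "set u \<subseteq> {..<m}"
  shows "monomial F \<alpha> u \<in> carrier (free_alg F m)"
proof -
  have "{w. monomial F \<alpha> u w \<noteq> \<zero>\<^bsub>F\<^esub>} \<subseteq> {u}" by (auto simp: monomial_def)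
  then show ?thesis
    using assms R.range_monomial[OF assms(1), of u] finite_subset unfolding free_alg_simps by blast
qed

lemma ev_monomial:
  assumes "\<alpha> \<in> carrier F" "set u \<subseteq> {..<m}"
  shows "ev (monomial F \<alpha> u) = \<alpha> \<odot>\<^bsub>A\<^esub> W u"
proof -
  have "ev (monomial F \<alpha> u) = (\<Oplus>\<^bsub>A\<^esub>w\<in>{u}. monomial F \<alpha> u w \<odot>\<^bsub>A\<^esub> W w)"
    by (rule ev_eq_sum[OF monomial_closed[OF assms]]) (use assms in \<open>auto simp: monomial_def\<close>)
  then show ?thesis using assms word_closed by (simp add: monomial_def)
qed

lemma ev_monomial_mult:
  assumes \<alpha>: "\<alpha> \<in> carrier F" and u: "set u \<subseteq> {..<m}" and q: "q \<in> carrier (free_alg F m)"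
  shows "ev (monomial F \<alpha> u \<otimes>\<^bsub>free_alg F m\<^esub> q) = ev (monomial F \<alpha> u) \<otimes>\<^bsub>A\<^esub> ev q"
proof -
  let ?r = "monomial F \<alpha> u \<otimes>\<^bsub>free_alg F m\<^esub> q"
  let ?T = "{v. q v \<noteq> \<zero>\<^bsub>F\<^esub>}"
  have r: "?r \<in> carrier (free_alg F m)" using monomial_closed[OF \<alpha> u] q by simp
  have rv: "?r (u @ v) = \<alpha> \<otimes>\<^bsub>F\<^esub> q v" for v
    using R.conv_monomial_append[OF free_range[OF q] \<alpha>] by (simp add: free_alg_simps(2))
  have T: "finite ?T" "\<And>v. v \<in> ?T \<Longrightarrow> set v \<subseteq> {..<m}" using q free_support free_word by auto
  have "{w. ?r w \<noteq> \<zero>\<^bsub>F\<^esub>} \<subseteq> (@) u ` ?T"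
  proof
    fix w assume "w \<in> {w. ?r w \<noteq> \<zero>\<^bsub>F\<^esub>}"
    then have nz: "?r w \<noteq> \<zero>\<^bsub>F\<^esub>" by simp
    then obtain v where v: "w = u @ v"
      using R.conv_monomial_other[OF free_range[OF q] \<alpha>, of w u] by (auto simp: free_alg_simps(2))
    then show "w \<in> (@) u ` ?T" using nz rv[of v] \<alpha> by auto
  qed
  moreover have "set w \<subseteq> {..<m}" if "w \<in> (@) u ` ?T" for w
    using that u T(2) by (elim imageE) simp
  ultimately have "ev ?r = (\<Oplus>\<^bsub>A\<^esub>w\<in>(@) u ` ?T. ?r w \<odot>\<^bsub>A\<^esub> W w)"
    by (intro ev_eq_sum[OF r]) (use T(1) in auto)
  also have "\<dots> = (\<Oplus>\<^bsub>A\<^esub>v\<in>?T. ?r (u @ v) \<odot>\<^bsub>A\<^esub> W (u @ v))"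
    using free_coeff[OF r] T u word_closed by (intro M.finsum_reindex) (auto simp: inj_on_def)
  also have "\<dots> = (\<Oplus>\<^bsub>A\<^esub>v\<in>?T. (\<alpha> \<odot>\<^bsub>A\<^esub> W u) \<otimes>\<^bsub>A\<^esub> (q v \<odot>\<^bsub>A\<^esub> W v))"
    using free_coeff[OF q] T u word_closed \<alpha>
    by (intro M.finsum_cong')
      (auto simp: rv word_append smult_mult_l smult_mult_r smult_assoc1[symmetric] R.m_comm)
  also have "\<dots> = (\<alpha> \<odot>\<^bsub>A\<^esub> W u) \<otimes>\<^bsub>A\<^esub> ev q"
    unfolding eval_free_def
    using free_coeff[OF q] T u word_closed \<alpha> by (intro finsum_rdistr[symmetric]) auto
  finally show ?thesis using ev_monomial[OF \<alpha> u] by simp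
qed

text \<open>Both sides are additive in \<open>p\<close>, so monomials can be split off from \<open>p\<close> one at a time.\<close>

lemma ev_mult:
  assumes p: "p \<in> carrier (free_alg F m)" and q: "q \<in> carrier (free_alg F m)"
  shows "ev (p \<otimes>\<^bsub>free_alg F m\<^esub> q) = ev p \<otimes>\<^bsub>A\<^esub> ev q"
proof -
  let ?A = "free_alg F m"
  have "ev (p \<otimes>\<^bsub>?A\<^esub> q) = ev p \<otimes>\<^bsub>A\<^esub> ev q"
    if "finite S" "p \<in> carrier ?A" "{w. p w \<noteq> \<zero>\<^bsub>F\<^esub>} \<subseteq> S" for S p
    using that
  proof (induction S arbitrary: p rule: finite_induct)
    case empty
    then have "p = \<zero>\<^bsub>?A\<^esub>" by (auto simp: free_alg_simps(4))
    moreover have "ev \<zero>\<^bsub>?A\<^esub> = \<zero>\<^bsub>A\<^esub>" by (simp add: eval_free_def free_alg_simps(4))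
    ultimately show ?case using q ev_closed[OF q] by simp
  next
    case (insert u S)
    show ?case
    proof (cases "p u = \<zero>\<^bsub>F\<^esub>")
      case True
      then have "{w. p w \<noteq> \<zero>\<^bsub>F\<^esub>} \<subseteq> S" using insert.prems(2) by auto
      then show ?thesis using insert by blast
    next
      case False
      have u: "set u \<subseteq> {..<m}" using free_word[OF insert.prems(1) False] .
      have \<alpha>: "p u \<in> carrier F" using free_coeff[OF insert.prems(1)] .
      define mo p' where "mo = monomial F (p u) u" and "p' = (\<lambda>w. if w = u then \<zero>\<^bsub>F\<^esub> else p w)"
      have mo: "mo \<in> carrier ?A" unfolding mo_def using monomial_closed[OF \<alpha> u] .
      have "finite {w. p' w \<noteq> \<zero>\<^bsub>F\<^esub>}"
        by (rule finite_subset[OF _ free_support[OF insert.prems(1)]]) (auto simp: p'_def)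
      then have p': "p' \<in> carrier ?A"
        using insert.prems(1) unfolding free_alg_simps(1) by (auto simp: image_subset_iff p'_def)
      have dec: "p = mo \<oplus>\<^bsub>?A\<^esub> p'"
        using free_coeff[OF insert.prems(1)] by (auto simp: free_alg_simps(5) monomial_def mo_def p'_def)
      have IH: "ev (p' \<otimes>\<^bsub>?A\<^esub> q) = ev p' \<otimes>\<^bsub>A\<^esub> ev q"
        using p' insert.prems(2) by (intro insert.IH) (auto simp: p'_def)
      have "ev (p \<otimes>\<^bsub>?A\<^esub> q) = ev (mo \<otimes>\<^bsub>?A\<^esub> q \<oplus>\<^bsub>?A\<^esub> p' \<otimes>\<^bsub>?A\<^esub> q)"
        using dec free.l_distr[OF mo p' q] by simp
      also have "\<dots> = ev mo \<otimes>\<^bsub>A\<^esub> ev q \<oplus>\<^bsub>A\<^esub> ev p' \<otimes>\<^bsub>A\<^esub> ev q"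
        using mo p' q IH ev_monomial_mult[OF \<alpha> u q] ev_add by (simp add: mo_def)
      also have "\<dots> = ev (mo \<oplus>\<^bsub>?A\<^esub> p') \<otimes>\<^bsub>A\<^esub> ev q"
        using ev_add[OF mo p'] ev_closed[OF mo] ev_closed[OF p'] ev_closed[OF q] by (simp add: l_distr)
      finally show ?thesis using dec by simp
    qed
  qed
  then show ?thesis using free_support[OF p] p by blast
qed

lemma ev_one: "ev \<one>\<^bsub>free_alg F m\<^esub> = \<one>\<^bsub>A\<^esub>"
  using ev_monomial[of "\<one>\<^bsub>F\<^esub>" "[]"] by (simp add: free_alg_simps(3) eval_word_def)

lemma ev_ring_hom: "ev \<in> ring_hom (free_alg F m) A"
  using ev_closed ev_mult ev_add ev_one by (intro ring_hom_memI) auto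

end

lemma free_alg_coefficient_hom:
  assumes F: "cring F" and \<sigma>: "\<sigma> \<in> ring_iso F F"
  shows "(\<circ>) \<sigma> \<in> ring_hom (free_alg F m) (free_alg F m)"
proof -
  interpret F: cring F by fact
  have hom: "\<sigma> \<in> ring_hom F F" and inj: "inj_on \<sigma> (carrier F)"
    using \<sigma> by (auto simp: ring_iso_def bij_betw_def)
  interpret h: ring_hom_ring F F \<sigma> using ring_hom_ringI2[OF F.ring_axioms F.ring_axioms hom] .
  have zero: "\<sigma> x = \<zero>\<^bsub>F\<^esub> \<longleftrightarrow> x = \<zero>\<^bsub>F\<^esub>" if "x \<in> carrier F" for x
    using inj that F.zero_closed h.hom_zero unfolding inj_on_def by metis
  have rng: "range p \<subseteq> carrier F" if "p \<in> carrier (free_alg F m)" for p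
    using that unfolding free_alg_simps by blast
  have coeff: "p w \<in> carrier F" if "p \<in> carrier (free_alg F m)" for p w
    using rng[OF that] by blast
  have closed: "\<sigma> \<circ> p \<in> carrier (free_alg F m)" if p: "p \<in> carrier (free_alg F m)" for p
  proof -
    have "(\<sigma> \<circ> p) w \<noteq> \<zero>\<^bsub>F\<^esub> \<longleftrightarrow> p w \<noteq> \<zero>\<^bsub>F\<^esub>" for w using zero[OF coeff[OF p]] by simp
    then show ?thesis using p coeff[OF p] unfolding free_alg_simps(1) by auto
  qed
  show ?thesis
  proof (rule ring_hom_memI)
    fix p q assume p: "p \<in> carrier (free_alg F m)" and q: "q \<in> carrier (free_alg F m)"
    note c = coeff[OF p] coeff[OF q]
    have "\<sigma> (conv F p q w) = conv F (\<sigma> \<circ> p) (\<sigma> \<circ> q) w" for w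
    proof -
      have "\<sigma> (conv F p q w) = (\<Oplus>\<^bsub>F\<^esub>k\<in>{..length w}. \<sigma> (p (take k w) \<otimes>\<^bsub>F\<^esub> q (drop k w)))"
        unfolding conv_def by (rule additive_finsum) (use c in \<open>auto intro: F.abelian_monoid_axioms\<close>)
      also have "\<dots> = conv F (\<sigma> \<circ> p) (\<sigma> \<circ> q) w"
        unfolding conv_def using c by (intro F.finsum_cong') auto
      finally show ?thesis .
    qed
    then show "\<sigma> \<circ> (p \<otimes>\<^bsub>free_alg F m\<^esub> q) = (\<sigma> \<circ> p) \<otimes>\<^bsub>free_alg F m\<^esub> (\<sigma> \<circ> q)"
      by (auto simp: free_alg_simps(2))
    show "\<sigma> \<circ> (p \<oplus>\<^bsub>free_alg F m\<^esub> q) = (\<sigma> \<circ> p) \<oplus>\<^bsub>free_alg F m\<^esub> (\<sigma> \<circ> q)"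
      using c by (auto simp: free_alg_simps(5))
  next
    show "\<sigma> \<circ> \<one>\<^bsub>free_alg F m\<^esub> = \<one>\<^bsub>free_alg F m\<^esub>" by (auto simp: free_alg_simps(3) monomial_def)
  qed (rule closed)
qed

text \<open>The universal property of a quotient ring, for a surjective homomorphism in place of a projection.\<close>

lemma ring_hom_factor:
  assumes "ring R" "ring A" "ring B" and g: "g \<in> ring_hom R A" "g ` carrier R = carrier A"
    and f: "f \<in> ring_hom R B" and ker: "a_kernel R A g \<subseteq> a_kernel R B f"
  obtains \<phi> where "\<phi> \<in> ring_hom A B" "\<And>p. p \<in> carrier R \<Longrightarrow> \<phi> (g p) = f p"
proof -
  interpret g: ring_hom_ring R A g using ring_hom_ringI2[OF assms(1,2) g(1)] .
  interpret f: ring_hom_ring R B f using ring_hom_ringI2[OF assms(1,3) f] .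
  have eq: "f p = f q" if p: "p \<in> carrier R" and q: "q \<in> carrier R" and gpq: "g p = g q" for p q
  proof -
    have "g (p \<ominus>\<^bsub>R\<^esub> q) = \<zero>\<^bsub>A\<^esub>"
      using p q gpq by (simp add: g.R.minus_eq g.S.r_neg)
    moreover have "p \<ominus>\<^bsub>R\<^esub> q \<in> carrier R" using p q by simp
    ultimately have "f (p \<ominus>\<^bsub>R\<^esub> q) = \<zero>\<^bsub>B\<^esub>" using ker unfolding a_kernel_def' by blast
    moreover have "f (p \<ominus>\<^bsub>R\<^esub> q) = f p \<ominus>\<^bsub>B\<^esub> f q"
      using p q by (simp add: g.R.minus_eq f.S.minus_eq)
    ultimately show ?thesis using p q f.S.r_right_minus_eq[of "f p" "f q"] by simp
  qed
  define s where "s = inv_into (carrier R) g"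
  have s: "s x \<in> carrier R" "g (s x) = x" if "x \<in> carrier A" for x
    using that g(2) by (auto simp: s_def inv_into_into f_inv_into_f)
  define \<phi> where "\<phi> x = f (s x)" for x
  have \<phi>: "\<phi> (g p) = f p" if "p \<in> carrier R" for p
    unfolding \<phi>_def using that s[of "g p"] by (intro eq) auto
  have "\<phi> \<in> ring_hom A B"
  proof (rule ring_hom_memI)
    show "\<phi> x \<in> carrier B" if "x \<in> carrier A" for x using s that by (simp add: \<phi>_def)
    show "\<phi> (x \<otimes>\<^bsub>A\<^esub> y) = \<phi> x \<otimes>\<^bsub>B\<^esub> \<phi> y" if "x \<in> carrier A" "y \<in> carrier A" for x y
      using \<phi>[of "s x \<otimes>\<^bsub>R\<^esub> s y"] s that by (simp add: \<phi>_def)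
    show "\<phi> (x \<oplus>\<^bsub>A\<^esub> y) = \<phi> x \<oplus>\<^bsub>B\<^esub> \<phi> y" if "x \<in> carrier A" "y \<in> carrier A" for x y
      using \<phi>[of "s x \<oplus>\<^bsub>R\<^esub> s y"] s that by (simp add: \<phi>_def)
    show "\<phi> \<one>\<^bsub>A\<^esub> = \<one>\<^bsub>B\<^esub>" using \<phi>[of "\<one>\<^bsub>R\<^esub>"] by simp
  qed
  then show thesis using that \<phi> by blast
qed

locale presented_algebra = generated_algebra F A m a
  for F :: "'f ring" and A :: "('f, 'a) module" and m a +
  fixes S :: "(nat list \<Rightarrow> 'f) set"
  assumes surj: "eval_free F A a ` carrier (free_alg F m) = carrier A"
    and relators: "S \<subseteq> carrier (free_alg F m)"
    and kernel: "a_kernel (free_alg F m) A (eval_free F A a) = Idl\<^bsub>free_alg F m\<^esub> S"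
begin

text \<open>The automorphism leaves the relators unchanged, so they lie in the kernel of \<open>p \<mapsto> ev (\<tau> \<circ> p)\<close>. Being
an ideal, this kernel contains all relations of \<open>A\<close>.\<close>

lemma induced_hom:
  assumes \<tau>: "\<tau> \<in> ring_iso F F" and fix_S: "\<forall>p\<in>S. \<forall>w. \<tau> (p w) = p w"
  shows "\<exists>\<phi>\<in>ring_hom A A. \<forall>p\<in>carrier (free_alg F m). \<phi> (ev p) = ev (\<tau> \<circ> p)"
proof -
  let ?A = "free_alg F m"
  have f: "ev \<circ> (\<circ>) \<tau> \<in> ring_hom ?A A"
    using free_alg_coefficient_hom[OF R.is_cring \<tau>] ev_ring_hom by (rule ring_hom_trans)
  interpret f: ring_hom_ring ?A A "ev \<circ> (\<circ>) \<tau>"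
    using ring_hom_ringI2[OF free.ring_axioms ring_axioms f] .
  have "p \<in> a_kernel ?A A (ev \<circ> (\<circ>) \<tau>)" if p: "p \<in> S" for p
  proof -
    have "\<tau> \<circ> p = p" using fix_S p by auto
    moreover have "p \<in> a_kernel ?A A ev" using p relators free.genideal_self kernel by blast
    ultimately show ?thesis by (simp add: a_kernel_def')
  qed
  then have "a_kernel ?A A ev \<subseteq> a_kernel ?A A (ev \<circ> (\<circ>) \<tau>)"
    unfolding kernel by (intro free.genideal_minimal f.kernel_is_ideal) blast
  then obtain \<phi> where "\<phi> \<in> ring_hom A A" "\<And>p. p \<in> carrier ?A \<Longrightarrow> \<phi> (ev p) = (ev \<circ> (\<circ>) \<tau>) p"
    using ring_hom_factor[OF free.ring_axioms ring_axioms ring_axioms ev_ring_hom surj f] by blast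
  then show ?thesis by auto
qed

text \<open>The inverse automorphism of the field fixes the relators as well and induces the inverse map on \<open>A\<close>.\<close>

lemma induced_semilinear_automorphism:
  assumes \<tau>: "\<tau> \<in> ring_iso F F" and fix_S: "\<forall>p\<in>S. \<forall>w. \<tau> (p w) = p w"
  obtains \<phi> where "\<phi> \<in> semilinear_iso F \<tau> A A" "\<And>p. p \<in> carrier (free_alg F m) \<Longrightarrow> \<phi> (ev p) = ev (\<tau> \<circ> p)"
proof -
  let ?A = "free_alg F m" and ?\<rho> = "inv_into (carrier F) \<tau>"
  have bij: "bij_betw \<tau> (carrier F) (carrier F)" and hom: "\<tau> \<in> ring_hom F F"
    using \<tau> by (auto simp: ring_iso_def)
  have \<rho>: "?\<rho> \<in> ring_iso F F" using ring_iso_set_sym[OF R.ring_axioms \<tau>] .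
  have inv: "?\<rho> (\<tau> x) = x" "\<tau> (?\<rho> x) = x" if "x \<in> carrier F" for x
    using bij that by (auto simp: bij_betw_inv_into_left bij_betw_inv_into_right)
  have "?\<rho> (p w) = p w" if "p \<in> S" for p w
  proof -
    have "\<tau> (p w) = p w" "p w \<in> carrier F" using fix_S free_coeff[of p w] relators that by auto
    then show ?thesis using inv(1)[of "p w"] by simp
  qed
  then have "\<exists>\<psi>\<in>ring_hom A A. \<forall>p\<in>carrier ?A. \<psi> (ev p) = ev (?\<rho> \<circ> p)"
    by (intro induced_hom \<rho>) blast
  then obtain \<psi> where \<psi>: "\<psi> \<in> ring_hom A A" "\<And>p. p \<in> carrier ?A \<Longrightarrow> \<psi> (ev p) = ev (?\<rho> \<circ> p)"
    by blast
  obtain \<phi> where \<phi>: "\<phi> \<in> ring_hom A A" "\<And>p. p \<in> carrier ?A \<Longrightarrow> \<phi> (ev p) = ev (\<tau> \<circ> p)"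
    using induced_hom[OF \<tau> fix_S] by blast
  have closed: "\<tau> \<circ> p \<in> carrier ?A" "?\<rho> \<circ> p \<in> carrier ?A" if "p \<in> carrier ?A" for p
    using ring_hom_memE(1)[OF free_alg_coefficient_hom[OF R.is_cring \<tau>] that]
      ring_hom_memE(1)[OF free_alg_coefficient_hom[OF R.is_cring \<rho>] that] by simp_all
  have comp: "\<tau> \<circ> (?\<rho> \<circ> p) = p" "?\<rho> \<circ> (\<tau> \<circ> p) = p" if "p \<in> carrier ?A" for p
    using inv free_coeff[OF that] by (auto simp: fun_eq_iff)
  have "\<phi> (\<psi> x) = x \<and> \<psi> (\<phi> x) = x" if "x \<in> carrier A" for x
  proof -
    have "x \<in> ev ` carrier ?A" using that surj by simp
    then obtain p where p: "p \<in> carrier ?A" "x = ev p" by (rule imageE)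
    then show ?thesis using \<phi>(2) \<psi>(2) closed[OF p(1)] comp[OF p(1)] by simp
  qed
  then have "bij_betw \<phi> (carrier A) (carrier A)"
    using \<phi>(1) \<psi>(1) by (intro bij_betwI[where g = \<psi>]) (auto simp: ring_hom_def)
  moreover have "\<phi> (\<alpha> \<odot>\<^bsub>A\<^esub> x) = \<tau> \<alpha> \<odot>\<^bsub>A\<^esub> \<phi> x" if \<alpha>: "\<alpha> \<in> carrier F" and x: "x \<in> carrier A" for \<alpha> x
  proof -
    have "x \<in> ev ` carrier ?A" using x surj by simp
    then obtain p where p: "p \<in> carrier ?A" "x = ev p" by (rule imageE)
    have t\<alpha>: "\<tau> \<alpha> \<in> carrier F" using hom \<alpha> by (rule ring_hom_memE)
    have "\<phi> (\<alpha> \<odot>\<^bsub>A\<^esub> x) = ev (\<tau> \<circ> (\<lambda>w. \<alpha> \<otimes>\<^bsub>F\<^esub> p w))"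
      using p \<alpha> ev_smult[OF p(1) \<alpha>] \<phi>(2)[OF smult_free_alg_closed[OF R.is_cring p(1) \<alpha>]] by simp
    also have "\<tau> \<circ> (\<lambda>w. \<alpha> \<otimes>\<^bsub>F\<^esub> p w) = (\<lambda>w. \<tau> \<alpha> \<otimes>\<^bsub>F\<^esub> (\<tau> \<circ> p) w)"
      using free_coeff[OF p(1)] \<alpha> hom by (auto simp: ring_hom_mult)
    also have "ev \<dots> = \<tau> \<alpha> \<odot>\<^bsub>A\<^esub> \<phi> x"
      using ev_smult[OF closed(1)[OF p(1)] t\<alpha>] \<phi>(2)[OF p(1)] p(2) by simp
    finally show ?thesis .
  qed
  ultimately have "\<phi> \<in> semilinear_iso F \<tau> A A"
    using \<phi>(1) by (auto simp: semilinear_iso_def ring_iso_def)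
  then show thesis using that \<phi>(2) by blast
qed

end

section \<open>Counting\<close>

text \<open>Elements of \<^const>\<open>field_Aut\<close> are extensional; for semilinearity only the values on the field matter.\<close>

lemma semilinearly_isomorphicI:
  assumes \<sigma>: "\<sigma> \<in> ring_iso F F" and \<phi>: "\<phi> \<in> semilinear_iso F \<sigma> B C" and F: "ring F"
  shows "semilinearly_isomorphic F B C"
proof -
  interpret F: ring F by fact
  let ?\<sigma> = "restrict \<sigma> (carrier F)"
  have "?\<sigma> \<in> ring_iso F F"
    using \<sigma> by (auto simp: ring_iso_def ring_hom_def bij_betw_def inj_on_def)
  then have "?\<sigma> \<in> carrier (field_Aut F)" by (simp add: field_Aut_simps)
  moreover have "\<phi> \<in> semilinear_iso F ?\<sigma> B C" using \<phi> by (simp add: semilinear_iso_def)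
  ultimately show ?thesis unfolding semilinearly_isomorphic_def by blast
qed

lemma semilinearly_isomorphicE:
  assumes "semilinearly_isomorphic F B C"
  obtains \<sigma> \<phi> where "\<sigma> \<in> ring_iso F F" "\<phi> \<in> semilinear_iso F \<sigma> B C"
  using assms by (auto simp: semilinearly_isomorphic_def field_Aut_simps)

lemma semilinearly_isomorphic_trans:
  assumes F: "ring F" and BC: "semilinearly_isomorphic F B C" and CD: "semilinearly_isomorphic F C D"
  shows "semilinearly_isomorphic F B D"
proof -
  obtain \<sigma> \<phi> where \<sigma>: "\<sigma> \<in> ring_iso F F" and \<phi>: "\<phi> \<in> semilinear_iso F \<sigma> B C"
    using semilinearly_isomorphicE[OF BC] .
  obtain \<tau> \<psi> where \<tau>: "\<tau> \<in> ring_iso F F" and \<psi>: "\<psi> \<in> semilinear_iso F \<tau> C D"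
    using semilinearly_isomorphicE[OF CD] .
  have st: "\<tau> \<circ> \<sigma> \<in> ring_iso F F" using ring_iso_set_trans[OF \<sigma> \<tau>] .
  have r: "\<phi> \<in> ring_iso B C" "\<psi> \<in> ring_iso C D" using \<phi> \<psi> by (simp_all add: semilinear_iso_def)
  have "\<psi> \<circ> \<phi> \<in> semilinear_iso F (\<tau> \<circ> \<sigma>) B D"
    using \<phi> \<psi> ring_iso_set_trans[OF r] ring_iso_memE(1)[OF r(1)] ring_iso_memE(1)[OF \<sigma>]
    by (simp add: semilinear_iso_def)
  then show ?thesis by (rule semilinearly_isomorphicI[OF st _ F])
qed

lemma semilinearly_isomorphic_sym:
  assumes F: "ring F" and B: "assoc_algebra F B" and BC: "semilinearly_isomorphic F B C"
  shows "semilinearly_isomorphic F C B"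
proof -
  interpret Br: ring B using B by (simp add: assoc_algebra_def)
  interpret B: assoc_algebra F B by fact
  obtain \<sigma> \<phi> where \<sigma>: "\<sigma> \<in> ring_iso F F" and \<phi>: "\<phi> \<in> semilinear_iso F \<sigma> B C"
    using semilinearly_isomorphicE[OF BC] .
  let ?\<tau> = "inv_into (carrier F) \<sigma>" and ?\<psi> = "inv_into (carrier B) \<phi>"
  have \<tau>: "?\<tau> \<in> ring_iso F F" using ring_iso_set_sym[OF F \<sigma>] .
  have r: "\<phi> \<in> ring_iso B C" using \<phi> by (simp add: semilinear_iso_def)
  have \<psi>: "?\<psi> \<in> ring_iso C B" using ring_iso_set_sym[OF Br.ring_axioms r] .
  have b\<sigma>: "bij_betw \<sigma> (carrier F) (carrier F)" and b\<phi>: "bij_betw \<phi> (carrier B) (carrier C)"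
    using \<sigma> r by (simp_all add: ring_iso_def)
  have "?\<psi> (\<alpha> \<odot>\<^bsub>C\<^esub> c) = ?\<tau> \<alpha> \<odot>\<^bsub>B\<^esub> ?\<psi> c" if \<alpha>: "\<alpha> \<in> carrier F" and c: "c \<in> carrier C" for \<alpha> c
  proof -
    have \<tau>\<alpha>: "?\<tau> \<alpha> \<in> carrier F" "\<sigma> (?\<tau> \<alpha>) = \<alpha>"
      using \<alpha> ring_iso_memE(1)[OF \<tau>] bij_betw_inv_into_right[OF b\<sigma>] by simp_all
    have \<psi>c: "?\<psi> c \<in> carrier B" "\<phi> (?\<psi> c) = c"
      using c ring_iso_memE(1)[OF \<psi>] bij_betw_inv_into_right[OF b\<phi>] by simp_all
    have "\<phi> (?\<tau> \<alpha> \<odot>\<^bsub>B\<^esub> ?\<psi> c) = \<alpha> \<odot>\<^bsub>C\<^esub> c" using \<phi> \<tau>\<alpha> \<psi>c by (simp add: semilinear_iso_def)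
    then show ?thesis
      using bij_betw_inv_into_left[OF b\<phi> B.smult_closed[OF \<tau>\<alpha>(1) \<psi>c(1)]] by simp
  qed
  then have "?\<psi> \<in> semilinear_iso F ?\<tau> C B" using \<psi> by (simp add: semilinear_iso_def)
  then show ?thesis by (rule semilinearly_isomorphicI[OF \<tau> _ F])
qed

lemma alg_isomorphic_imp_semilinearly_isomorphic:
  assumes "ring F" "alg_isomorphic F B C"
  shows "semilinearly_isomorphic F B C"
proof -
  obtain h where "h \<in> semilinear_iso F id B C"
    using assms(2) by (auto simp: alg_isomorphic_def alg_iso_def semilinear_iso_def)
  then show ?thesis by (rule semilinearly_isomorphicI[OF ring_iso_set_refl _ assms(1)])
qed

lemma twist_semilinearly_isomorphic:
  assumes "ring F" "\<sigma> \<in> carrier (field_Aut F)"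
  shows "semilinearly_isomorphic F (twist \<sigma> B) B"
proof -
  have "id \<in> semilinear_iso F \<sigma> (twist \<sigma> B) B" by (simp add: semilinear_iso_def ring_iso_set_refl)
  then show ?thesis using assms(2) unfolding semilinearly_isomorphic_def by blast
qed

lemma semilinear_iso_corner:
  assumes R: "ring R" and e: "e \<in> carrier R" and \<phi>: "\<phi> \<in> semilinear_iso F \<sigma> R R'"
  shows "\<phi> \<in> semilinear_iso F \<sigma> (corner R e) (corner R' (\<phi> e))"
proof -
  interpret R: ring R by fact
  have iso: "\<phi> \<in> ring_iso R R'" using \<phi> by (simp add: semilinear_iso_def)
  have bij: "bij_betw \<phi> (carrier R) (carrier R')" using iso by (simp add: ring_iso_def)
  have sub: "carrier (corner R e) \<subseteq> carrier R" using e by (auto simp: corner_def)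
  have hom: "\<phi> (x \<otimes>\<^bsub>R\<^esub> y) = \<phi> x \<otimes>\<^bsub>R'\<^esub> \<phi> y" "\<phi> (x \<oplus>\<^bsub>R\<^esub> y) = \<phi> x \<oplus>\<^bsub>R'\<^esub> \<phi> y"
    if "x \<in> carrier R" "y \<in> carrier R" for x y
    using ring_iso_memE(2,3)[OF iso that] by simp_all
  have img: "\<phi> ` carrier (corner R e) = carrier (corner R' (\<phi> e))"
  proof -
    have "\<phi> ` carrier (corner R e) = (\<lambda>x. \<phi> (e \<otimes>\<^bsub>R\<^esub> x \<otimes>\<^bsub>R\<^esub> e)) ` carrier R" by (auto simp: corner_def)
    also have "\<dots> = (\<lambda>x. \<phi> e \<otimes>\<^bsub>R'\<^esub> x \<otimes>\<^bsub>R'\<^esub> \<phi> e) ` \<phi> ` carrier R"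
      unfolding image_image using e hom(1) by (intro image_cong) simp_all
    also have "\<phi> ` carrier R = carrier R'" using bij by (simp add: bij_betw_def)
    finally show ?thesis by (auto simp: corner_def)
  qed
  have "inj_on \<phi> (carrier (corner R e))" using bij sub by (auto simp: bij_betw_def intro: inj_on_subset)
  then have "bij_betw \<phi> (carrier (corner R e)) (carrier (corner R' (\<phi> e)))" using img by (simp add: bij_betw_def)
  moreover have "\<phi> \<in> ring_hom (corner R e) (corner R' (\<phi> e))"
    using img hom subsetD[OF sub] by (intro ring_hom_memI) auto
  ultimately show ?thesis
    using \<phi> sub by (auto simp: semilinear_iso_def ring_iso_def)
qed

lemma semilinear_iso_mat_alg:
  assumes F: "\<And>\<alpha>. \<alpha> \<in> carrier F \<Longrightarrow> \<sigma> \<alpha> \<in> carrier F"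
    and A: "assoc_algebra F A" and A': "assoc_algebra F A'" and \<phi>: "\<phi> \<in> semilinear_iso F \<sigma> A A'"
  shows "(\<lambda>M. \<lambda>p\<in>{..<n} \<times> {..<n}. \<phi> (M p)) \<in> semilinear_iso F \<sigma> (mat_alg n A) (mat_alg n A')"
proof -
  let ?I = "{..<n} \<times> {..<n}"
  let ?\<Phi> = "\<lambda>M. \<lambda>p\<in>?I. \<phi> (M p)"
  interpret Ar: ring A using A by (simp add: assoc_algebra_def)
  interpret A: assoc_algebra F A by fact
  interpret Ar': ring A' using A' by (simp add: assoc_algebra_def)
  interpret M: ring "mat_alg n A" using assoc_algebra_mat_alg[OF A] by (simp add: assoc_algebra_def)
  have iso: "\<phi> \<in> ring_iso A A'" using \<phi> by (simp add: semilinear_iso_def)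
  then have hom: "\<phi> \<in> ring_hom A A'" and bij: "bij_betw \<phi> (carrier A) (carrier A')"
    by (simp_all add: ring_iso_def)
  interpret h: ring_hom_ring A A' \<phi> using ring_hom_ringI2[OF Ar.ring_axioms Ar'.ring_axioms hom] .
  have entry: "M (i, j) \<in> carrier A" if "M \<in> carrier (mat_alg n A)" "i < n" "j < n" for M i j
    using mat_alg_entry that .
  have closed: "?\<Phi> M \<in> carrier (mat_alg n A')" if "M \<in> carrier (mat_alg n A)" for M
    using entry[OF that] by (intro mat_algI) auto
  let ?\<psi> = "inv_into (carrier A) \<phi>"
  let ?\<Psi> = "\<lambda>M. \<lambda>p\<in>?I. ?\<psi> (M p)"
  have bij': "bij_betw ?\<psi> (carrier A') (carrier A)" using bij_betw_inv_into[OF bij] .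
  have "bij_betw ?\<Phi> (carrier (mat_alg n A)) (carrier (mat_alg n A'))"
  proof (rule bij_betwI[where g = ?\<Psi>])
    show "?\<Phi> \<in> carrier (mat_alg n A) \<rightarrow> carrier (mat_alg n A')" using closed by blast
    show "?\<Psi> \<in> carrier (mat_alg n A') \<rightarrow> carrier (mat_alg n A)"
      using bij_betwE[OF bij'] mat_alg_entry[of _ n A'] by (intro Pi_I mat_algI) auto
    show "?\<Psi> (?\<Phi> M) = M" if "M \<in> carrier (mat_alg n A)" for M
      using that entry[OF that] bij_betw_inv_into_left[OF bij] mat_alg_extensional(6)[OF that]
      by (intro mat_alg_eqI[where n = n]) auto
    show "?\<Phi> (?\<Psi> M) = M" if "M \<in> carrier (mat_alg n A')" for M
      using that mat_alg_entry[OF that] bij_betw_inv_into_right[OF bij] mat_alg_extensional(6)[OF that]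
      by (intro mat_alg_eqI[where n = n]) auto
  qed
  moreover have "?\<Phi> \<in> ring_hom (mat_alg n A) (mat_alg n A')"
  proof (rule ring_hom_memI)
    fix M N assume M: "M \<in> carrier (mat_alg n A)" and N: "N \<in> carrier (mat_alg n A)"
    show "?\<Phi> (M \<otimes>\<^bsub>mat_alg n A\<^esub> N) = ?\<Phi> M \<otimes>\<^bsub>mat_alg n A'\<^esub> ?\<Phi> N"
    proof (rule mat_alg_eqI[where n = n])
      fix i j assume ij: "i < n" "j < n"
      have "\<phi> (\<Oplus>\<^bsub>A\<^esub>k\<in>{..<n}. M (i, k) \<otimes>\<^bsub>A\<^esub> N (k, j)) = (\<Oplus>\<^bsub>A'\<^esub>k\<in>{..<n}. \<phi> (M (i, k) \<otimes>\<^bsub>A\<^esub> N (k, j)))"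
        by (rule additive_finsum[OF Ar.abelian_monoid_axioms Ar'.abelian_monoid_axioms])
          (use entry[OF M] entry[OF N] ij in auto)
      also have "\<dots> = (\<Oplus>\<^bsub>A'\<^esub>k\<in>{..<n}. ?\<Phi> M (i, k) \<otimes>\<^bsub>A'\<^esub> ?\<Phi> N (k, j))"
        using entry[OF M] entry[OF N] ij by (intro Ar'.finsum_cong') auto
      finally show "?\<Phi> (M \<otimes>\<^bsub>mat_alg n A\<^esub> N) (i, j) = (?\<Phi> M \<otimes>\<^bsub>mat_alg n A'\<^esub> ?\<Phi> N) (i, j)"
        using ij by (simp add: mat_alg_ops)
    qed (simp_all add: mat_alg_extensional)
    show "?\<Phi> (M \<oplus>\<^bsub>mat_alg n A\<^esub> N) = ?\<Phi> M \<oplus>\<^bsub>mat_alg n A'\<^esub> ?\<Phi> N"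
      by (rule mat_alg_eqI[where n = n]) (simp_all add: mat_alg_extensional mat_alg_ops entry[OF M] entry[OF N])
  next
    show "?\<Phi> \<one>\<^bsub>mat_alg n A\<^esub> = \<one>\<^bsub>mat_alg n A'\<^esub>"
      by (rule mat_alg_eqI[where n = n]) (simp_all add: mat_alg_extensional mat_alg_ops)
  qed (rule closed)
  moreover have "?\<Phi> (\<alpha> \<odot>\<^bsub>mat_alg n A\<^esub> M) = \<sigma> \<alpha> \<odot>\<^bsub>mat_alg n A'\<^esub> ?\<Phi> M"
    if "\<alpha> \<in> carrier F" and M: "M \<in> carrier (mat_alg n A)" for \<alpha> M
    using \<phi> that(1) by (intro mat_alg_eqI[where n = n])
      (simp_all add: mat_alg_extensional mat_alg_ops entry[OF M] semilinear_iso_def)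
  ultimately show ?thesis by (simp add: semilinear_iso_def ring_iso_def)
qed

text \<open>The counting principle: if the invariant \<open>r\<close> takes countably many values and determines \<open>f\<close>, then so
does \<open>f\<close>.\<close>

lemma countable_image_if_determined:
  assumes "countable D" "r ` U \<subseteq> D" "\<And>x y. x \<in> U \<Longrightarrow> y \<in> U \<Longrightarrow> r x = r y \<Longrightarrow> f x = f y"
  shows "countable (f ` U)"
proof -
  let ?g = "\<lambda>d. f (SOME x. x \<in> U \<and> r x = d)"
  have "f x = ?g (r x)" if x: "x \<in> U" for x
  proof -
    have "(SOME y. y \<in> U \<and> r y = r x) \<in> U \<and> r (SOME y. y \<in> U \<and> r y = r x) = r x"
      by (rule someI[of _ x]) (use x in simp)
    then show ?thesis using assms(3)[of x] x by metis
  qed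
  then have "f ` U \<subseteq> ?g ` D" using assms(2) by blast
  then show ?thesis using assms(1) by (meson countable_image countable_subset)
qed

lemma countable_free_alg_over_countable:
  assumes "countable C"
  shows "countable {p \<in> carrier (free_alg F m). range p \<subseteq> C}"
proof -
  let ?graph = "\<lambda>p. {(w, p w) | w. p w \<noteq> \<zero>\<^bsub>F\<^esub>}"
  have "inj ?graph"
  proof (rule injI, rule ext)
    fix p q w assume "?graph p = ?graph q"
    then have "(w, x) \<in> ?graph p \<longleftrightarrow> (w, x) \<in> ?graph q" for x by simp
    then show "p w = q w" by simp metis
  qed
  moreover have "?graph ` {p \<in> carrier (free_alg F m). range p \<subseteq> C} \<subseteq> {S. S \<subseteq> UNIV \<times> C \<and> finite S}"
    by (auto simp: free_alg_simps)
  moreover have "countable {S. S \<subseteq> (UNIV :: nat list set) \<times> C \<and> finite S}"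
    using countable_Collect_finite_subset[of "(UNIV :: nat list set) \<times> C"] assms by (simp add: conj_commute)
  ultimately have "countable (?graph ` {p \<in> carrier (free_alg F m). range p \<subseteq> C})"
    by (rule_tac countable_subset)
  then show ?thesis
    using \<open>inj ?graph\<close> inj_on_subset[OF _ subset_UNIV] by (intro countable_image_inj_on[of ?graph]) auto
qed

lemma countable_PiE_const:
  assumes "finite I" "countable S"
  shows "countable (I \<rightarrow>\<^sub>E S)"
proof -
  let ?graph = "\<lambda>f. (\<lambda>x. (x, f x)) ` I"
  have "?graph ` (I \<rightarrow>\<^sub>E S) \<subseteq> {B. finite B \<and> B \<subseteq> I \<times> S}" using assms(1) by (auto simp: PiE_iff)
  moreover have "countable {B. finite B \<and> B \<subseteq> I \<times> S}"
    using assms by (intro countable_Collect_finite_subset countable_SIGMA) (auto intro: countable_finite)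
  ultimately have "countable (?graph ` (I \<rightarrow>\<^sub>E S))" by (rule countable_subset)
  moreover have "inj_on ?graph (I \<rightarrow>\<^sub>E S)"
  proof (rule inj_onI)
    fix f g assume f: "f \<in> I \<rightarrow>\<^sub>E S" and g: "g \<in> I \<rightarrow>\<^sub>E S" and eq: "?graph f = ?graph g"
    have "f x = g x" if "x \<in> I" for x
      using eq that by (auto simp: set_eq_iff image_iff)
    then show "f = g" by (rule PiE_ext[OF f g])
  qed
  ultimately show ?thesis by (rule countable_image_inj_on)
qed

text \<open>The invariant \<open>r\<close> assigns to an algebra a size \<open>n\<close> and a matrix over \<open>A\<close> such that the algebra is
semilinearly isomorphic to the corner at that matrix. All entries are values of polynomials with
coefficients in the countable set \<open>C\<close>, which leaves only countably many matrices.\<close>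

theorem morita_class_countable_up_to_semilinear:
  fixes F :: "'f ring" and A :: "('f, 'a) module"
  assumes F: "algebraically_closed F" and fp: "finitely_presented F A"
  obtains D and r :: "('f, 'b) module \<Rightarrow> nat \<times> (nat \<times> nat \<Rightarrow> 'a)"
  where "countable D" "r ` morita_class F A \<subseteq> D"
    "\<And>B C. B \<in> morita_class F A \<Longrightarrow> C \<in> morita_class F A \<Longrightarrow> r B = r C \<Longrightarrow> semilinearly_isomorphic F B C"
proof -
  interpret F: algebraically_closed F by fact
  have A: "assoc_algebra F A" using fp by (simp add: finitely_presented_def)
  obtain m a S where a: "a \<in> {..<m} \<rightarrow> carrier A"
    and surj: "eval_free F A a ` carrier (free_alg F m) = carrier A"
    and S: "finite S" "S \<subseteq> carrier (free_alg F m)"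
    and ker: "a_kernel (free_alg F m) A (eval_free F A a) = Idl\<^bsub>free_alg F m\<^esub> S"
    using fp unfolding finitely_presented_def by blast
  interpret P: presented_algebra F A m a S
    unfolding presented_algebra_def generated_algebra_def generated_algebra_axioms_def
      presented_algebra_axioms_def
    using A a surj S ker by simp
  let ?ev = "eval_free F A a" and ?I = "\<lambda>n::nat. {..<n} \<times> {..<n}"
  have K: "countable (\<Union>p\<in>S. range p)" "(\<Union>p\<in>S. range p) \<subseteq> carrier F"
    using S P.free_range by (auto intro: countable_finite)
  obtain C where C: "countable C" "C \<subseteq> carrier F"
    and move: "\<And>T. finite T \<Longrightarrow> T \<subseteq> carrier F \<Longrightarrow>
      \<exists>\<tau>\<in>ring_iso F F. (\<forall>x\<in>(\<Union>p\<in>S. range p). \<tau> x = x) \<and> \<tau> ` T \<subseteq> C"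
    using F.exists_countable_set_meeting_orbits[OF K] by blast
  define A1 where "A1 = ?ev ` {p \<in> carrier (free_alg F m). range p \<subseteq> C}"
  define D where "D = (SIGMA n:UNIV. ?I n \<rightarrow>\<^sub>E A1)"
  have "countable A1" unfolding A1_def using C(1) by (intro countable_image countable_free_alg_over_countable)
  then have D: "countable D" unfolding D_def by (intro countable_SIGMA countable_PiE_const) auto
  have key: "\<exists>d\<in>D. semilinearly_isomorphic F B (corner (mat_alg (fst d) A) (snd d))"
    if "B \<in> morita_class F A" for B :: "('f, 'b) module"
  proof -
    have B: "assoc_algebra F B" and "morita_equivalent F A B" using that by (simp_all add: morita_class_def)
    then obtain \<sigma> where \<sigma>: "\<sigma> \<in> carrier (field_Aut F)" "linearly_morita_equivalent F A (twist \<sigma> B)"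
      by (auto simp: morita_equivalent_def)
    have tB: "assoc_algebra F (twist \<sigma> B)" using twist_assoc_algebra[OF B \<sigma>(1)] .
    obtain n E where E: "E \<in> carrier (mat_alg n A)" "alg_isomorphic F (twist \<sigma> B) (corner (mat_alg n A) E)"
      using linearly_morita_equivalent_imp_matrix_corner[OF A tB \<sigma>(2)] .
    have "\<exists>p\<in>carrier (free_alg F m). ?ev p = E x" if "x \<in> ?I n" for x
    proof -
      have "E x \<in> carrier A" using that E(1) mat_alg_entry by (cases x) auto
      then have "E x \<in> ?ev ` carrier (free_alg F m)" using surj by simp
      then obtain p where "E x = ?ev p" "p \<in> carrier (free_alg F m)" by (rule imageE)
      then show ?thesis by (intro bexI[of _ p]) simp_all
    qed
    then obtain q where q: "\<And>x. x \<in> ?I n \<Longrightarrow> q x \<in> carrier (free_alg F m) \<and> ?ev (q x) = E x"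
      by metis
    have fin: "finite (range p)" if "p \<in> carrier (free_alg F m)" for p
    proof -
      have "range p \<subseteq> insert \<zero>\<^bsub>F\<^esub> (p ` {w. p w \<noteq> \<zero>\<^bsub>F\<^esub>})" by auto
      then show ?thesis using P.free_support[OF that] by (meson finite_imageI finite_insert finite_subset)
    qed
    have T: "finite (\<Union>x\<in>?I n. range (q x))" "(\<Union>x\<in>?I n. range (q x)) \<subseteq> carrier F"
      using q fin P.free_range by blast+
    \<comment> \<open>the coefficients of all entries of \<open>E\<close>, moved into \<open>C\<close> without touching the relators\<close>
    obtain \<tau> where \<tau>: "\<tau> \<in> ring_iso F F" "\<forall>x\<in>(\<Union>p\<in>S. range p). \<tau> x = x"
      "\<tau> ` (\<Union>x\<in>?I n. range (q x)) \<subseteq> C"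
      using move[OF T] by (elim bexE conjE)
    have "\<forall>p\<in>S. \<forall>w. \<tau> (p w) = p w" using \<tau>(2) by blast
    then obtain \<phi> where \<phi>: "\<phi> \<in> semilinear_iso F \<tau> A A"
      "\<And>p. p \<in> carrier (free_alg F m) \<Longrightarrow> \<phi> (?ev p) = ?ev (\<tau> \<circ> p)"
      using P.induced_semilinear_automorphism[OF \<tau>(1)] by blast
    let ?E = "\<lambda>x\<in>?I n. \<phi> (E x)"
    have Mr: "ring (mat_alg n A)" using assoc_algebra_mat_alg[OF A] by (simp add: assoc_algebra_def)
    have cl: "\<tau> \<alpha> \<in> carrier F" if "\<alpha> \<in> carrier F" for \<alpha> using ring_iso_memE(1)[OF \<tau>(1) that] .
    have EE': "semilinearly_isomorphic F (corner (mat_alg n A) E) (corner (mat_alg n A) ?E)"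
      using semilinearly_isomorphicI[OF \<tau>(1)
          semilinear_iso_corner[OF Mr E(1) semilinear_iso_mat_alg[OF cl A A \<phi>(1)]] F.ring_axioms] .
    have BB': "semilinearly_isomorphic F B (twist \<sigma> B)"
      using semilinearly_isomorphic_sym[OF F.ring_axioms tB
          twist_semilinearly_isomorphic[OF F.ring_axioms \<sigma>(1)]] .
    note trans = semilinearly_isomorphic_trans[OF F.ring_axioms]
    have "semilinearly_isomorphic F B (corner (mat_alg n A) ?E)"
      using trans[OF BB' trans[OF alg_isomorphic_imp_semilinearly_isomorphic[OF F.ring_axioms E(2)] EE']] .
    moreover have "(n, ?E) \<in> D"
    proof -
      have "\<phi> (E x) \<in> A1" if x: "x \<in> ?I n" for x
      proof -
        have "\<tau> \<circ> q x \<in> carrier (free_alg F m)"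
          using ring_hom_memE(1)[OF free_alg_coefficient_hom[OF F.is_cring \<tau>(1)]] q[OF x] by simp
        moreover have "range (\<tau> \<circ> q x) \<subseteq> C" using \<tau>(3) x by auto
        moreover have "\<phi> (E x) = ?ev (\<tau> \<circ> q x)" using \<phi>(2) q[OF x] by metis
        ultimately show ?thesis unfolding A1_def by blast
      qed
      then show ?thesis by (auto simp: D_def)
    qed
    ultimately show ?thesis by force
  qed
  define r :: "('f, 'b) module \<Rightarrow> nat \<times> (nat \<times> nat \<Rightarrow> 'a)" where
    "r B = (SOME d. d \<in> D \<and> semilinearly_isomorphic F B (corner (mat_alg (fst d) A) (snd d)))" for B
  have r: "r B \<in> D \<and> semilinearly_isomorphic F B (corner (mat_alg (fst (r B)) A) (snd (r B)))"
    if "B \<in> morita_class F A" for B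
    unfolding r_def by (rule someI_ex) (use key[OF that] in blast)
  have iso: "semilinearly_isomorphic F B C"
    if B: "B \<in> morita_class F A" and C: "C \<in> morita_class F A" and eq: "r B = r C" for B C
  proof -
    have "assoc_algebra F C" using C by (simp add: morita_class_def)
    then have "semilinearly_isomorphic F (corner (mat_alg (fst (r C)) A) (snd (r C))) C"
      using conjunct2[OF r[OF C]] by (rule semilinearly_isomorphic_sym[OF F.ring_axioms])
    then show ?thesis
      using semilinearly_isomorphic_trans[OF F.ring_axioms conjunct2[OF r[OF B]]] eq by simp
  qed
  have "r ` morita_class F A \<subseteq> D" using r by blast
  then show thesis by (rule that[OF D _ iso])
qed

text \<open>A semilinear isomorphism from \<open>B\<close> to \<open>C\<close> is a linear one to a twist of \<open>C\<close>, and twists stay in the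
orbit.\<close>

lemma orbit_eq_if_semilinearly_isomorphic:
  fixes F :: "'f ring" and A :: "('f, 'a) module" and B C :: "('f, 'b) module"
  assumes F: "ring F" and B: "B \<in> morita_class F A" and C: "C \<in> morita_class F A"
    and BC: "semilinearly_isomorphic F B C"
  shows "orbit (field_Aut F) (Aut_action F A) (alg_iso_class F B)
    = orbit (field_Aut F) (Aut_action F A) (alg_iso_class F C)"
proof -
  interpret G: group "field_Aut F" using F by (rule group_field_Aut)
  interpret act: group_action "field_Aut F"
    "morita_iso_classes F A :: ('f, 'b) module set set" "Aut_action F A"
    using F by (rule Aut_action_group_action)
  have alg: "assoc_algebra F B" "assoc_algebra F C" using B C by (simp_all add: morita_class_def)
  have sub: "orbit (field_Aut F) (Aut_action F A) (alg_iso_class F B)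
    \<subseteq> orbit (field_Aut F) (Aut_action F A) (alg_iso_class F C)"
    if B: "B \<in> morita_class F A" and C: "C \<in> morita_class F A" and BC: "semilinearly_isomorphic F B C"
    for B C :: "('f, 'b) module"
  proof
    fix K assume "K \<in> orbit (field_Aut F) (Aut_action F A) (alg_iso_class F B)"
    then obtain g where g: "g \<in> carrier (field_Aut F)" "K = Aut_action F A g (alg_iso_class F B)"
      by (auto simp: orbit_def)
    obtain \<sigma> where \<sigma>: "\<sigma> \<in> carrier (field_Aut F)" "alg_isomorphic F B (twist \<sigma> C)"
      using BC by (auto simp: semilinearly_isomorphic_iff_twist)
    have alg: "assoc_algebra F B" "assoc_algebra F C" using B C by (simp_all add: morita_class_def)
    let ?s = "inv\<^bsub>field_Aut F\<^esub> \<sigma>"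
    have "alg_iso_class F B = alg_iso_class F (twist \<sigma> C)"
      using \<sigma> alg twist_assoc_algebra by (subst alg_iso_class_eq_iff) auto
    also have "\<dots> = Aut_action F A ?s (alg_iso_class F C)"
      using Aut_action_iso_class[OF F _ C, of ?s] \<sigma>(1) by simp
    finally have "K = Aut_action F A (g \<otimes>\<^bsub>field_Aut F\<^esub> ?s) (alg_iso_class F C)"
      using g \<sigma>(1) C act.composition_rule[of "alg_iso_class F C" g ?s]
      by (simp add: morita_iso_classes_def)
    then show "K \<in> orbit (field_Aut F) (Aut_action F A) (alg_iso_class F C)"
      using g(1) \<sigma>(1) unfolding orbit_def by blast
  qed
  show ?thesis
    using sub[OF B C BC] sub[OF C B semilinearly_isomorphic_sym[OF F alg(1) BC]] by blast
qed

theorem theorem1: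
  fixes F :: "'f ring" and A :: "('f, 'a) module"
  assumes "algebraically_closed F"
    and "finitely_presented F A"
  shows "countable (orbits (field_Aut F)
           (morita_iso_classes F A :: ('f, 'b) module set set) (Aut_action F A)) \<and>
         countable ((morita_class F A :: ('f, 'b) module set) // semilinear_rel F A)"
proof -
  interpret F: algebraically_closed F by fact
  note F = F.ring_axioms
  let ?M = "morita_class F A :: ('f, 'b) module set"
  obtain D and r :: "('f, 'b) module \<Rightarrow> nat \<times> (nat \<times> nat \<Rightarrow> 'a)" where D: "countable D" "r ` ?M \<subseteq> D"
    and r: "\<And>B C. B \<in> ?M \<Longrightarrow> C \<in> ?M \<Longrightarrow> r B = r C \<Longrightarrow> semilinearly_isomorphic F B C"
    by (rule morita_class_countable_up_to_semilinear[OF assms]) blast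
  have "countable ((\<lambda>B. orbit (field_Aut F) (Aut_action F A) (alg_iso_class F B)) ` ?M)"
    by (rule countable_image_if_determined[OF D]) (intro orbit_eq_if_semilinearly_isomorphic F r)
  moreover have "countable ((\<lambda>B. semilinear_rel F A `` {B}) ` ?M)"
  proof (rule countable_image_if_determined[OF D])
    fix B C assume B: "B \<in> ?M" and C: "C \<in> ?M" and eq: "r B = r C"
    have BC: "semilinearly_isomorphic F B C" "semilinearly_isomorphic F C B"
      using r B C eq by simp_all
    then show "semilinear_rel F A `` {B} = semilinear_rel F A `` {C}"
      using B C semilinearly_isomorphic_trans[OF F] unfolding semilinear_rel_def by blast
  qed
  moreover have "orbits (field_Aut F) (morita_iso_classes F A) (Aut_action F A)
      = (\<lambda>B. orbit (field_Aut F) (Aut_action F A) (alg_iso_class F B)) ` ?M"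
    by (auto simp: orbits_def morita_iso_classes_def)
  moreover have "?M // semilinear_rel F A = (\<lambda>B. semilinear_rel F A `` {B}) ` ?M"
    by (auto simp: quotient_def)
  ultimately show ?thesis by simp
qed

end
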